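(* Let $m<s\leq n$ ($m$ a positive integer, $m<n$) and let $A\subset\mathbb{R}^{n}$ be $\mathcal H^s$ measurable with $0<\mathcal H^s(A)<\infty$. Then the set $B \subset \mathbb{R}^{n}$ of points $x \in \mathbb{R}^{n}$ with $$\gamma_{n,n-m}(\{V\in G(n,n-m):\dim (A\cap(V+x))=s-m\}) =0 $$ satisfies $\dim B \leq m$.
   Context: $\dim$ denotes Hausdorff dimension and $\mathcal H^s$ the $s$-dimensional Hausdorff measure. $G(n,k)$ is the Grassmannian of $k$-dimensional linear subspaces of $\mathbb{R}^n$ and $\gamma_{n,k}$ its orthogonally invariant Borel probability measure. $V+x$ is the affine plane through $x$ parallel to $V$. *)

theory Defs
  imports "HOL-Analysis.Analysis" "HOL-Probability.Probability"
begin

text \<open>Contribution (diam C)^s of a covering set C, with the usual conventions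
  diam(empty)^s = 0 and 0^0 = 1 (so that H^0 is counting measure).\<close>
definition hcontent :: "real \<Rightarrow> 'a::metric_space set \<Rightarrow> real" where
  "hcontent s C =
     (if C = {} then 0
      else if diameter C = 0 then (if s = 0 then 1 else 0)
      else diameter C powr s)"

definition hausdorff_pre :: "real \<Rightarrow> real \<Rightarrow> 'a::metric_space set \<Rightarrow> ennreal" where
  "hausdorff_pre s \<delta> A =
     (INF C \<in> {C :: nat \<Rightarrow> 'a set. A \<subseteq> (\<Union>i. C i) \<and>
                 (\<forall>i. bounded (C i) \<and> diameter (C i) \<le> \<delta>)}.
        (\<Sum>i. ennreal (hcontent s (C i))))"

definition hausdorff_measure :: "real \<Rightarrow> 'a::metric_space set \<Rightarrow> ennreal" where
  "hausdorff_measure s A = (SUP \<delta> \<in> {0<..}. hausdorff_pre s \<delta> A)"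

definition hausdorff_measurable :: "real \<Rightarrow> 'a::metric_space set \<Rightarrow> bool" where
  "hausdorff_measurable s A \<longleftrightarrow>
     (\<forall>E. hausdorff_measure s E = hausdorff_measure s (E \<inter> A) + hausdorff_measure s (E - A))"

definition hausdorff_dim :: "'a::metric_space set \<Rightarrow> real" where
  "hausdorff_dim A = Inf {t. 0 \<le> t \<and> hausdorff_measure t A = 0}"

definition grassmannian :: "nat \<Rightarrow> 'a::euclidean_space set set" where
  "grassmannian k = {V. subspace V \<and> dim V = k}"

text \<open>Gap metric between linear subspaces (Hausdorff distance of the unit balls).\<close>
definition grass_gap :: "'a::euclidean_space set \<Rightarrow> 'a set \<Rightarrow> real" where
  "grass_gap V W =
     max (SUP x \<in> V \<inter> cball 0 1. infdist x W) (SUP y \<in> W \<inter> cball 0 1. infdist y V)"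

definition grass_open :: "nat \<Rightarrow> 'a::euclidean_space set set \<Rightarrow> bool" where
  "grass_open k U \<longleftrightarrow> U \<subseteq> grassmannian k \<and>
     (\<forall>V\<in>U. \<exists>e>0. \<forall>W\<in>grassmannian k. grass_gap V W < e \<longrightarrow> W \<in> U)"

definition grass_borel :: "nat \<Rightarrow> 'a::euclidean_space set measure" where
  "grass_borel k = sigma (grassmannian k) {U. grass_open k U}"

text \<open>gamma is an orthogonally invariant Borel probability measure on G(n,k)
  (such a measure exists and is unique).\<close>
definition grass_invariant_prob :: "nat \<Rightarrow> 'a::euclidean_space set measure \<Rightarrow> bool" where
  "grass_invariant_prob k \<gamma> \<longleftrightarrow>
     prob_space \<gamma> \<and> sets \<gamma> = sets (grass_borel k) \<and>
     (\<forall>f. orthogonal_transformation f \<longrightarrow>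
        (\<forall>S\<in>sets \<gamma>. (\<lambda>V. f ` V) ` S \<in> sets \<gamma> \<and>
                     emeasure \<gamma> ((\<lambda>V. f ` V) ` S) = emeasure \<gamma> S))"

end

theory Submission
  imports Defs
begin

text \<open>A Frostman measure \<open>\<mu>\<close> on a compact subset C of A is smeared by Gaussians transversal to the planes
  V + y. The average over V of the Gaussian kernel at z is comparable to \<open>|z|\<close> to the power -m, so the
  finite m-energy of \<open>\<mu>\<close> makes the smeared densities Cauchy in the square mean on the bundle of all
  planes. A plane is thin if its intersection with C has small \<open>\<tau>\<close>-content for some \<open>\<tau>\<close> below s - m.
  By Cauchy-Schwarz and the finiteness of the (\<open>\<tau>\<close> + m)-energy of \<open>\<mu>\<close>, the densities have little mass
  on thin planes.

  Almost every plane through an exceptional point x is thin, since almost every slice of A has dimension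
  at most s - m. Thinness is an open condition, so narrow Gaussian pencils of planes around x consist
  mostly of thin planes. If the exceptional set had positive t-content for some t above m, it would carry
  measures \<open>\<nu>\<close> with bounded m-energies. The smeared densities of \<open>\<nu>\<close> are then bounded in the square mean
  and live mostly on thin planes, so their pairing with the densities of \<open>\<mu>\<close> is small. But this pairing
  is the mutual m-energy of \<open>\<mu>\<close> and \<open>\<nu>\<close>, which is bounded below.

  The exceptional set need not be measurable. Therefore \<open>\<nu>\<close> is a sum of finitely many point masses,
  constructed at the dyadic scale of the smearing.\<close>

section \<open>Orthogonal coordinates\<close>

text \<open>Orthogonal invariance is all that is known of \<open>\<gamma>\<close>. Bounds for the
  averaged kernel therefore come from testing it against isotropic Gaussians, whose integral against
  the kernel is the same for every V; radial monotonicity turns these integrals into pointwise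
  bounds.

  Square-mean convergence of the smeared densities is read off from the energies: as a function of
  the squared scale, the energy has second differences proportional to squared distances of
  densities. So it is midpoint convex, and a bounded function of this kind is monotone.

  The scale from which a thin plane shows its thinness depends on the plane, so the bound on thin
  planes passes through Fatou. For the same reason thick pencils do not vanish uniformly in x. On a
  possibly non-measurable set the increasing sets lemma for the dyadic content takes the place of
  Egorov's theorem.

  The final estimate freezes \<open>\<mu>\<close> at a scale \<open>1 / 2 ^ i\<close> fixed before
  \<open>\<nu>\<close>: this bounds the smeared density of \<open>\<mu>\<close> independently of the
  scale of \<open>\<nu>\<close>, which is chosen afterwards and as fine as desired.\<close>

lemma orthonormal_expand:
  fixes B :: "'a::euclidean_space set"
  assumes "pairwise orthogonal B" "\<And>x. x \<in> B \<Longrightarrow> norm x = 1" "finite B" "x \<in> span B"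
  shows "(\<Sum>b\<in>B. (x \<bullet> b) *\<^sub>R b) = x"
proof -
  have *: "b \<bullet> c = (if b = c then 1 else 0)" if "b \<in> B" "c \<in> B" for b c
    using assms(1,2) that by (auto simp: pairwise_def orthogonal_def norm_eq_1)
  show ?thesis
    using assms(4)
  proof (induction rule: span_induct_alt)
    case base
    show ?case by simp
  next
    case (step c b y)
    have "(\<Sum>d\<in>B. (b \<bullet> d) *\<^sub>R d) = (\<Sum>d\<in>B. if b = d then d else 0)"
      using step by (intro sum.cong) (auto simp: *)
    also have "\<dots> = b"
      using step assms(3) by (simp add: sum.delta)
    finally have "(\<Sum>d\<in>B. (b \<bullet> d) *\<^sub>R d) = b" .
    then show ?case
      using step by (simp add: inner_add_left scaleR_add_left sum.distrib flip: scaleR_scaleR scaleR_sum_right)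
  qed
qed

text \<open>Orthonormal bases of V and of its orthogonal complement W form a basis of the whole
  space; \<open>g\<close> matches it with the standard one, and \<open>I\<close> collects the
  coordinates belonging to W. Gaussians in the distance to V thus factor into one-dimensional
  ones.\<close>

lemma coordinates_infdist:
  fixes V :: "(real^'n) set"
  assumes "V \<in> grassmannian (CARD('n) - m)" "m \<le> CARD('n)"
  obtains g :: "real^'n \<Rightarrow> real^'n" and I where "orthogonal_transformation g" "I \<subseteq> Basis" "card I = m"
    "\<And>x. (infdist x V)\<^sup>2 = (\<Sum>i\<in>I. (g x \<bullet> i)\<^sup>2)"
proof -
  have V: "subspace V" "dim V = CARD('n) - m"
    using assms by (auto simp: grassmannian_def)
  define W where "W = {y. \<forall>x\<in>V. orthogonal x y}"
  have W: "subspace W"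
    unfolding W_def by (simp add: subspace_orthogonal_to_vectors)
  have dW: "dim W = m"
    using dim_subspace_orthogonal_to_vectors[OF V(1), of UNIV] V(2) assms(2) by (simp add: W_def)
  obtain B1 where B1: "B1 \<subseteq> V" "pairwise orthogonal B1" "\<And>x. x \<in> B1 \<Longrightarrow> norm x = 1"
    "independent B1" "card B1 = dim V" "span B1 = V"
    using orthonormal_basis_subspace[OF V(1)] by metis
  obtain B2 where B2: "B2 \<subseteq> W" "pairwise orthogonal B2" "\<And>x. x \<in> B2 \<Longrightarrow> norm x = 1"
    "independent B2" "card B2 = dim W" "span B2 = W"
    using orthonormal_basis_subspace[OF W] by metis
  have fin: "finite B1" "finite B2"
    using B1(4) B2(4) independent_imp_finite by auto
  have orth: "orthogonal x y" if "x \<in> B1" "y \<in> B2" for x y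
    using that B1(1) B2(1) by (auto simp: W_def)
  have disj: "B1 \<inter> B2 = {}"
    using orth B1(3) by (force simp: orthogonal_def norm_eq_1)
  define B where "B = B1 \<union> B2"
  have finB: "finite B" using fin by (simp add: B_def)
  have Bn: "\<And>x. x \<in> B \<Longrightarrow> norm x = 1"
    using B1(3) B2(3) by (auto simp: B_def)
  have Bo: "pairwise orthogonal B"
    using B1(2) B2(2) orth orthogonal_commute unfolding B_def pairwise_def by blast
  have cB: "card B = CARD('n)"
    using fin disj B1(5) B2(5) V(2) dW assms(2) by (simp add: B_def card_Un_disjoint)
  have indB: "independent B"
    using Bo Bn by (intro pairwise_orthogonal_independent) force+
  have spB: "span B = UNIV"
    using card_ge_dim_independent[of B UNIV] indB cB by auto
  have inn: "b \<bullet> c = (if b = c then 1 else 0)" if "b \<in> B" "c \<in> B" for b c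
    using Bo Bn that by (auto simp: pairwise_def orthogonal_def norm_eq_1)
  have expand: "(\<Sum>b\<in>B. (x \<bullet> b) *\<^sub>R b) = x" for x
    using orthonormal_expand[OF Bo Bn finB] spB by auto
  have parseval: "x \<bullet> y = (\<Sum>b\<in>B. (x \<bullet> b) * (y \<bullet> b))" for x y
  proof -
    have "x \<bullet> y = (\<Sum>b\<in>B. (x \<bullet> b) *\<^sub>R b) \<bullet> y" by (simp add: expand)
    also have "\<dots> = (\<Sum>b\<in>B. (x \<bullet> b) * (b \<bullet> y))" by (simp only: inner_sum_left inner_scaleR_left)
    finally show ?thesis by (simp only: inner_commute[of y])
  qed
  obtain h where h: "bij_betw h (Basis :: (real^'n) set) B"
    using finite_same_card_bij[of "Basis :: (real^'n) set" B] finB cB by auto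
  define I where "I = {i\<in>Basis. h i \<in> B2}"
  define g where "g x = (\<Sum>i\<in>Basis. (x \<bullet> h i) *\<^sub>R i)" for x
  have gi: "g x \<bullet> i = x \<bullet> h i" if "i \<in> Basis" for x i
    using that by (simp add: g_def)
  have hI: "bij_betw h I B2"
    using h by (auto simp: I_def bij_betw_def inj_on_def B_def)
  have "orthogonal_transformation g"
    unfolding orthogonal_transformation_def
  proof (intro conjI allI)
    show "linear g"
      unfolding g_def
      by (rule linearI) (simp_all add: inner_add_left scaleR_add_left sum.distrib scaleR_sum_right)
  next
    fix v w
    have "g v \<bullet> g w = (\<Sum>i\<in>Basis. (v \<bullet> h i) * (w \<bullet> h i))"
      by (subst euclidean_inner) (simp add: gi)
    also have "\<dots> = (\<Sum>b\<in>B. (v \<bullet> b) * (w \<bullet> b))"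
      using sum.reindex_bij_betw[OF h, of "\<lambda>b. (v \<bullet> b) * (w \<bullet> b)"] by simp
    finally show "g v \<bullet> g w = v \<bullet> w" by (simp only: parseval[of v w])
  qed
  moreover have "(infdist x V)\<^sup>2 = (\<Sum>i\<in>I. (g x \<bullet> i)\<^sup>2)" for x
  proof -
    define p where "p = (\<Sum>b\<in>B1. (x \<bullet> b) *\<^sub>R b)"
    have p: "p \<in> V"
      unfolding p_def using B1(1) V(1) by (intro subspace_sum subspace_scale) auto
    have xp: "x - p = (\<Sum>b\<in>B2. (x \<bullet> b) *\<^sub>R b)"
      using expand[of x] fin disj by (simp add: p_def B_def sum.union_disjoint algebra_simps)
    have xpW: "x - p \<in> W"
      unfolding xp using B2(1) W by (intro subspace_sum subspace_scale) auto
    have le: "norm (x - p) \<le> norm (x - v)" if "v \<in> V" for v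
    proof -
      have "p - v \<in> V" using p that V(1) by (simp add: subspace_diff)
      then have "orthogonal (x - p) (p - v)"
        using xpW by (auto simp: W_def orthogonal_commute)
      then have "(norm (x - v))\<^sup>2 = (norm (x - p))\<^sup>2 + (norm (p - v))\<^sup>2"
        using norm_add_Pythagorean by fastforce
      then show ?thesis by (simp add: power2_le_imp_le)
    qed
    have "infdist x V = norm (x - p)"
    proof (rule antisym)
      show "infdist x V \<le> norm (x - p)"
        using infdist_le[OF p, of x] by (simp add: dist_norm)
      show "norm (x - p) \<le> infdist x V"
        using p by (subst infdist_notempty) (auto simp: dist_norm intro!: cINF_greatest le)
    qed
    then have "(infdist x V)\<^sup>2 = (x - p) \<bullet> (x - p)" by (simp add: power2_norm_eq_inner)
    also have "\<dots> = (\<Sum>b\<in>B2. (x \<bullet> b) * (x \<bullet> b))"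
    proof -
      have xpb: "(x - p) \<bullet> b = (if b \<in> B2 then x \<bullet> b else 0)" if "b \<in> B" for b
      proof -
        have "(x - p) \<bullet> b = (\<Sum>c\<in>B2. (x \<bullet> c) * (c \<bullet> b))"
          unfolding xp by (simp add: inner_sum_left)
        also have "\<dots> = (\<Sum>c\<in>B2. if c = b then x \<bullet> b else 0)"
          using that by (intro sum.cong) (auto simp: inn B_def)
        finally show ?thesis using fin by simp
      qed
      have "(x - p) \<bullet> (x - p) = (\<Sum>b\<in>B. if b \<in> B2 then (x \<bullet> b) * (x \<bullet> b) else 0)"
        by (subst parseval[of "x - p" "x - p"], intro sum.cong) (auto simp: xpb)
      also have "\<dots> = (\<Sum>b\<in>B \<inter> B2. (x \<bullet> b) * (x \<bullet> b))"
        using finB by (simp add: sum.inter_restrict)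
      finally show ?thesis by (simp add: B_def Int_absorb1)
    qed
    also have "\<dots> = (\<Sum>i\<in>I. (x \<bullet> h i) * (x \<bullet> h i))"
      using sum.reindex_bij_betw[OF hI, of "\<lambda>b. (x \<bullet> b) * (x \<bullet> b)"] by simp
    also have "\<dots> = (\<Sum>i\<in>I. (g x \<bullet> i)\<^sup>2)"
      by (intro sum.cong) (auto simp: I_def gi power2_eq_square)
    finally show ?thesis .
  qed
  moreover have "card I = m"
    using bij_betw_same_card[OF hI] B2(5) dW by simp
  moreover have "I \<subseteq> Basis" by (auto simp: I_def)
  ultimately show ?thesis using that by blast
qed

text \<open>Uniqueness of Haar measure, by hand: the image measure is translation invariant and
  agrees with Lebesgue measure on centred balls. Fubini makes two translation invariant measures
  proportional, and the unit ball fixes the factor.\<close>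

lemma lborel_distr_orthogonal:
  fixes g :: "'a::euclidean_space \<Rightarrow> 'a"
  assumes g: "orthogonal_transformation g"
  shows "distr lborel borel g = lborel"
proof -
  have lin: "linear g" and bij: "bij g"
    using g by (auto simp: orthogonal_transformation_linear orthogonal_transformation_bij)
  have [measurable]: "g \<in> borel_measurable borel"
    using lin by (intro borel_measurable_continuous_onI linear_continuous_on linear_conv_bounded_linear[THEN iffD1])
  define M where "M = distr lborel borel g"
  have setsM: "sets M = sets borel" and [simp]: "space M = UNIV" by (simp_all add: M_def)
  have Mball: "emeasure M (ball 0 r) = emeasure lborel (ball (0::'a) r)" for r
  proof -
    have "g -` ball 0 r = ball 0 r"
      using g by (auto simp: orthogonal_transformation_norm)
    then show ?thesis by (simp add: M_def emeasure_distr)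
  qed
  have "sigma_finite_measure M"
  proof (rule sigma_finite_measure.intro, intro exI conjI)
    let ?A = "range (\<lambda>n::nat. ball (0::'a) (real n))"
    show "countable ?A" by simp
    show "?A \<subseteq> sets M" by (auto simp: setsM)
    show "\<Union>?A = space M"
      using reals_Archimedean2 by auto
    show "\<forall>a\<in>?A. emeasure M a \<noteq> \<infinity>"
      using emeasure_bounded_finite[of "ball (0::'a) _"] by (auto simp: Mball less_top)
  qed
  then interpret M: sigma_finite_measure M .
  interpret pair_sigma_finite M "lborel :: 'a measure" ..
  have Mplus: "(\<integral>\<^sup>+x. f (x + c) \<partial>M) = (\<integral>\<^sup>+x. f x \<partial>M)" if [measurable]: "f \<in> borel_measurable borel" for f c
  proof -
    obtain d where d: "g d = c" using bij by (metis bij_def surjD)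
    have "(\<integral>\<^sup>+x. f (x + c) \<partial>M) = (\<integral>\<^sup>+x. f (g (d + x)) \<partial>lborel)"
      unfolding M_def by (subst nn_integral_distr) (auto simp: linear_add[OF lin] d add.commute)
    also have "\<dots> = (\<integral>\<^sup>+x. f (g x) \<partial>distr lborel borel ((+) d))"
      by (subst nn_integral_distr) auto
    also have "\<dots> = (\<integral>\<^sup>+x. f (g x) \<partial>lborel)" by (simp add: lborel_distr_plus)
    also have "\<dots> = (\<integral>\<^sup>+x. f x \<partial>M)"
      unfolding M_def by (subst nn_integral_distr) auto
    finally show ?thesis .
  qed
  have Lplus: "(\<integral>\<^sup>+x. f (c + x) \<partial>lborel) = (\<integral>\<^sup>+x. f x \<partial>lborel)" if [measurable]: "f \<in> borel_measurable borel" for f and c :: 'a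
    using nn_integral_distr[of "(+) c" lborel borel f] by (simp add: lborel_distr_plus)
  \<comment> \<open>Both sides are the double integral of \<open>f x * b (- x + y)\<close>; one
    order is direct, the other follows the shift of x by y, where symmetry of the ball removes the
    sign.\<close>
  have prod: "emeasure M E * emeasure lborel (ball (0::'a) 1) = emeasure lborel E * emeasure M (ball 0 1)"
    if [measurable]: "E \<in> sets borel" for E
  proof -
    have [measurable_cong]: "sets M = sets borel" by (rule setsM)
    define f where "f = (indicator E :: 'a \<Rightarrow> ennreal)"
    define b where "b = (indicator (ball 0 1) :: 'a \<Rightarrow> ennreal)"
    have [measurable]: "f \<in> borel_measurable borel" "b \<in> borel_measurable borel"
      by (auto simp: f_def b_def intro!: borel_measurable_indicator)
    have meas: "(\<lambda>(x, y). f x * b (- x + y)) \<in> borel_measurable (M \<Otimes>\<^sub>M lborel)"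
      "(\<lambda>(x, y). f (x + y) * b x) \<in> borel_measurable (M \<Otimes>\<^sub>M lborel)"
      by measurable
    have "emeasure M E * emeasure lborel (ball (0::'a) 1) = (\<integral>\<^sup>+x. f x \<partial>M) * (\<integral>\<^sup>+y. b y \<partial>lborel)"
      by (simp add: f_def b_def setsM)
    also have "\<dots> = (\<integral>\<^sup>+x. f x * (\<integral>\<^sup>+y. b y \<partial>lborel) \<partial>M)"
      by (rule nn_integral_multc[symmetric]) measurable
    also have "\<dots> = (\<integral>\<^sup>+x. f x * (\<integral>\<^sup>+y. b (- x + y) \<partial>lborel) \<partial>M)"
      by (subst Lplus) auto
    also have "\<dots> = (\<integral>\<^sup>+x. (\<integral>\<^sup>+y. f x * b (- x + y) \<partial>lborel) \<partial>M)"
      by (intro nn_integral_cong nn_integral_cmult[symmetric]) measurable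
    also have "\<dots> = (\<integral>\<^sup>+y. (\<integral>\<^sup>+x. f x * b (- x + y) \<partial>M) \<partial>lborel)"
      using Fubini'[OF meas(1)] by simp
    also have "\<dots> = (\<integral>\<^sup>+y. (\<integral>\<^sup>+x. f (x + y) * b x \<partial>M) \<partial>lborel)"
    proof (rule nn_integral_cong)
      fix y :: 'a
      have "(\<integral>\<^sup>+x. f (x + y) * b (- (x + y) + y) \<partial>M) = (\<integral>\<^sup>+x. f x * b (- x + y) \<partial>M)"
        by (rule Mplus) measurable
      moreover have "b (- (x + y) + y) = b x" for x
        by (simp add: b_def indicator_def)
      ultimately show "(\<integral>\<^sup>+x. f x * b (- x + y) \<partial>M) = (\<integral>\<^sup>+x. f (x + y) * b x \<partial>M)" by simp
    qed
    also have "\<dots> = (\<integral>\<^sup>+x. (\<integral>\<^sup>+y. f (x + y) * b x \<partial>lborel) \<partial>M)"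
      using Fubini'[OF meas(2)] by simp
    also have "\<dots> = (\<integral>\<^sup>+x. (\<integral>\<^sup>+y. f (x + y) \<partial>lborel) * b x \<partial>M)"
      by (intro nn_integral_cong nn_integral_multc) measurable
    also have "\<dots> = (\<integral>\<^sup>+x. (\<integral>\<^sup>+y. f y \<partial>lborel) * b x \<partial>M)"
      by (subst Lplus) auto
    also have "\<dots> = (\<integral>\<^sup>+y. f y \<partial>lborel) * (\<integral>\<^sup>+x. b x \<partial>M)"
      by (rule nn_integral_cmult) measurable
    also have "\<dots> = emeasure lborel E * emeasure M (ball 0 1)"
      by (simp add: f_def b_def setsM)
    finally show ?thesis .
  qed
  have "M = lborel"
  proof (rule measure_eqI)
    fix E assume "E \<in> sets M"
    then have "emeasure M E * emeasure lborel (ball (0::'a) 1) = emeasure lborel E * emeasure lborel (ball (0::'a) 1)"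
      using prod[of E] by (simp add: Mball setsM)
    moreover have "emeasure lborel (ball (0::'a) 1) \<noteq> 0"
      using unit_ball_vol_pos[of "real DIM('a)"] by (auto simp: emeasure_ball simp del: unit_ball_vol_pos)
    moreover have "emeasure lborel (ball (0::'a) 1) \<noteq> \<infinity>"
      using emeasure_lborel_ball_finite[of "0::'a" 1] by simp
    ultimately show "emeasure M E = emeasure lborel E"
    proof -
      let ?u = "emeasure lborel (ball (0::'a) 1)"
      assume "emeasure M E * ?u = emeasure lborel E * ?u" and u: "?u \<noteq> 0" "?u \<noteq> \<infinity>"
      then have "emeasure M E * ?u / ?u = emeasure lborel E * ?u / ?u" by simp
      then show ?thesis using u by (simp add: ennreal_mult_divide_eq)
    qed
  qed (simp add: setsM)
  then show ?thesis by (simp add: M_def)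
qed

section \<open>Gaussian kernels transversal to a subspace\<close>

text \<open>A Gaussian of width \<open>a\<close> on the m-dimensional quotient by V. Only the power
  of \<open>a\<close> is normalised; powers of \<open>sqrt (2 * pi)\<close> are carried along as
  constants.\<close>

definition gauss_kernel :: "nat \<Rightarrow> real \<Rightarrow> (real^'n) set \<Rightarrow> real^'n \<Rightarrow> real" where
  "gauss_kernel m a V x = exp (- (infdist x V)\<^sup>2 / (2 * a\<^sup>2)) / a ^ m"

text \<open>By Pythagoras the exponent is minus half the squared norm of the projection of y to the
  subspace V.\<close>

definition fiber_weight :: "(real^'n) set \<Rightarrow> real^'n \<Rightarrow> real" where
  "fiber_weight V y = exp (- ((norm y)\<^sup>2 - (infdist y V)\<^sup>2) / 2)"

lemma nn_integral_gaussian_real: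
  assumes "0 < \<sigma>"
  shows "(\<integral>\<^sup>+x. ennreal (exp (- (x - c)\<^sup>2 / (2 * \<sigma>\<^sup>2))) \<partial>lborel) = ennreal (sqrt (2 * pi) * \<sigma>)"
proof -
  have "(\<integral>\<^sup>+x. ennreal (exp (- (x - c)\<^sup>2 / (2 * \<sigma>\<^sup>2))) \<partial>lborel)
      = (\<integral>\<^sup>+x. ennreal (sqrt (2 * pi) * \<sigma>) * ennreal (normal_density c \<sigma> x) \<partial>lborel)"
    using assms by (intro nn_integral_cong)
      (simp add: normal_density_def real_sqrt_mult flip: ennreal_mult)
  also have "\<dots> = ennreal (sqrt (2 * pi) * \<sigma>) * (\<integral>\<^sup>+x. ennreal (normal_density c \<sigma> x) \<partial>lborel)"
    by (rule nn_integral_cmult) measurable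
  also have "(\<integral>\<^sup>+x. ennreal (normal_density c \<sigma> x) \<partial>lborel) = 1"
    using assms by (subst nn_integral_eq_integral) auto
  finally show ?thesis by simp
qed

text \<open>Completing the square in u leaves a Gaussian of width \<open>h\<close> about the
  weighted mean \<open>c\<close>, and a factor in z - w in which the variances are added.\<close>

lemma nn_integral_gaussian_product_real:
  fixes a b z w :: real
  assumes "0 < a" "0 < b"
  shows "(\<integral>\<^sup>+u. ennreal (exp (- (u - z)\<^sup>2 / (2 * a\<^sup>2)) / a) * ennreal (exp (- (u - w)\<^sup>2 / (2 * b\<^sup>2)) / b) \<partial>lborel)
       = ennreal (sqrt (2 * pi) * (exp (- (z - w)\<^sup>2 / (2 * (a\<^sup>2 + b\<^sup>2))) / sqrt (a\<^sup>2 + b\<^sup>2)))"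
proof -
  define s where "s = a\<^sup>2 + b\<^sup>2"
  have s: "0 < s" using assms by (simp add: s_def sum_power2_gt_zero_iff)
  define h where "h = a * b / sqrt s"
  define c where "c = (b\<^sup>2 * z + a\<^sup>2 * w) / s"
  have h: "0 < h" "h\<^sup>2 = a\<^sup>2 * b\<^sup>2 / s" using assms s by (auto simp: h_def power_divide power_mult_distrib)
  have sq: "(u - z)\<^sup>2 / (2 * a\<^sup>2) + (u - w)\<^sup>2 / (2 * b\<^sup>2) = (z - w)\<^sup>2 / (2 * s) + (u - c)\<^sup>2 / (2 * h\<^sup>2)" for u
  proof -
    have uc: "u - c = (b\<^sup>2 * (u - z) + a\<^sup>2 * (u - w)) / s"
      using s by (simp add: c_def divide_simps) (simp add: s_def algebra_simps)
    have "(u - c)\<^sup>2 / (2 * h\<^sup>2) = (b\<^sup>2 * (u - z) + a\<^sup>2 * (u - w))\<^sup>2 / (2 * a\<^sup>2 * b\<^sup>2 * s)"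
      unfolding uc h(2) using s assms by (simp add: power2_eq_square field_simps)
    moreover have "(u - z)\<^sup>2 / (2 * a\<^sup>2) + (u - w)\<^sup>2 / (2 * b\<^sup>2)
        = ((u - z)\<^sup>2 * b\<^sup>2 + (u - w)\<^sup>2 * a\<^sup>2) * s / (2 * a\<^sup>2 * b\<^sup>2 * s)"
      using s assms by (simp add: field_simps)
    moreover have "(z - w)\<^sup>2 / (2 * s) = (z - w)\<^sup>2 * a\<^sup>2 * b\<^sup>2 / (2 * a\<^sup>2 * b\<^sup>2 * s)"
      using s assms by (simp add: field_simps)
    moreover have "((u - z)\<^sup>2 * b\<^sup>2 + (u - w)\<^sup>2 * a\<^sup>2) * s
        = (z - w)\<^sup>2 * a\<^sup>2 * b\<^sup>2 + (b\<^sup>2 * (u - z) + a\<^sup>2 * (u - w))\<^sup>2"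
      unfolding s_def by algebra
    ultimately show ?thesis by (simp add: add_divide_distrib)
  qed
  have ex: "exp (- (u - z)\<^sup>2 / (2 * a\<^sup>2)) / a * (exp (- (u - w)\<^sup>2 / (2 * b\<^sup>2)) / b)
      = exp (- (z - w)\<^sup>2 / (2 * s)) / (a * b) * exp (- (u - c)\<^sup>2 / (2 * h\<^sup>2))" for u
  proof -
    have "exp (- (u - z)\<^sup>2 / (2 * a\<^sup>2)) * exp (- (u - w)\<^sup>2 / (2 * b\<^sup>2))
        = exp (- ((u - z)\<^sup>2 / (2 * a\<^sup>2) + (u - w)\<^sup>2 / (2 * b\<^sup>2)))"
      by (simp flip: exp_add)
    also have "\<dots> = exp (- (z - w)\<^sup>2 / (2 * s)) * exp (- (u - c)\<^sup>2 / (2 * h\<^sup>2))"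
      unfolding sq by (simp flip: exp_add)
    finally show ?thesis by (simp add: mult_ac)
  qed
  have "(\<integral>\<^sup>+u. ennreal (exp (- (u - z)\<^sup>2 / (2 * a\<^sup>2)) / a) * ennreal (exp (- (u - w)\<^sup>2 / (2 * b\<^sup>2)) / b) \<partial>lborel)
      = (\<integral>\<^sup>+u. ennreal (exp (- (z - w)\<^sup>2 / (2 * s)) / (a * b)) * ennreal (exp (- (u - c)\<^sup>2 / (2 * h\<^sup>2))) \<partial>lborel)"
    using assms by (intro nn_integral_cong, subst (1 2) ennreal_mult[symmetric]) (simp_all only: ex, auto)
  also have "\<dots> = ennreal (exp (- (z - w)\<^sup>2 / (2 * s)) / (a * b)) * ennreal (sqrt (2 * pi) * h)"
    by (subst nn_integral_cmult, measurable, simp only: nn_integral_gaussian_real[OF h(1)])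
  also have "\<dots> = ennreal (sqrt (2 * pi) * (exp (- (z - w)\<^sup>2 / (2 * s)) / sqrt s))"
    using assms s by (simp add: h_def flip: ennreal_mult)
  finally show ?thesis by (simp add: s_def)
qed

lemma nn_integral_orthogonal_prod:
  fixes g :: "'a::euclidean_space \<Rightarrow> 'a" and f :: "'a \<Rightarrow> real \<Rightarrow> ennreal"
  assumes g: "orthogonal_transformation g" and [measurable]: "\<And>b. b \<in> Basis \<Longrightarrow> f b \<in> borel_measurable borel"
  shows "(\<integral>\<^sup>+x. (\<Prod>b\<in>Basis. f b (g x \<bullet> b)) \<partial>lborel) = (\<Prod>b\<in>Basis. (\<integral>\<^sup>+x. f b x \<partial>lborel))"
proof -
  have [measurable]: "g \<in> borel_measurable borel"
    using orthogonal_transformation_linear[OF g]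
    by (intro borel_measurable_continuous_onI linear_continuous_on linear_conv_bounded_linear[THEN iffD1])
  have "(\<integral>\<^sup>+x. (\<Prod>b\<in>Basis. f b (g x \<bullet> b)) \<partial>lborel) = (\<integral>\<^sup>+x. (\<Prod>b\<in>Basis. f b (x \<bullet> b)) \<partial>distr lborel borel g)"
    by (subst nn_integral_distr) auto
  then show ?thesis
    by (simp add: lborel_distr_orthogonal[OF g] nn_integral_lborel_prod)
qed

context
  fixes V :: "(real^'n) set" and m :: nat
  assumes V: "V \<in> grassmannian (CARD('n) - m)" and m: "m \<le> CARD('n)"
begin

lemma prod_Basis_split:
  assumes "I \<subseteq> (Basis :: (real^'n) set)" "card I = m"
  shows "(\<Prod>i\<in>Basis. if i \<in> I then f i else (h i :: 'b::comm_monoid_mult)) = (\<Prod>i\<in>I. f i) * (\<Prod>i\<in>Basis - I. h i)"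
  using assms(1) by (subst prod.If_cases) (auto simp: Int_absorb1 Diff_eq)

lemma gauss_kernel_coordinates:
  obtains g :: "real^'n \<Rightarrow> real^'n" and I where "orthogonal_transformation g" "I \<subseteq> Basis" "card I = m"
    "\<And>c y z. gauss_kernel m c V (y - z) = (\<Prod>i\<in>I. exp (- (g y \<bullet> i - g z \<bullet> i)\<^sup>2 / (2 * c\<^sup>2)) / c)"
    "\<And>y. fiber_weight V y = (\<Prod>i\<in>Basis - I. exp (- (g y \<bullet> i)\<^sup>2 / (2 * 1\<^sup>2)))"
proof -
  obtain g :: "real^'n \<Rightarrow> real^'n" and I where g: "orthogonal_transformation g" "I \<subseteq> Basis" "card I = m"
    and d: "\<And>x. (infdist x V)\<^sup>2 = (\<Sum>i\<in>I. (g x \<bullet> i)\<^sup>2)"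
    by (rule coordinates_infdist[OF V m]) blast
  have finI: "finite I" using g(2) finite_Basis finite_subset by blast
  have lin: "g (x - y) = g x - g y" for x y
    using orthogonal_transformation_linear[OF g(1)] by (simp add: linear_diff)
  have gk: "gauss_kernel m c V (y - z) = (\<Prod>i\<in>I. exp (- (g y \<bullet> i - g z \<bullet> i)\<^sup>2 / (2 * c\<^sup>2)) / c)" for c y z
    using finI g(3) by (simp add: gauss_kernel_def d lin inner_diff_left sum_divide_distrib exp_sum prod_dividef flip: sum_negf)
  have fw: "fiber_weight V y = (\<Prod>i\<in>Basis - I. exp (- (g y \<bullet> i)\<^sup>2 / (2 * 1\<^sup>2)))" for y
  proof -
    have "(norm y)\<^sup>2 = (norm (g y))\<^sup>2" by (simp add: orthogonal_transformation_norm[OF g(1)])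
    also have "\<dots> = (\<Sum>i\<in>Basis. (g y \<bullet> i)\<^sup>2)"
      by (subst power2_norm_eq_inner, subst euclidean_inner) (simp add: power2_eq_square)
    finally have "(norm y)\<^sup>2 - (infdist y V)\<^sup>2 = (\<Sum>i\<in>Basis - I. (g y \<bullet> i)\<^sup>2)"
      unfolding d using g(2) by (simp add: sum_diff)
    then show ?thesis by (simp add: fiber_weight_def exp_sum sum_divide_distrib flip: sum_negf)
  qed
  show ?thesis using that[OF g gk fw] .
qed

text \<open>Factors \<open>p\<close> belong to the coordinates across V, factors \<open>q\<close> to
  those along V. The three Gaussian integrals that follow are instances.\<close>

lemma nn_integral_coordinate_split:
  fixes g :: "real^'n \<Rightarrow> real^'n"
  assumes g: "orthogonal_transformation g" and I: "I \<subseteq> (Basis :: (real^'n) set)" "card I = m"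
    and [measurable]: "\<And>i. p i \<in> borel_measurable borel" "\<And>i. q i \<in> borel_measurable borel"
    and pq: "\<And>i. i \<in> I \<Longrightarrow> (\<integral>\<^sup>+u. ennreal (p i u) \<partial>lborel) = ennreal (P i)"
      "\<And>i. i \<in> Basis - I \<Longrightarrow> (\<integral>\<^sup>+u. ennreal (q i u) \<partial>lborel) = ennreal Q"
    and nn: "\<And>i u. 0 \<le> p i u" "\<And>i u. 0 \<le> q i u" "\<And>i. 0 \<le> P i" "0 \<le> Q"
  shows "(\<integral>\<^sup>+y. ennreal ((\<Prod>i\<in>I. p i (g y \<bullet> i)) * (\<Prod>i\<in>Basis - I. q i (g y \<bullet> i))) \<partial>lborel)
    = ennreal ((\<Prod>i\<in>I. P i) * Q ^ (CARD('n) - m))"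
proof -
  define f where "f i u = (if i \<in> I then ennreal (p i u) else ennreal (q i u))" for i u
  have [measurable]: "f i \<in> borel_measurable borel" for i
    unfolding f_def by measurable
  have "(\<integral>\<^sup>+y. ennreal ((\<Prod>i\<in>I. p i (g y \<bullet> i)) * (\<Prod>i\<in>Basis - I. q i (g y \<bullet> i))) \<partial>lborel)
      = (\<integral>\<^sup>+y. (\<Prod>i\<in>Basis. f i (g y \<bullet> i)) \<partial>lborel)"
    unfolding f_def prod_Basis_split[OF I] using nn
    by (intro nn_integral_cong) (simp add: prod_nonneg prod_ennreal ennreal_mult)
  also have "\<dots> = (\<Prod>i\<in>Basis. (\<integral>\<^sup>+u. f i u \<partial>lborel))"
    by (rule nn_integral_orthogonal_prod[OF g]) measurable
  also have "\<dots> = (\<Prod>i\<in>Basis. if i \<in> I then ennreal (P i) else ennreal Q)"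
    by (intro prod.cong) (auto simp: f_def pq)
  also have "\<dots> = ennreal ((\<Prod>i\<in>I. P i) * Q ^ (CARD('n) - m))"
    unfolding prod_Basis_split[OF I] using nn I
    by (simp add: prod_nonneg prod_ennreal ennreal_mult card_Diff_subset finite_subset ennreal_power)
  finally show ?thesis .
qed

text \<open>Semigroup law of the Gaussians. It turns the pairing of two smeared densities into an
  energy at the scale \<open>sqrt (a\<^sup>2 + b\<^sup>2)\<close>.\<close>

lemma nn_integral_gauss_kernel_product:
  assumes ab: "0 < a" "0 < b"
  shows "(\<integral>\<^sup>+y. ennreal (gauss_kernel m a V (y - z) * gauss_kernel m b V (y - w) * fiber_weight V y) \<partial>lborel)
     = ennreal (sqrt (2 * pi) ^ CARD('n) * gauss_kernel m (sqrt (a\<^sup>2 + b\<^sup>2)) V (z - w))"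
proof -
  obtain g :: "real^'n \<Rightarrow> real^'n" and I where g: "orthogonal_transformation g" "I \<subseteq> Basis" "card I = m"
    and gk: "\<And>c y z. gauss_kernel m c V (y - z) = (\<Prod>i\<in>I. exp (- (g y \<bullet> i - g z \<bullet> i)\<^sup>2 / (2 * c\<^sup>2)) / c)"
    and fw: "\<And>y. fiber_weight V y = (\<Prod>i\<in>Basis - I. exp (- (g y \<bullet> i)\<^sup>2 / (2 * 1\<^sup>2)))"
    by (rule gauss_kernel_coordinates) blast
  have "(\<integral>\<^sup>+y. ennreal (gauss_kernel m a V (y - z) * gauss_kernel m b V (y - w) * fiber_weight V y) \<partial>lborel)
    = (\<integral>\<^sup>+y. ennreal ((\<Prod>i\<in>I. (\<lambda>u. exp (- (u - g z \<bullet> i)\<^sup>2 / (2 * a\<^sup>2)) / a * (exp (- (u - g w \<bullet> i)\<^sup>2 / (2 * b\<^sup>2)) / b)) (g y \<bullet> i))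
        * (\<Prod>i\<in>Basis - I. (\<lambda>u. exp (- (u - 0)\<^sup>2 / (2 * 1\<^sup>2))) (g y \<bullet> i))) \<partial>lborel)"
    unfolding gk fw by (simp only: prod.distrib diff_zero)
  also have "\<dots> = ennreal ((\<Prod>i\<in>I. sqrt (2 * pi) * (exp (- (g z \<bullet> i - g w \<bullet> i)\<^sup>2 / (2 * (a\<^sup>2 + b\<^sup>2))) / sqrt (a\<^sup>2 + b\<^sup>2)))
      * (sqrt (2 * pi) * 1) ^ (CARD('n) - m))"
  proof (rule nn_integral_coordinate_split[OF g])
    fix i
    show "(\<integral>\<^sup>+u. ennreal (exp (- (u - g z \<bullet> i)\<^sup>2 / (2 * a\<^sup>2)) / a * (exp (- (u - g w \<bullet> i)\<^sup>2 / (2 * b\<^sup>2)) / b)) \<partial>lborel)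
      = ennreal (sqrt (2 * pi) * (exp (- (g z \<bullet> i - g w \<bullet> i)\<^sup>2 / (2 * (a\<^sup>2 + b\<^sup>2))) / sqrt (a\<^sup>2 + b\<^sup>2)))"
      using ab by (subst nn_integral_gaussian_product_real[OF ab, symmetric], subst ennreal_mult) auto
    show "(\<integral>\<^sup>+u. ennreal (exp (- (u - 0)\<^sup>2 / (2 * 1\<^sup>2))) \<partial>lborel) = ennreal (sqrt (2 * pi) * 1)"
      by (rule nn_integral_gaussian_real) simp
  qed (use ab in auto)
  also have "(\<Prod>i\<in>I. sqrt (2 * pi) * (exp (- (g z \<bullet> i - g w \<bullet> i)\<^sup>2 / (2 * (a\<^sup>2 + b\<^sup>2))) / sqrt (a\<^sup>2 + b\<^sup>2)))
      = sqrt (2 * pi) ^ m * gauss_kernel m (sqrt (a\<^sup>2 + b\<^sup>2)) V (z - w)"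
    unfolding gk by (simp only: prod.distrib prod_constant g(3)) simp
  also have "sqrt (2 * pi) ^ m * gauss_kernel m (sqrt (a\<^sup>2 + b\<^sup>2)) V (z - w) * (sqrt (2 * pi) * 1) ^ (CARD('n) - m)
    = sqrt (2 * pi) ^ CARD('n) * gauss_kernel m (sqrt (a\<^sup>2 + b\<^sup>2)) V (z - w)"
    using m power_add[of "sqrt (2 * pi)" m "CARD('n) - m"] by (simp add: mult_ac)
  finally show ?thesis .
qed

text \<open>The mass does not depend on a, z or V, so it can serve as the dominating constant in a
  limit under the integral over \<open>\<gamma>\<close>.\<close>

lemma nn_integral_gauss_kernel_fiber_weight:
  assumes a: "0 < a"
  shows "(\<integral>\<^sup>+y. ennreal (gauss_kernel m a V (y - z) * fiber_weight V y) \<partial>lborel) = ennreal (sqrt (2 * pi) ^ CARD('n))"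
proof -
  obtain g :: "real^'n \<Rightarrow> real^'n" and I where g: "orthogonal_transformation g" "I \<subseteq> Basis" "card I = m"
    and gk: "\<And>c y z. gauss_kernel m c V (y - z) = (\<Prod>i\<in>I. exp (- (g y \<bullet> i - g z \<bullet> i)\<^sup>2 / (2 * c\<^sup>2)) / c)"
    and fw: "\<And>y. fiber_weight V y = (\<Prod>i\<in>Basis - I. exp (- (g y \<bullet> i)\<^sup>2 / (2 * 1\<^sup>2)))"
    by (rule gauss_kernel_coordinates) blast
  have "(\<integral>\<^sup>+y. ennreal (gauss_kernel m a V (y - z) * fiber_weight V y) \<partial>lborel)
    = (\<integral>\<^sup>+y. ennreal ((\<Prod>i\<in>I. (\<lambda>u. exp (- (u - g z \<bullet> i)\<^sup>2 / (2 * a\<^sup>2)) / a) (g y \<bullet> i))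
        * (\<Prod>i\<in>Basis - I. (\<lambda>u. exp (- (u - 0)\<^sup>2 / (2 * 1\<^sup>2))) (g y \<bullet> i))) \<partial>lborel)"
    unfolding gk fw by simp
  also have "\<dots> = ennreal ((\<Prod>i\<in>I. sqrt (2 * pi)) * (sqrt (2 * pi) * 1) ^ (CARD('n) - m))"
  proof (rule nn_integral_coordinate_split[OF g])
    fix i
    have "(\<integral>\<^sup>+u. ennreal (exp (- (u - g z \<bullet> i)\<^sup>2 / (2 * a\<^sup>2)) / a) \<partial>lborel)
      = (\<integral>\<^sup>+u. ennreal (1 / a) * ennreal (exp (- (u - g z \<bullet> i)\<^sup>2 / (2 * a\<^sup>2))) \<partial>lborel)"
      using a by (simp flip: ennreal_mult)
    also have "\<dots> = ennreal (1 / a) * ennreal (sqrt (2 * pi) * a)"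
      by (subst nn_integral_cmult, measurable, simp only: nn_integral_gaussian_real[OF a])
    finally show "(\<integral>\<^sup>+u. ennreal (exp (- (u - g z \<bullet> i)\<^sup>2 / (2 * a\<^sup>2)) / a) \<partial>lborel) = ennreal (sqrt (2 * pi))"
      using a by (simp flip: ennreal_mult)
    show "(\<integral>\<^sup>+u. ennreal (exp (- (u - 0)\<^sup>2 / (2 * 1\<^sup>2))) \<partial>lborel) = ennreal (sqrt (2 * pi) * 1)"
      by (rule nn_integral_gaussian_real) simp
  qed (use a in auto)
  also have "(\<Prod>i\<in>I. sqrt (2 * pi)) * (sqrt (2 * pi) * 1) ^ (CARD('n) - m) = sqrt (2 * pi) ^ CARD('n)"
    using m power_add[of "sqrt (2 * pi)" m "CARD('n) - m"] by (simp add: g(3))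
  finally show ?thesis .
qed

text \<open>The right side is the same for all V, hence survives averaging over
  \<open>\<gamma>\<close>. Every quantitative bound for the averaged kernel starts from this
  integral.\<close>

lemma nn_integral_gauss_kernel_gaussian:
  assumes a: "0 < a" and l: "0 < l"
  shows "(\<integral>\<^sup>+y. ennreal (gauss_kernel m a V y * exp (- (norm y)\<^sup>2 / (2 * l\<^sup>2))) \<partial>lborel)
    = ennreal (sqrt (2 * pi) ^ CARD('n) * l ^ CARD('n) / sqrt (a\<^sup>2 + l\<^sup>2) ^ m)"
proof -
  obtain g :: "real^'n \<Rightarrow> real^'n" and I where g: "orthogonal_transformation g" "I \<subseteq> Basis" "card I = m"
    and gk: "\<And>c y z. gauss_kernel m c V (y - z) = (\<Prod>i\<in>I. exp (- (g y \<bullet> i - g z \<bullet> i)\<^sup>2 / (2 * c\<^sup>2)) / c)"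
    and fw: "\<And>y. fiber_weight V y = (\<Prod>i\<in>Basis - I. exp (- (g y \<bullet> i)\<^sup>2 / (2 * 1\<^sup>2)))"
    by (rule gauss_kernel_coordinates) blast
  have g0: "g 0 = 0" using orthogonal_transformation_linear[OF g(1)] linear_0 by blast
  have gk0: "gauss_kernel m a V y = (\<Prod>i\<in>I. exp (- (g y \<bullet> i)\<^sup>2 / (2 * a\<^sup>2)) / a)" for y
    using gk[of a y 0] by (simp add: g0)
  have nrm: "exp (- (norm y)\<^sup>2 / (2 * l\<^sup>2)) = (\<Prod>i\<in>I. exp (- (g y \<bullet> i)\<^sup>2 / (2 * l\<^sup>2))) * (\<Prod>i\<in>Basis - I. exp (- (g y \<bullet> i)\<^sup>2 / (2 * l\<^sup>2)))" for y
  proof -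
    have "(norm y)\<^sup>2 = (norm (g y))\<^sup>2" by (simp add: orthogonal_transformation_norm[OF g(1)])
    also have "\<dots> = (\<Sum>i\<in>Basis. (g y \<bullet> i)\<^sup>2)"
      by (subst power2_norm_eq_inner, subst euclidean_inner) (simp add: power2_eq_square)
    finally have "exp (- (norm y)\<^sup>2 / (2 * l\<^sup>2)) = (\<Prod>i\<in>Basis. exp (- (g y \<bullet> i)\<^sup>2 / (2 * l\<^sup>2)))"
      by (simp add: exp_sum sum_divide_distrib flip: sum_negf)
    then show ?thesis using prod.subset_diff[OF g(2) finite_Basis] by (simp add: mult.commute)
  qed
  have "(\<integral>\<^sup>+y. ennreal (gauss_kernel m a V y * exp (- (norm y)\<^sup>2 / (2 * l\<^sup>2))) \<partial>lborel)
    = (\<integral>\<^sup>+y. ennreal ((\<Prod>i\<in>I. (\<lambda>u. l * (exp (- (u - 0)\<^sup>2 / (2 * a\<^sup>2)) / a * (exp (- (u - 0)\<^sup>2 / (2 * l\<^sup>2)) / l))) (g y \<bullet> i))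
        * (\<Prod>i\<in>Basis - I. (\<lambda>u. exp (- (u - 0)\<^sup>2 / (2 * l\<^sup>2))) (g y \<bullet> i))) \<partial>lborel)"
  proof -
    have "l * (p / a * (q / l)) = p / a * q" for p q :: real using l by simp
    then show ?thesis
      unfolding gk0 nrm by (simp only: prod.distrib diff_zero mult.assoc)
  qed
  also have "\<dots> = ennreal ((\<Prod>i\<in>I. sqrt (2 * pi) * l / sqrt (a\<^sup>2 + l\<^sup>2)) * (sqrt (2 * pi) * l) ^ (CARD('n) - m))"
  proof (rule nn_integral_coordinate_split[OF g])
    fix i
    have "(\<integral>\<^sup>+u. ennreal (l * (exp (- (u - 0)\<^sup>2 / (2 * a\<^sup>2)) / a * (exp (- (u - 0)\<^sup>2 / (2 * l\<^sup>2)) / l))) \<partial>lborel)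
      = (\<integral>\<^sup>+u. ennreal l * (ennreal (exp (- (u - 0)\<^sup>2 / (2 * a\<^sup>2)) / a) * ennreal (exp (- (u - 0)\<^sup>2 / (2 * l\<^sup>2)) / l)) \<partial>lborel)"
      using a l by (intro nn_integral_cong) (simp flip: ennreal_mult)
    also have "\<dots> = ennreal l * ennreal (sqrt (2 * pi) * (exp (- (0 - 0)\<^sup>2 / (2 * (a\<^sup>2 + l\<^sup>2))) / sqrt (a\<^sup>2 + l\<^sup>2)))"
      by (subst nn_integral_cmult, measurable, subst nn_integral_gaussian_product_real[OF a l]) simp
    finally show "(\<integral>\<^sup>+u. ennreal (l * (exp (- (u - 0)\<^sup>2 / (2 * a\<^sup>2)) / a * (exp (- (u - 0)\<^sup>2 / (2 * l\<^sup>2)) / l))) \<partial>lborel)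
      = ennreal (sqrt (2 * pi) * l / sqrt (a\<^sup>2 + l\<^sup>2))"
      using l by (simp add: mult.commute flip: ennreal_mult)
    show "(\<integral>\<^sup>+u. ennreal (exp (- (u - 0)\<^sup>2 / (2 * l\<^sup>2))) \<partial>lborel) = ennreal (sqrt (2 * pi) * l)"
      by (rule nn_integral_gaussian_real[OF l])
  qed (use a l in auto)
  also have "(\<Prod>i\<in>I. sqrt (2 * pi) * l / sqrt (a\<^sup>2 + l\<^sup>2)) * (sqrt (2 * pi) * l) ^ (CARD('n) - m)
    = sqrt (2 * pi) ^ CARD('n) * l ^ CARD('n) / sqrt (a\<^sup>2 + l\<^sup>2) ^ m"
    using m power_add[of "sqrt (2 * pi) * l" m "CARD('n) - m"]
    by (simp add: g(3) power_divide flip: power_mult_distrib)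
  finally show ?thesis .
qed

end

section \<open>Averages over the Grassmannian\<close>

lemma infdist_subspace_scaleR_le:
  fixes V :: "'a::euclidean_space set"
  assumes "subspace V" "0 \<le> c"
  shows "infdist (c *\<^sub>R x) V \<le> c * infdist x V"
proof -
  have "closed V" "V \<noteq> {}" using assms closed_subspace subspace_0 by auto
  then obtain v where v: "v \<in> V" "infdist x V = dist x v"
    using infdist_attains_inf by metis
  have "infdist (c *\<^sub>R x) V \<le> dist (c *\<^sub>R x) (c *\<^sub>R v)"
    using v(1) assms(1) by (intro infdist_le subspace_scale)
  also have "\<dots> = c * dist x v" using assms(2) by (simp add: dist_norm norm_scaleR flip: scaleR_diff_right)
  finally show ?thesis by (simp add: v)
qed

lemma infdist_subspace_le_norm:
  assumes "subspace V" shows "infdist x V \<le> norm x"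
  using infdist_le[OF subspace_0[OF assms], of x] by simp

text \<open>The point v of V nearest to z has norm at most \<open>2 * norm z\<close>; rescaled to
  the unit ball, its distance to W is controlled by the gap. This continuity in V is the link to the
  topology behind \<open>grass_borel\<close>.\<close>

lemma infdist_le_grass_gap:
  fixes V W :: "'a::euclidean_space set"
  assumes V: "subspace V" and W: "subspace W"
  shows "infdist z W \<le> infdist z V + 2 * norm z * grass_gap V W"
proof -
  have "closed V" "V \<noteq> {}" using V closed_subspace subspace_0 by auto
  then obtain v where v: "v \<in> V" "infdist z V = dist z v"
    using infdist_attains_inf by metis
  have dv: "dist z v \<le> norm z" using infdist_subspace_le_norm[OF V, of z] v by simp
  have "norm v \<le> norm z + dist z v"
    using norm_triangle_ineq2[of v z] by (simp add: dist_norm norm_minus_commute)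
  with dv have nv: "norm v \<le> 2 * norm z" by simp
  have bdd: "bdd_above ((\<lambda>x. infdist x W) ` (V \<inter> cball 0 1))"
  proof (rule bdd_aboveI2)
    fix x assume "x \<in> V \<inter> cball 0 1"
    then show "infdist x W \<le> 1" using infdist_subspace_le_norm[OF W, of x] by simp
  qed
  have up: "infdist x W \<le> grass_gap V W" if "x \<in> V \<inter> cball 0 1" for x
    using cSUP_upper[OF that bdd] unfolding grass_gap_def by linarith
  have gap0: "0 \<le> grass_gap V W"
    using up[of 0] infdist_nonneg[of 0 W] subspace_0[OF V] by (simp add: order_trans[OF infdist_nonneg])
  have "infdist v W \<le> norm v * grass_gap V W"
  proof (cases "v = 0")
    case True
    then show ?thesis using infdist_subspace_le_norm[OF W, of v] gap0 by simp
  next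
    case False
    have "infdist (norm v *\<^sub>R (inverse (norm v) *\<^sub>R v)) W \<le> norm v * infdist (inverse (norm v) *\<^sub>R v) W"
      using W by (intro infdist_subspace_scaleR_le) auto
    also have "\<dots> \<le> norm v * grass_gap V W"
      using False v(1) V by (intro mult_left_mono up) (auto simp: subspace_scale)
    finally show ?thesis using False by simp
  qed
  also have "\<dots> \<le> 2 * norm z * grass_gap V W"
    using nv gap0 by (rule mult_right_mono)
  finally show ?thesis
    using infdist_triangle[of z W v] v by simp
qed

lemma space_grass_borel: "space (grass_borel k) = grassmannian k"
  and sets_grass_borel: "grass_open k U \<Longrightarrow> U \<in> sets (grass_borel k)"
proof -
  have "{U. grass_open k U} \<subseteq> Pow (grassmannian k)"
    by (auto simp: grass_open_def)
  then show "space (grass_borel k) = grassmannian k" "grass_open k U \<Longrightarrow> U \<in> sets (grass_borel k)"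
    by (auto simp: grass_borel_def space_measure_of_conv)
qed

lemma infdist_measurable_grass_borel:
  fixes z :: "'a::euclidean_space"
  shows "(\<lambda>V. infdist z V) \<in> borel_measurable (grass_borel k)"
proof (rule borel_measurableI_less)
  fix a :: real
  have "grass_open k {V \<in> grassmannian k. infdist z V < a}"
    unfolding grass_open_def
  proof (intro conjI ballI)
    fix V assume "V \<in> {V \<in> grassmannian k. infdist z V < a}"
    then have V: "V \<in> grassmannian k" "infdist z V < a" by auto
    define e where "e = (a - infdist z V) / (2 * norm z + 1)"
    have n1: "0 < 2 * norm z + 1" using norm_ge_zero[of z] by linarith
    have e: "0 < e" using V n1 by (simp add: e_def)
    have "W \<in> {V \<in> grassmannian k. infdist z V < a}" if W: "W \<in> grassmannian k" "grass_gap V W < e" for W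
    proof -
      have "infdist z W \<le> infdist z V + 2 * norm z * grass_gap V W"
        using V W by (intro infdist_le_grass_gap) (auto simp: grassmannian_def)
      also have "\<dots> \<le> infdist z V + 2 * norm z * e"
        using W by (simp add: mult_left_mono)
      also have "\<dots> < infdist z V + (2 * norm z + 1) * e" using e by (simp add: algebra_simps)
      also have "\<dots> = a" using n1 by (simp add: e_def)
      finally show ?thesis using W by simp
    qed
    then show "\<exists>e>0. \<forall>W\<in>grassmannian k. grass_gap V W < e \<longrightarrow> W \<in> {V \<in> grassmannian k. infdist z V < a}"
      using e by auto
  qed auto
  then show "{x \<in> space (grass_borel k). infdist z x < a} \<in> sets (grass_borel k)"
    using sets_grass_borel by (simp add: space_grass_borel)
qed

locale invariant_grassmannian = prob_space \<gamma> for \<gamma> :: "(real^'n) set measure" +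
  fixes m :: nat
  assumes m: "0 < m" "m < CARD('n)"
    and invariant: "grass_invariant_prob (CARD('n) - m) \<gamma>"
begin

lemma sets_gamma: "sets \<gamma> = sets (grass_borel (CARD('n) - m))"
  using invariant by (simp add: grass_invariant_prob_def)

lemma space_gamma: "space \<gamma> = grassmannian (CARD('n) - m)"
  using sets_eq_imp_space_eq[OF sets_gamma] by (simp add: space_grass_borel)

lemma subspace_gamma: "V \<in> space \<gamma> \<Longrightarrow> subspace V"
  by (simp add: space_gamma grassmannian_def)

lemma infdist_measurable1: "(\<lambda>V. infdist z V) \<in> borel_measurable \<gamma>"
  using infdist_measurable_grass_borel[of z] measurable_cong_sets[OF sets_gamma refl] by blast

text \<open>The distance is 1-Lipschitz in x and measurable in V for fixed x. Joint measurability
  follows by replacing x with a point q of a countable dense set, at a rational cost r.\<close>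

lemma infdist_measurable_pair: "(\<lambda>(x, V). infdist x V) \<in> borel_measurable (borel \<Otimes>\<^sub>M \<gamma>)"
proof (rule borel_measurableI_less)
  fix a :: real
  obtain D :: "(real^'n) set" where D: "countable D" "\<And>X. open X \<Longrightarrow> X \<noteq> {} \<Longrightarrow> \<exists>d\<in>D. d \<in> X"
    by (rule countable_dense_setE) blast
  have "{p \<in> space (borel \<Otimes>\<^sub>M \<gamma>). (case p of (x, V) \<Rightarrow> infdist x V) < a}
    = (\<Union>q\<in>D. \<Union>r\<in>\<rat>. ball q r \<times> {V \<in> space \<gamma>. infdist q V < a - r})" (is "?L = ?R")
  proof (intro equalityI subsetI)
    fix p assume "p \<in> ?L"
    then obtain x V where p: "p = (x, V)" "V \<in> space \<gamma>" "infdist x V < a"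
      by (auto simp: space_pair_measure)
    obtain r where r: "r \<in> \<rat>" "0 < r" "r < (a - infdist x V) / 2"
      using Rats_dense_in_real[of 0 "(a - infdist x V) / 2"] p(3) by auto
    obtain q where q: "q \<in> D" "dist x q < r"
      using D(2)[of "ball x r"] r(2) by auto
    have "infdist q V \<le> infdist x V + dist q x" by (rule infdist_triangle)
    then have "infdist q V < a - r" using q r by (simp add: dist_commute)
    then have "p \<in> ball q r \<times> {V \<in> space \<gamma>. infdist q V < a - r}"
      using p q by (simp add: dist_commute)
    then show "p \<in> ?R" using q(1) r(1) by blast
  next
    fix p assume "p \<in> ?R"
    then obtain x V q r where p: "p = (x, V)" "V \<in> space \<gamma>" "dist q x < r" "infdist q V < a - r"
      by auto
    have "infdist x V \<le> infdist q V + dist x q" by (rule infdist_triangle)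
    then show "p \<in> ?L" using p by (simp add: dist_commute space_pair_measure)
  qed
  moreover have "{V \<in> space \<gamma>. infdist q V < b} \<in> sets \<gamma>" for q b
    using infdist_measurable1[of q] by measurable
  ultimately show "{p \<in> space (borel \<Otimes>\<^sub>M \<gamma>). (case p of (x, V) \<Rightarrow> infdist x V) < a} \<in> sets (borel \<Otimes>\<^sub>M \<gamma>)"
    using D(1) countable_rat by (auto intro!: sets.countable_UN' pair_measureI)
qed

lemma infdist_measurable [measurable (raw)]:
  assumes "f \<in> borel_measurable M" "g \<in> M \<rightarrow>\<^sub>M \<gamma>"
  shows "(\<lambda>x. infdist (f x) (g x)) \<in> borel_measurable M"
  using measurable_compose[OF measurable_Pair[OF assms] infdist_measurable_pair] by simp

lemma gauss_kernel_measurable [measurable (raw)]: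
  assumes [measurable]: "f \<in> borel_measurable M" "g \<in> M \<rightarrow>\<^sub>M \<gamma>"
  shows "(\<lambda>x. gauss_kernel m a (g x) (f x)) \<in> borel_measurable M"
  unfolding gauss_kernel_def by measurable

lemma fiber_weight_measurable [measurable (raw)]:
  assumes [measurable]: "f \<in> borel_measurable M" "g \<in> M \<rightarrow>\<^sub>M \<gamma>"
  shows "(\<lambda>x. fiber_weight (g x) (f x)) \<in> borel_measurable M"
  unfolding fiber_weight_def by measurable

text \<open>\<open>grass_invariant_prob\<close> speaks of forward images. As f is a bijection,
  preimages under it are forward images under its inverse, which is orthogonal too.\<close>

lemma
  assumes f: "orthogonal_transformation f"
  shows image_measurable_gamma: "(`) f \<in> \<gamma> \<rightarrow>\<^sub>M \<gamma>"
    and distr_gamma_orthogonal: "distr \<gamma> \<gamma> ((`) f) = \<gamma>"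
proof -
  have bij: "bij f" using f by (rule orthogonal_transformation_bij)
  have f': "orthogonal_transformation (inv f)" using f by (rule orthogonal_transformation_inv)
  have inv: "(\<lambda>V. inv f ` V) ` S \<in> sets \<gamma>" "emeasure \<gamma> ((\<lambda>V. inv f ` V) ` S) = emeasure \<gamma> S" if "S \<in> sets \<gamma>" for S
    using invariant f' that by (auto simp: grass_invariant_prob_def)
  have fi: "f ` (inv f ` V) = V" "inv f ` (f ` V) = V" for V
    using bij by (auto simp: image_comp o_def bij_is_surj surj_f_inv_f bij_is_inj)
  have sp: "f ` V \<in> space \<gamma>" if "V \<in> space \<gamma>" for V
  proof -
    have lin: "linear f" using f by (rule orthogonal_transformation_linear)
    have "inj_on f (span V)" using bij by (meson bij_is_inj inj_on_subset subset_UNIV)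
    then have "dim (f ` V) = dim V" using lin dim_image_eq by blast
    then show ?thesis using that lin by (auto simp: space_gamma grassmannian_def linear_subspace_image)
  qed
  have vim: "(`) f -` S \<inter> space \<gamma> = (\<lambda>V. inv f ` V) ` S" if "S \<in> sets \<gamma>" for S
  proof (intro equalityI subsetI)
    fix V assume "V \<in> (`) f -` S \<inter> space \<gamma>"
    then show "V \<in> (\<lambda>V. inv f ` V) ` S" by (metis Int_iff fi(2) imageI vimageE)
  next
    fix V assume V: "V \<in> (\<lambda>V. inv f ` V) ` S"
    then have "V \<in> space \<gamma>" using inv(1)[OF that] sets.sets_into_space by blast
    then show "V \<in> (`) f -` S \<inter> space \<gamma>" using V by (auto simp: fi)
  qed
  show meas: "(`) f \<in> \<gamma> \<rightarrow>\<^sub>M \<gamma>"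
    using sp inv(1) by (intro measurableI) (auto simp: vim)
  show "distr \<gamma> \<gamma> ((`) f) = \<gamma>"
    using meas by (intro measure_eqI) (auto simp: emeasure_distr vim inv(2))
qed

section \<open>The averaged Gaussian kernel\<close>

definition kernel_avg :: "real \<Rightarrow> real^'n \<Rightarrow> ennreal" where
  "kernel_avg a z = (\<integral>\<^sup>+V. ennreal (gauss_kernel m a V z) \<partial>\<gamma>)"

lemma kernel_avg_measurable [measurable]: "kernel_avg a \<in> borel_measurable borel"
  unfolding kernel_avg_def by measurable

lemma gauss_kernel_nonneg [simp]: "0 \<le> a \<Longrightarrow> 0 \<le> gauss_kernel m a V z"
  by (simp add: gauss_kernel_def)

lemma gauss_kernel_le: "0 < a \<Longrightarrow> gauss_kernel m a V z \<le> 1 / a ^ m"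
  by (simp add: gauss_kernel_def divide_right_mono)

lemma infdist_orthogonal_image:
  assumes f: "orthogonal_transformation f"
  shows "infdist (f x) (f ` V) = infdist x V"
proof -
  have "dist (f x) (f y) = dist x y" for y
    using f by (metis dist_norm linear_diff orthogonal_transformation_linear orthogonal_transformation_norm)
  then show ?thesis by (simp add: infdist_def image_comp o_def)
qed

text \<open>Shrinking w to the norm of z brings it closer to every subspace; a rotation then carries
  it to z without changing the average. In particular the average is radial.\<close>

lemma kernel_avg_antimono:
  assumes a: "0 < a" and le: "norm z \<le> norm w"
  shows "kernel_avg a w \<le> kernel_avg a z"
proof -
  define c where "c = norm z / norm w"
  have c: "0 \<le> c" "c \<le> 1" "norm (c *\<^sub>R w) = norm z"
    using le by (auto simp: c_def divide_le_eq_1)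
  obtain f where f: "orthogonal_transformation f" "f (c *\<^sub>R w) = z"
    using orthogonal_transformation_exists[OF c(3)] .
  note [measurable] = image_measurable_gamma[OF f(1)]
  have "kernel_avg a w \<le> (\<integral>\<^sup>+V. ennreal (gauss_kernel m a V (c *\<^sub>R w)) \<partial>\<gamma>)"
    unfolding kernel_avg_def
  proof (intro nn_integral_mono ennreal_leI)
    fix V assume "V \<in> space \<gamma>"
    then have "subspace V" by (rule subspace_gamma)
    then have "infdist (c *\<^sub>R w) V \<le> c * infdist w V"
      using c by (intro infdist_subspace_scaleR_le)
    also have "\<dots> \<le> 1 * infdist w V" using c by (intro mult_right_mono infdist_nonneg)
    finally have "(infdist (c *\<^sub>R w) V)\<^sup>2 \<le> (infdist w V)\<^sup>2"
      by (intro power_mono) (auto simp: infdist_nonneg)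
    then show "gauss_kernel m a V w \<le> gauss_kernel m a V (c *\<^sub>R w)"
      using a by (simp add: gauss_kernel_def divide_right_mono)
  qed
  also have "\<dots> = (\<integral>\<^sup>+V. ennreal (gauss_kernel m a (f ` V) (f (c *\<^sub>R w))) \<partial>\<gamma>)"
    by (simp only: gauss_kernel_def infdist_orthogonal_image[OF f(1)])
  also have "\<dots> = (\<integral>\<^sup>+V. ennreal (gauss_kernel m a V (f (c *\<^sub>R w))) \<partial>distr \<gamma> \<gamma> ((`) f))"
    by (subst nn_integral_distr) auto
  also have "\<dots> = kernel_avg a z"
    by (simp only: distr_gamma_orthogonal[OF f(1)] f(2) kernel_avg_def)
  finally show ?thesis .
qed

lemma kernel_avg_le_inverse_power: "0 < a \<Longrightarrow> kernel_avg a z \<le> ennreal (1 / a ^ m)"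
proof -
  assume a: "0 < a"
  have "kernel_avg a z \<le> (\<integral>\<^sup>+V. ennreal (1 / a ^ m) \<partial>\<gamma>)"
    unfolding kernel_avg_def using a by (intro nn_integral_mono ennreal_leI gauss_kernel_le)
  also have "\<dots> = ennreal (1 / a ^ m)" by (simp add: emeasure_space_1)
  finally show ?thesis .
qed

lemma nn_integral_kernel_avg_gaussian:
  assumes a: "0 < a" and l: "0 < l"
  shows "(\<integral>\<^sup>+x. kernel_avg a x * ennreal (exp (- (norm x)\<^sup>2 / (2 * l\<^sup>2))) \<partial>lborel)
    = ennreal (sqrt (2 * pi) ^ CARD('n) * l ^ CARD('n) / sqrt (a\<^sup>2 + l\<^sup>2) ^ m)"
proof -
  interpret pair_sigma_finite \<gamma> "lborel :: (real^'n) measure" ..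
  let ?f = "\<lambda>V x. ennreal (gauss_kernel m a V x * exp (- (norm x)\<^sup>2 / (2 * l\<^sup>2)))"
  have "(\<integral>\<^sup>+x. kernel_avg a x * ennreal (exp (- (norm x)\<^sup>2 / (2 * l\<^sup>2))) \<partial>lborel)
    = (\<integral>\<^sup>+x. (\<integral>\<^sup>+V. ?f V x \<partial>\<gamma>) \<partial>lborel)"
    unfolding kernel_avg_def using a
    by (intro nn_integral_cong, subst nn_integral_multc[symmetric]) (auto simp: ennreal_mult)
  also have "\<dots> = (\<integral>\<^sup>+V. (\<integral>\<^sup>+x. ?f V x \<partial>lborel) \<partial>\<gamma>)"
    by (rule Fubini') measurable
  also have "\<dots> = (\<integral>\<^sup>+V. ennreal (sqrt (2 * pi) ^ CARD('n) * l ^ CARD('n) / sqrt (a\<^sup>2 + l\<^sup>2) ^ m) \<partial>\<gamma>)"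
    using m by (intro nn_integral_cong nn_integral_gauss_kernel_gaussian a l) (auto simp: space_gamma)
  finally show ?thesis by (simp add: emeasure_space_1)
qed

text \<open>By monotonicity the value at z is at most the mean over the ball of radius
  \<open>norm z\<close>. The Gaussian of the same width is at least \<open>exp (- 1 / 2)\<close> on
  that ball, so its known integral controls the mean.\<close>

lemma kernel_avg_upper:
  obtains C where "1 \<le> C" "\<And>a z. 0 < a \<Longrightarrow> kernel_avg a z \<le> ennreal (C / (max a (norm z)) ^ m)"
proof -
  define v where "v = unit_ball_vol (real CARD('n))"
  have v: "0 < v" by (simp add: v_def unit_ball_vol_pos)
  define D where "D = sqrt (2 * pi) ^ CARD('n) * exp (1/2) / v"
  have "kernel_avg a z \<le> ennreal (D / norm z ^ m)" if a: "0 < a" and z: "z \<noteq> 0" for a z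
  proof -
    define r where "r = norm z"
    have r: "0 < r" using z by (simp add: r_def)
    define k where "k = enn2real (kernel_avg a z)"
    have k: "kernel_avg a z = ennreal k" "0 \<le> k"
      using kernel_avg_le_inverse_power[OF a, of z] by (auto simp: k_def ennreal_enn2real_if top_unique)
    have "ennreal (k * exp (- 1 / 2)) * emeasure lborel (cball (0::real^'n) r)
      = (\<integral>\<^sup>+x. ennreal (k * exp (- 1 / 2)) * indicator (cball 0 r) x \<partial>(lborel :: (real^'n) measure))"
      by (subst nn_integral_cmult_indicator) auto
    also have "\<dots> \<le> (\<integral>\<^sup>+x. kernel_avg a x * ennreal (exp (- (norm x)\<^sup>2 / (2 * r\<^sup>2))) \<partial>lborel)"
    proof (rule nn_integral_mono)
      fix x :: "real^'n"
      show "ennreal (k * exp (- 1 / 2)) * indicator (cball 0 r) x \<le> kernel_avg a x * ennreal (exp (- (norm x)\<^sup>2 / (2 * r\<^sup>2)))"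
      proof (cases "norm x \<le> r")
        case True
        have "(norm x)\<^sup>2 \<le> r\<^sup>2" using True by (intro power_mono) auto
        then have "- 1 / 2 \<le> - (norm x)\<^sup>2 / (2 * r\<^sup>2)" using r by (simp add: field_simps)
        then have "ennreal k * ennreal (exp (- 1 / 2)) \<le> kernel_avg a x * ennreal (exp (- (norm x)\<^sup>2 / (2 * r\<^sup>2)))"
          using kernel_avg_antimono[OF a, of x z] True k r_def by (intro mult_mono ennreal_leI) auto
        then show ?thesis using True k by (simp add: ennreal_mult)
      qed simp
    qed
    also have "\<dots> = ennreal (sqrt (2 * pi) ^ CARD('n) * r ^ CARD('n) / sqrt (a\<^sup>2 + r\<^sup>2) ^ m)"
      by (rule nn_integral_kernel_avg_gaussian[OF a r])
    also have "\<dots> \<le> ennreal (sqrt (2 * pi) ^ CARD('n) * r ^ CARD('n) / r ^ m)"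
    proof (intro ennreal_leI divide_left_mono power_mono mult_nonneg_nonneg)
      show "r \<le> sqrt (a\<^sup>2 + r\<^sup>2)" using r by (intro real_le_rsqrt) auto
      show "0 < sqrt (a\<^sup>2 + r\<^sup>2) ^ m * r ^ m" using r by (intro mult_pos_pos zero_less_power) (auto simp: add_nonneg_pos)
    qed (use r in auto)
    finally have "ennreal (k * exp (- 1 / 2) * (v * r ^ CARD('n))) \<le> ennreal (sqrt (2 * pi) ^ CARD('n) * r ^ CARD('n) / r ^ m)"
      using r k v by (simp add: emeasure_cball v_def ennreal_mult)
    then have "k * exp (- 1 / 2) * (v * r ^ CARD('n)) \<le> sqrt (2 * pi) ^ CARD('n) * r ^ CARD('n) / r ^ m"
      using r by (subst (asm) ennreal_le_iff) auto
    then have "(k * exp (- 1 / 2) * v) * r ^ CARD('n) \<le> (sqrt (2 * pi) ^ CARD('n) / r ^ m) * r ^ CARD('n)"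
      by (simp add: mult_ac)
    then have "k * exp (- 1 / 2) * v \<le> sqrt (2 * pi) ^ CARD('n) / r ^ m"
      using r by (subst (asm) mult_le_cancel_right_pos) auto
    then have "k \<le> D / r ^ m"
      using v r by (simp add: D_def exp_minus field_simps)
    then show ?thesis by (simp add: k r_def ennreal_leI)
  qed
  note D = this
  have "kernel_avg a z \<le> ennreal (max 1 D / (max a (norm z)) ^ m)" if a: "0 < a" for a z
  proof (cases "norm z \<le> a")
    case True
    have "1 / a ^ m \<le> max 1 D / a ^ m" using a by (intro divide_right_mono) auto
    then show ?thesis
      using kernel_avg_le_inverse_power[OF a, of z] True by (simp add: max_def order_trans[OF _ ennreal_leI])
  next
    case False
    then have "z \<noteq> 0" using a by auto
    have "D / norm z ^ m \<le> max 1 D / norm z ^ m" by (intro divide_right_mono) auto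
    then show ?thesis
      using D[OF a \<open>z \<noteq> 0\<close>] False by (simp add: max_def order_trans[OF _ ennreal_leI])
  qed
  then show ?thesis using that[of "max 1 D"] by auto
qed

lemma gaussian_integral:
  assumes l: "0 < l"
  shows "(\<integral>\<^sup>+x. ennreal (exp (- (norm x)\<^sup>2 / (2 * l\<^sup>2))) \<partial>(lborel :: (real^'n) measure)) = ennreal (sqrt (2 * pi) ^ CARD('n) * l ^ CARD('n))"
proof -
  have "(UNIV :: (real^'n) set) \<in> grassmannian (CARD('n) - 0)"
    by (simp add: grassmannian_def)
  from nn_integral_gauss_kernel_gaussian[OF this _ zero_less_one l] show ?thesis
    by (simp add: gauss_kernel_def)
qed

text \<open>Two Gaussian tests, of widths \<open>Q\<close> and \<open>l = L * Q\<close>, are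
  compared. The ball of radius \<open>Q\<close> contributes an amount of order
  \<open>Q ^ (CARD('n) - m)\<close>, the whole space one of order \<open>l ^ (CARD('n) - m)\<close>.
  As m < CARD('n), a large \<open>L\<close> leaves a definite part outside the ball, where the
  average is at most its value \<open>k\<close> at norm \<open>Q\<close>.\<close>

lemma kernel_avg_lower:
  assumes "0 < R"
  obtains c where "0 < c" "\<And>a z. 0 < a \<Longrightarrow> a \<le> 1 \<Longrightarrow> norm z \<le> R \<Longrightarrow> ennreal c \<le> kernel_avg a z"
proof -
  define Q where "Q = max 1 R"
  have Q: "1 \<le> Q" "R \<le> Q" by (auto simp: Q_def)
  \<comment> \<open>After the inner part is subtracted, the factor 2 leaves as much again;
    \<open>sqrt 2 ^ m\<close> pays for \<open>sqrt (a\<^sup>2 + l\<^sup>2) \<le> sqrt 2 * l\<close>,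
    valid as a \<le> 1 \<le> l.\<close>
  define L where "L = 2 * exp (1/2) * sqrt 2 ^ m"
  have L: "1 \<le> L"
  proof -
    have "1 \<le> exp (1/2::real)" "1 \<le> sqrt 2 ^ m" by (auto intro!: one_le_power)
    then have "1 * 1 \<le> exp (1/2::real) * sqrt 2 ^ m" by (intro mult_mono) auto
    then show ?thesis by (simp add: L_def)
  qed
  define l where "l = L * Q"
  have "1 * 1 \<le> L * Q" using L Q by (intro mult_mono) auto
  then have l: "1 \<le> l" by (simp add: l_def)
  define c where "c = exp (1/2) * Q ^ (CARD('n) - m) / l ^ CARD('n)"
  have c: "0 < c" using Q l by (auto simp: c_def intro!: divide_pos_pos mult_pos_pos zero_less_power)
  let ?s = "sqrt (2 * pi) ^ CARD('n)"
  have pw: "t ^ CARD('n) / t ^ m = t ^ (CARD('n) - m)" if "0 < t" for t :: real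
    using that m by (simp add: power_diff)
  have "ennreal c \<le> kernel_avg a z" if a: "0 < a" "a \<le> 1" and z: "norm z \<le> R" for a z
  proof -
    obtain w :: "real^'n" where w: "norm w = Q" using vector_choose_size[of Q] Q by auto
    define k where "k = enn2real (kernel_avg a w)"
    have k: "kernel_avg a w = ennreal k" "0 \<le> k"
      using kernel_avg_le_inverse_power[OF a(1), of w] by (auto simp: k_def ennreal_enn2real_if top_unique)
    let ?w = "\<lambda>r (x :: real^'n). ennreal (exp (- (norm x)\<^sup>2 / (2 * r\<^sup>2)))"
    have "ennreal (?s * l ^ CARD('n) / sqrt (a\<^sup>2 + l\<^sup>2) ^ m) = (\<integral>\<^sup>+x. kernel_avg a x * ?w l x \<partial>lborel)"
      using nn_integral_kernel_avg_gaussian[OF a(1), of l] l by simp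
    also have "\<dots> \<le> (\<integral>\<^sup>+x. ennreal (exp (1/2)) * (kernel_avg a x * ?w Q x) + ennreal k * ?w l x \<partial>lborel)"
    proof (rule nn_integral_mono)
      fix x :: "real^'n"
      show "kernel_avg a x * ?w l x \<le> ennreal (exp (1/2)) * (kernel_avg a x * ?w Q x) + ennreal k * ?w l x"
      proof (cases "norm x \<le> Q")
        case True
        have "(norm x)\<^sup>2 \<le> Q\<^sup>2" using True by (intro power_mono) auto
        then have "(norm x)\<^sup>2 / (2 * Q\<^sup>2) \<le> 1 / 2" using Q by (simp add: divide_le_eq)
        moreover have "0 \<le> (norm x)\<^sup>2 / (2 * l\<^sup>2)" by simp
        ultimately have "- (norm x)\<^sup>2 / (2 * l\<^sup>2) \<le> 1 / 2 + - (norm x)\<^sup>2 / (2 * Q\<^sup>2)"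
          unfolding minus_divide_left[symmetric] by linarith
        then have "exp (- (norm x)\<^sup>2 / (2 * l\<^sup>2)) \<le> exp (1/2) * exp (- (norm x)\<^sup>2 / (2 * Q\<^sup>2))"
          by (subst exp_add[symmetric]) simp
        then have "kernel_avg a x * ?w l x \<le> kernel_avg a x * (ennreal (exp (1/2)) * ?w Q x)"
          by (intro mult_left_mono) (auto simp flip: ennreal_mult)
        also have "\<dots> = ennreal (exp (1/2)) * (kernel_avg a x * ?w Q x)" by (simp add: mult_ac)
        finally show ?thesis by (rule order_trans) simp
      next
        case False
        then have "kernel_avg a x \<le> ennreal k"
          using kernel_avg_antimono[OF a(1), of w x] w k by simp
        then have "kernel_avg a x * ?w l x \<le> ennreal k * ?w l x" by (intro mult_right_mono) auto
        then show ?thesis by (rule order_trans) simp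
      qed
    qed
    also have "\<dots> = ennreal (exp (1/2)) * (\<integral>\<^sup>+x. kernel_avg a x * ?w Q x \<partial>lborel) + ennreal k * (\<integral>\<^sup>+x. ?w l x \<partial>lborel)"
      by (subst nn_integral_add) (auto simp: nn_integral_cmult)
    also have "\<dots> = ennreal (exp (1/2)) * ennreal (?s * Q ^ CARD('n) / sqrt (a\<^sup>2 + Q\<^sup>2) ^ m) + ennreal k * ennreal (?s * l ^ CARD('n))"
      using nn_integral_kernel_avg_gaussian[OF a(1), of Q] gaussian_integral[of l] l Q by simp
    also have "\<dots> = ennreal (exp (1/2) * (?s * Q ^ CARD('n) / sqrt (a\<^sup>2 + Q\<^sup>2) ^ m) + k * (?s * l ^ CARD('n)))"
    proof -
      have "ennreal p * ennreal q + ennreal r * ennreal t = ennreal (p * q + r * t)"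
        if "0 \<le> p" "0 \<le> q" "0 \<le> r" "0 \<le> t" for p q r t
        using that by (simp add: ennreal_mult ennreal_plus)
      then show ?thesis using k Q l by simp
    qed
    finally have main: "?s * l ^ CARD('n) / sqrt (a\<^sup>2 + l\<^sup>2) ^ m \<le> exp (1/2) * (?s * Q ^ CARD('n) / sqrt (a\<^sup>2 + Q\<^sup>2) ^ m) + k * (?s * l ^ CARD('n))"
      using k Q l by (subst (asm) ennreal_le_iff) (auto intro!: add_nonneg_nonneg mult_nonneg_nonneg divide_nonneg_nonneg)
    have s: "0 < ?s" by simp
    have "sqrt (a\<^sup>2 + l\<^sup>2) \<le> sqrt 2 * l"
    proof (rule real_le_lsqrt)
      have "a\<^sup>2 \<le> l\<^sup>2" using a l by (intro power_mono) auto
      then show "a\<^sup>2 + l\<^sup>2 \<le> (sqrt 2 * l)\<^sup>2" by (simp add: power_mult_distrib)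
    qed (use l in auto)
    then have "sqrt (a\<^sup>2 + l\<^sup>2) ^ m \<le> sqrt 2 ^ m * l ^ m"
      using l by (simp add: power_mono flip: power_mult_distrib)
    moreover have "0 < sqrt (a\<^sup>2 + l\<^sup>2) ^ m" using a l by (intro zero_less_power) (auto simp: add_pos_pos)
    ultimately have "?s * l ^ CARD('n) / (sqrt 2 ^ m * l ^ m) \<le> ?s * l ^ CARD('n) / sqrt (a\<^sup>2 + l\<^sup>2) ^ m"
      using l by (intro divide_left_mono) auto
    then have low: "?s * (l ^ (CARD('n) - m) / sqrt 2 ^ m) \<le> ?s * l ^ CARD('n) / sqrt (a\<^sup>2 + l\<^sup>2) ^ m"
    proof -
      have "?s * (l ^ (CARD('n) - m) / sqrt 2 ^ m) = ?s * l ^ CARD('n) / (sqrt 2 ^ m * l ^ m)"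
        using pw[of l, symmetric] l by (simp add: mult.commute)
      with \<open>?s * l ^ CARD('n) / (sqrt 2 ^ m * l ^ m) \<le> _\<close> show ?thesis by simp
    qed
    have "Q \<le> sqrt (a\<^sup>2 + Q\<^sup>2)" using Q by (intro real_le_rsqrt) auto
    then have "Q ^ m \<le> sqrt (a\<^sup>2 + Q\<^sup>2) ^ m" using Q by (intro power_mono) auto
    then have "?s * Q ^ CARD('n) / sqrt (a\<^sup>2 + Q\<^sup>2) ^ m \<le> ?s * Q ^ CARD('n) / Q ^ m"
      using Q a by (intro divide_left_mono mult_pos_pos zero_less_power) (auto simp: add_pos_pos)
    then have up: "?s * Q ^ CARD('n) / sqrt (a\<^sup>2 + Q\<^sup>2) ^ m \<le> ?s * Q ^ (CARD('n) - m)"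
      using pw[of Q] Q by (metis less_le_trans times_divide_eq_right zero_less_one)
    have "?s * (l ^ (CARD('n) - m) / sqrt 2 ^ m) \<le> exp (1/2) * (?s * Q ^ (CARD('n) - m)) + k * (?s * l ^ CARD('n))"
      using low main up mult_left_mono[OF up, of "exp (1/2)"] by simp
    then have "?s * (l ^ (CARD('n) - m) / sqrt 2 ^ m) \<le> ?s * (exp (1/2) * Q ^ (CARD('n) - m) + k * l ^ CARD('n))"
      by (simp add: algebra_simps)
    then have 1: "l ^ (CARD('n) - m) / sqrt 2 ^ m \<le> exp (1/2) * Q ^ (CARD('n) - m) + k * l ^ CARD('n)"
      using s by (simp only: mult_le_cancel_left_pos)
    have "L \<le> L ^ (CARD('n) - m)" using L m by (intro self_le_power) auto
    then have "2 * exp (1/2) * sqrt 2 ^ m * Q ^ (CARD('n) - m) \<le> l ^ (CARD('n) - m)"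
      using Q by (simp add: l_def power_mult_distrib L_def mult_right_mono)
    then have "2 * exp (1/2) * Q ^ (CARD('n) - m) \<le> l ^ (CARD('n) - m) / sqrt 2 ^ m"
      by (simp add: field_simps)
    with 1 have "exp (1/2) * Q ^ (CARD('n) - m) \<le> k * l ^ CARD('n)" by linarith
    then have "c \<le> k" using l by (simp add: c_def divide_le_eq)
    then have "ennreal c \<le> kernel_avg a w" by (simp add: k ennreal_leI)
    also have "\<dots> \<le> kernel_avg a z" using z w Q by (intro kernel_avg_antimono a) auto
    finally show ?thesis .
  qed
  then show ?thesis using that c by blast
qed

end

section \<open>Smeared densities on the bundle of planes\<close>

text \<open>The geometric series over dyadic shells, with ratio \<open>2 powr (t - s)\<close>, plus
  1 for the distances above 1.\<close>

definition riesz_const :: "real \<Rightarrow> real \<Rightarrow> real" where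
  "riesz_const t s = 1 + 2 powr t / (1 - 2 powr (t - s))"

lemma riesz_const_nonneg: "t < s \<Longrightarrow> 0 \<le> riesz_const t s"
  using powr_less_mono[of "t - s" 0 "2::real"]
  by (auto simp: riesz_const_def intro!: add_nonneg_nonneg divide_nonneg_nonneg)

text \<open>Summation over dyadic shells. The kernel is truncated at \<open>1 / 2 ^ j\<close> and
  growth is required only for k \<le> j, because the sums of point masses built later satisfy a
  growth bound only down to their own scale.\<close>

lemma riesz_potential_bound:
  fixes \<mu> :: "'a::euclidean_space measure"
  assumes [measurable_cong]: "sets \<mu> = sets borel" and t: "0 \<le> t" "t < s" and c: "0 \<le> c"
    and growth: "\<And>k. k \<le> j \<Longrightarrow> emeasure \<mu> (cball x (1 / 2 ^ k)) \<le> ennreal (c * (1 / 2 ^ k) powr s)"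
    and total: "emeasure \<mu> UNIV \<le> ennreal c"
  shows "(\<integral>\<^sup>+z. ennreal ((max (1 / 2 ^ j) (dist x z)) powr - t) \<partial>\<mu>) \<le> ennreal (c * riesz_const t s)"
proof -
  define q where "q = 2 powr (t - s)"
  have q: "0 \<le> q" "q < 1" using t powr_less_mono[of "t - s" 0 "2::real"] by (auto simp: q_def)
  have pw: "(2::real) ^ k = 2 powr real k" for k by (simp add: powr_realpow)
  have pt: "ennreal ((max (1 / 2 ^ j) r) powr - t) \<le> 1 + (\<Sum>k\<le>j. ennreal (2 powr (real (Suc k) * t)) * indicator {..1 / 2 ^ k} r)" (is "_ \<le> 1 + ?S") if "0 \<le> r" for r
  proof (cases "r \<le> 1")
    case False
    have "(max (1 / 2 ^ j) r) powr - t \<le> 1 powr - t"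
      using False t by (intro powr_mono2') auto
    then have "ennreal ((max (1 / 2 ^ j) r) powr - t) \<le> 1" by (simp add: ennreal_leI flip: ennreal_1)
    then show ?thesis by (rule order_trans) simp
  next
    case True
    have "\<exists>k\<le>j. r \<le> 1 / 2 ^ k \<and> 1 / 2 ^ Suc k \<le> max (1 / 2 ^ j) r"
    proof (cases "r \<le> 1 / 2 ^ j")
      case True
      then show ?thesis by (intro exI[of _ j]) (auto simp: max_def divide_simps)
    next
      case False
      \<comment> \<open>The first scale strictly below r. Its predecessor, which exists because r
        \<le> 1, satisfies both inequalities.\<close>
      define k where "k = (LEAST i. 1 / 2 ^ i < r)"
      have k: "1 / 2 ^ k < r" unfolding k_def by (rule LeastI[of _ j]) (use False in auto)
      have "k \<le> j" unfolding k_def by (rule Least_le) (use False in auto)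
      have "k \<noteq> 0" using k True by (intro notI) simp
      then obtain i where i: "k = Suc i" by (cases k) auto
      have "\<not> 1 / 2 ^ i < r" using i not_less_Least[of i "\<lambda>i. 1 / 2 ^ i < r"] by (simp add: k_def)
      then show ?thesis using k i \<open>k \<le> j\<close> by (intro exI[of _ i]) auto
    qed
    then obtain k where k: "k \<le> j" "r \<le> 1 / 2 ^ k" "1 / 2 ^ Suc k \<le> max (1 / 2 ^ j) r" by auto
    have "(max (1 / 2 ^ j) r) powr - t \<le> (1 / 2 ^ Suc k) powr - t"
      using k t by (intro powr_mono2') auto
    also have "\<dots> = 2 powr (real (Suc k) * t)"
      by (simp only: pw powr_divide powr_powr powr_one_eq_one powr_minus) (simp add: powr_minus field_simps)
    finally have "ennreal ((max (1 / 2 ^ j) r) powr - t) \<le> ennreal (2 powr (real (Suc k) * t)) * indicator {..1 / 2 ^ k} r"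
      using k by (simp add: ennreal_leI)
    also have "\<dots> \<le> ?S" using k(1) by (intro member_le_sum) auto
    finally show ?thesis by (rule order_trans) simp
  qed
  have "(\<integral>\<^sup>+z. ennreal ((max (1 / 2 ^ j) (dist x z)) powr - t) \<partial>\<mu>)
    \<le> (\<integral>\<^sup>+z. 1 + (\<Sum>k\<le>j. ennreal (2 powr (real (Suc k) * t)) * indicator (cball x (1 / 2 ^ k)) z) \<partial>\<mu>)"
  proof (rule nn_integral_mono)
    fix z
    show "ennreal ((max (1 / 2 ^ j) (dist x z)) powr - t) \<le> 1 + (\<Sum>k\<le>j. ennreal (2 powr (real (Suc k) * t)) * indicator (cball x (1 / 2 ^ k)) z)"
      using pt[of "dist x z"] by (simp add: indicator_def cong: sum.cong)
  qed
  also have "\<dots> = emeasure \<mu> UNIV + (\<Sum>k\<le>j. ennreal (2 powr (real (Suc k) * t)) * emeasure \<mu> (cball x (1 / 2 ^ k)))"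
  proof -
    have sp: "space \<mu> = UNIV" using sets_eq_imp_space_eq[OF assms(1)] by simp
    have [measurable]: "cball x r \<in> sets \<mu>" for r by (simp add: assms(1))
    have "(\<integral>\<^sup>+z. 1 + (\<Sum>k\<le>j. ennreal (2 powr (real (Suc k) * t)) * indicator (cball x (1 / 2 ^ k)) z) \<partial>\<mu>)
      = (\<integral>\<^sup>+z. 1 \<partial>\<mu>) + (\<integral>\<^sup>+z. (\<Sum>k\<le>j. ennreal (2 powr (real (Suc k) * t)) * indicator (cball x (1 / 2 ^ k)) z) \<partial>\<mu>)"
      by (rule nn_integral_add) measurable
    also have "(\<integral>\<^sup>+z. (\<Sum>k\<le>j. ennreal (2 powr (real (Suc k) * t)) * indicator (cball x (1 / 2 ^ k)) z) \<partial>\<mu>)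
      = (\<Sum>k\<le>j. (\<integral>\<^sup>+z. ennreal (2 powr (real (Suc k) * t)) * indicator (cball x (1 / 2 ^ k)) z \<partial>\<mu>))"
      by (rule nn_integral_sum) measurable
    finally show ?thesis by (simp add: nn_integral_cmult_indicator sp)
  qed
  also have "\<dots> \<le> ennreal c + (\<Sum>k\<le>j. ennreal (2 powr (real (Suc k) * t)) * ennreal (c * (1 / 2 ^ k) powr s))"
    using total growth by (intro add_mono sum_mono mult_left_mono) auto
  also have "\<dots> = ennreal c + (\<Sum>k\<le>j. ennreal (c * 2 powr t * q ^ k))"
  proof -
    have "2 powr (real (Suc k) * t) * (c * (1 / 2 ^ k) powr s) = c * 2 powr t * q ^ k" for k
      by (simp add: q_def pw powr_divide powr_powr powr_diff power_divide ring_distribs powr_add mult_ac flip: powr_realpow)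
    note e = this
    have "ennreal (2 powr (real (Suc k) * t)) * ennreal (c * (1 / 2 ^ k) powr s) = ennreal (c * 2 powr t * q ^ k)" for k
      unfolding e[symmetric] using c by (intro ennreal_mult[symmetric]) auto
    then show ?thesis by (simp del: of_nat_Suc)
  qed
  also have "\<dots> = ennreal (c + c * 2 powr t * (\<Sum>k\<le>j. q ^ k))"
    unfolding sum_distrib_left using c q
    by (subst ennreal_plus) (auto simp: sum_ennreal intro!: sum_nonneg mult_nonneg_nonneg)
  also have "\<dots> \<le> ennreal (c * riesz_const t s)"
  proof (rule ennreal_leI)
    have "(\<Sum>k\<le>j. q ^ k) \<le> 1 / (1 - q)"
      using q sum_le_suminf[of "\<lambda>k. q ^ k" "{..j}"] suminf_geometric[of q] summable_geometric[of q] by simp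
    then have "c * 2 powr t * (\<Sum>k\<le>j. q ^ k) \<le> c * 2 powr t * (1 / (1 - q))"
      using c by (intro mult_left_mono) auto
    then show "c + c * 2 powr t * (\<Sum>k\<le>j. q ^ k) \<le> c * riesz_const t s"
      by (simp add: riesz_const_def q_def algebra_simps)
  qed
  finally show ?thesis .
qed

lemma riesz_energy_bound:
  fixes \<mu> \<nu> :: "'a::euclidean_space measure"
  assumes [measurable_cong]: "sets \<mu> = sets borel" "sets \<nu> = sets borel"
    and fin: "finite_measure \<mu>" "finite_measure \<nu>" and t: "0 \<le> t" "t < s" and c: "0 \<le> c"
    and growth: "AE x in \<nu>. \<forall>k\<le>j. emeasure \<mu> (cball x (1 / 2 ^ k)) \<le> ennreal (c * (1 / 2 ^ k) powr s)"
    and total: "emeasure \<mu> UNIV \<le> ennreal c"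
  shows "(\<integral>\<^sup>+p. ennreal ((max (1 / 2 ^ j) (dist (fst p) (snd p))) powr - t) \<partial>(\<nu> \<Otimes>\<^sub>M \<mu>))
    \<le> ennreal (c * riesz_const t s) * emeasure \<nu> UNIV"
proof -
  interpret M: finite_measure \<mu> by fact
  have "(\<integral>\<^sup>+p. ennreal ((max (1 / 2 ^ j) (dist (fst p) (snd p))) powr - t) \<partial>(\<nu> \<Otimes>\<^sub>M \<mu>))
    = (\<integral>\<^sup>+x. (\<integral>\<^sup>+z. ennreal ((max (1 / 2 ^ j) (dist x z)) powr - t) \<partial>\<mu>) \<partial>\<nu>)"
    by (subst M.nn_integral_fst[symmetric]) auto
  also have "\<dots> \<le> (\<integral>\<^sup>+x. ennreal (c * riesz_const t s) \<partial>\<nu>)"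
    using growth by (intro nn_integral_mono_AE) (auto intro!: riesz_potential_bound[OF assms(1) t c _ total])
  also have "\<dots> = ennreal (c * riesz_const t s) * emeasure \<nu> UNIV"
    using sets_eq_imp_space_eq[OF assms(2)] by simp
  finally show ?thesis .
qed

text \<open>Increments over equal steps are nondecreasing, so a single positive one would force
  linear growth past the bound B. It is applied to the energy as a function of the squared
  scale.\<close>

lemma midpoint_convex_bounded_antimono:
  fixes f :: "real \<Rightarrow> real"
  assumes mid: "\<And>u h. 0 < u \<Longrightarrow> 0 < h \<Longrightarrow> 2 * f (u + h) \<le> f u + f (u + 2 * h)"
    and bdd: "\<And>u. 0 < u \<Longrightarrow> f u \<le> B" and uv: "0 < u" "u \<le> v"
  shows "f v \<le> f u"
proof (rule ccontr)
  assume nle: "\<not> f v \<le> f u"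
  define h where "h = v - u"
  have h: "0 < h" using nle uv by (auto simp: h_def less_le)
  define d where "d = f (u + h) - f u"
  have d: "0 < d" using nle by (simp add: d_def h_def)
  have step: "d \<le> f (u + real (Suc k) * h) - f (u + real k * h)" for k
  proof (induction k)
    case 0
    show ?case by (simp add: d_def)
  next
    case (Suc k)
    have "0 < u + real k * h" using uv h by (simp add: add_pos_nonneg)
    from mid[OF this h] Suc show ?case by (simp add: algebra_simps)
  qed
  have lin: "f u + real k * d \<le> f (u + real k * h)" for k
  proof (induction k)
    case (Suc k)
    then show ?case using step[of k] by (simp add: algebra_simps)
  qed simp
  obtain k where "(B - f u) / d < real k" using reals_Archimedean2 by blast
  then have "B < f u + real k * d" using d by (simp add: field_simps)
  also have "\<dots> \<le> f (u + real k * h)" by (rule lin)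
  also have "\<dots> \<le> B" using uv h by (intro bdd) (simp add: add_pos_nonneg)
  finally show False by simp
qed

context invariant_grassmannian
begin

definition plane_bundle :: "((real^'n) \<times> (real^'n) set) measure" where
  "plane_bundle = density (lborel \<Otimes>\<^sub>M \<gamma>) (\<lambda>(y, V). ennreal (fiber_weight V y))"

lemma sets_plane_bundle [measurable_cong]: "sets plane_bundle = sets (borel \<Otimes>\<^sub>M \<gamma>)"
  by (simp add: plane_bundle_def cong: sets_pair_measure_cong)

lemma space_plane_bundle: "space plane_bundle = UNIV \<times> space \<gamma>"
  by (simp add: plane_bundle_def space_pair_measure)

definition gauss_const :: real where "gauss_const = sqrt (2 * pi) ^ CARD('n)"

lemma gauss_const_pos: "0 < gauss_const"
  by (simp add: gauss_const_def)

lemma fiber_weight_nonneg [simp]: "0 \<le> fiber_weight V y"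
  by (simp add: fiber_weight_def)

text \<open>The weight is Gaussian along V and constant across, so this measure stands in for the
  integration over the quotients by the subspaces V.\<close>

lemma nn_integral_bundle:
  assumes [measurable]: "f \<in> borel_measurable (borel \<Otimes>\<^sub>M \<gamma>)"
  shows "(\<integral>\<^sup>+x. f x \<partial>plane_bundle) = (\<integral>\<^sup>+V. (\<integral>\<^sup>+y. f (y, V) * ennreal (fiber_weight V y) \<partial>lborel) \<partial>\<gamma>)"
proof -
  interpret pair_sigma_finite "lborel :: (real^'n) measure" \<gamma> ..
  have "(\<integral>\<^sup>+x. f x \<partial>plane_bundle) = (\<integral>\<^sup>+x. ennreal (fiber_weight (snd x) (fst x)) * f x \<partial>(lborel \<Otimes>\<^sub>M \<gamma>))"
    unfolding plane_bundle_def by (subst nn_integral_density) (auto simp: case_prod_beta')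
  also have "\<dots> = (\<integral>\<^sup>+V. (\<integral>\<^sup>+y. ennreal (fiber_weight V y) * f (y, V) \<partial>lborel) \<partial>\<gamma>)"
    by (subst nn_integral_snd[symmetric]) (auto simp: case_prod_beta')
  finally show ?thesis by (simp add: mult.commute)
qed

lemma nn_integral_bundle_kernels:
  assumes ab: "0 < a" "0 < b"
  shows "(\<integral>\<^sup>+x. ennreal (gauss_kernel m a (snd x) (fst x - z) * gauss_kernel m b (snd x) (fst x - w)) \<partial>plane_bundle)
    = ennreal gauss_const * kernel_avg (sqrt (a\<^sup>2 + b\<^sup>2)) (z - w)"
proof -
  have "(\<integral>\<^sup>+x. ennreal (gauss_kernel m a (snd x) (fst x - z) * gauss_kernel m b (snd x) (fst x - w)) \<partial>plane_bundle)
    = (\<integral>\<^sup>+V. (\<integral>\<^sup>+y. ennreal (gauss_kernel m a V (y - z) * gauss_kernel m b V (y - w) * fiber_weight V y) \<partial>lborel) \<partial>\<gamma>)"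
    using ab by (subst nn_integral_bundle) (auto simp: ennreal_mult intro!: nn_integral_cong)
  also have "\<dots> = (\<integral>\<^sup>+V. ennreal (gauss_const * gauss_kernel m (sqrt (a\<^sup>2 + b\<^sup>2)) V (z - w)) \<partial>\<gamma>)"
    unfolding gauss_const_def using m
    by (intro nn_integral_cong nn_integral_gauss_kernel_product ab) (auto simp: space_gamma)
  also have "\<dots> = ennreal gauss_const * kernel_avg (sqrt (a\<^sup>2 + b\<^sup>2)) (z - w)"
    unfolding kernel_avg_def using gauss_const_pos
    by (subst nn_integral_cmult[symmetric]) (auto simp: ennreal_mult)
  finally show ?thesis .
qed

text \<open>Tonelli with a free weight on the pairs: the weight 1 yields the pairing of smeared
  densities, a truncated Riesz kernel yields the integrated slice energy.\<close>

lemma nn_integral_bundle_weighted_pairs: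
  fixes \<mu> \<nu> :: "(real^'n) measure"
  assumes [measurable_cong]: "sets \<mu> = sets borel" "sets \<nu> = sets borel"
    and fin: "finite_measure \<mu>" "finite_measure \<nu>" and ab: "0 < a" "0 < b"
    and [measurable]: "q \<in> borel_measurable (borel \<Otimes>\<^sub>M borel)"
  shows "(\<integral>\<^sup>+x. (\<integral>\<^sup>+p. q p * ennreal (gauss_kernel m a (snd x) (fst x - fst p) * gauss_kernel m b (snd x) (fst x - snd p)) \<partial>(\<mu> \<Otimes>\<^sub>M \<nu>)) \<partial>plane_bundle)
    = ennreal gauss_const * (\<integral>\<^sup>+p. q p * kernel_avg (sqrt (a\<^sup>2 + b\<^sup>2)) (fst p - snd p) \<partial>(\<mu> \<Otimes>\<^sub>M \<nu>))"
proof -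
  interpret M: finite_measure \<mu> by fact
  interpret N: finite_measure \<nu> by fact
  interpret MN: pair_sigma_finite \<mu> \<nu> ..
  interpret L: pair_sigma_finite "lborel :: (real^'n) measure" \<gamma> ..
  interpret LMN: pair_sigma_finite "(lborel :: (real^'n) measure) \<Otimes>\<^sub>M \<gamma>" "\<mu> \<Otimes>\<^sub>M \<nu>" ..
  let ?g = "\<lambda>x p. q p * ennreal (gauss_kernel m a (snd x) (fst x - fst p) * gauss_kernel m b (snd x) (fst x - snd p))"
  let ?w = "\<lambda>x. ennreal (fiber_weight (snd x) (fst x))"
  have "(\<integral>\<^sup>+x. (\<integral>\<^sup>+p. ?g x p \<partial>(\<mu> \<Otimes>\<^sub>M \<nu>)) \<partial>plane_bundle)
    = (\<integral>\<^sup>+x. ?w x * (\<integral>\<^sup>+p. ?g x p \<partial>(\<mu> \<Otimes>\<^sub>M \<nu>)) \<partial>(lborel \<Otimes>\<^sub>M \<gamma>))"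
    unfolding plane_bundle_def by (subst nn_integral_density) (auto simp: case_prod_beta')
  also have "\<dots> = (\<integral>\<^sup>+x. (\<integral>\<^sup>+p. ?w x * ?g x p \<partial>(\<mu> \<Otimes>\<^sub>M \<nu>)) \<partial>(lborel \<Otimes>\<^sub>M \<gamma>))"
    by (intro nn_integral_cong nn_integral_cmult[symmetric]) measurable
  also have "\<dots> = (\<integral>\<^sup>+p. (\<integral>\<^sup>+x. ?w x * ?g x p \<partial>(lborel \<Otimes>\<^sub>M \<gamma>)) \<partial>(\<mu> \<Otimes>\<^sub>M \<nu>))"
    by (rule LMN.Fubini'[symmetric]) measurable
  also have "\<dots> = (\<integral>\<^sup>+p. (\<integral>\<^sup>+x. ?g x p \<partial>plane_bundle) \<partial>(\<mu> \<Otimes>\<^sub>M \<nu>))"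
    unfolding plane_bundle_def
    by (rule nn_integral_cong, subst nn_integral_density) (auto simp: case_prod_beta')
  also have "\<dots> = (\<integral>\<^sup>+p. q p * (ennreal gauss_const * kernel_avg (sqrt (a\<^sup>2 + b\<^sup>2)) (fst p - snd p)) \<partial>(\<mu> \<Otimes>\<^sub>M \<nu>))"
    by (intro nn_integral_cong, subst nn_integral_cmult, measurable) (simp add: nn_integral_bundle_kernels[OF ab])
  also have "\<dots> = (\<integral>\<^sup>+p. ennreal gauss_const * (q p * kernel_avg (sqrt (a\<^sup>2 + b\<^sup>2)) (fst p - snd p)) \<partial>(\<mu> \<Otimes>\<^sub>M \<nu>))"
    by (simp add: mult_ac)
  also have "\<dots> = ennreal gauss_const * (\<integral>\<^sup>+p. q p * kernel_avg (sqrt (a\<^sup>2 + b\<^sup>2)) (fst p - snd p) \<partial>(\<mu> \<Otimes>\<^sub>M \<nu>))"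
    by (rule nn_integral_cmult) measurable
  finally show ?thesis .
qed

text \<open>For x = (y, V), and up to a constant, the mass of \<open>\<mu>\<close> near the plane V
  + y per unit of transversal volume: an approximate density at y of the projection of
  \<open>\<mu>\<close> along V.\<close>

definition smear :: "(real^'n) measure \<Rightarrow> real \<Rightarrow> (real^'n) \<times> (real^'n) set \<Rightarrow> real" where
  "smear \<mu> a x = (\<integral>z. gauss_kernel m a (snd x) (fst x - z) \<partial>\<mu>)"

definition energy :: "(real^'n) measure \<Rightarrow> (real^'n) measure \<Rightarrow> real \<Rightarrow> ennreal" where
  "energy \<mu> \<nu> \<tau> = (\<integral>\<^sup>+p. kernel_avg \<tau> (fst p - snd p) \<partial>(\<mu> \<Otimes>\<^sub>M \<nu>))"

lemma gauss_kernel_measurable_borel: "(\<lambda>z. gauss_kernel m a V (y - z)) \<in> borel_measurable borel"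
proof -
  have [measurable]: "(\<lambda>z. infdist (y - z) V) \<in> borel_measurable borel"
    by (intro borel_measurable_continuous_onI continuous_intros)
  show ?thesis unfolding gauss_kernel_def by measurable
qed

lemma smear_nonneg: "0 < a \<Longrightarrow> 0 \<le> smear \<mu> a x"
  unfolding smear_def by (intro integral_nonneg_AE) auto

lemma ennreal_smear:
  assumes "sets \<mu> = sets borel" "finite_measure \<mu>" and a: "0 < a"
  shows "ennreal (smear \<mu> a x) = (\<integral>\<^sup>+z. ennreal (gauss_kernel m a (snd x) (fst x - z)) \<partial>\<mu>)"
proof -
  interpret M: finite_measure \<mu> by fact
  have [measurable]: "(\<lambda>z. gauss_kernel m a (snd x) (fst x - z)) \<in> borel_measurable \<mu>"
    using gauss_kernel_measurable_borel measurable_cong_sets[OF assms(1) refl] by blast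
  have "integrable \<mu> (\<lambda>z. gauss_kernel m a (snd x) (fst x - z))"
    using a gauss_kernel_le[OF a] by (intro M.integrable_const_bound[of _ "1 / a ^ m"]) auto
  then show ?thesis using a unfolding smear_def by (subst nn_integral_eq_integral) auto
qed

lemma smear_measurable:
  assumes [measurable_cong]: "sets \<mu> = sets borel" and "finite_measure \<mu>"
  shows "smear \<mu> a \<in> borel_measurable (borel \<Otimes>\<^sub>M \<gamma>)"
proof -
  interpret M: finite_measure \<mu> by fact
  show ?thesis unfolding smear_def by measurable
qed

lemma smear_le:
  assumes "sets \<mu> = sets borel" "finite_measure \<mu>" and a: "0 < a"
  shows "smear \<mu> a x \<le> measure \<mu> UNIV / a ^ m"
proof -
  interpret M: finite_measure \<mu> by fact
  have sp: "space \<mu> = UNIV" using sets_eq_imp_space_eq[OF assms(1)] by simp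
  have "ennreal (smear \<mu> a x) \<le> (\<integral>\<^sup>+z. ennreal (1 / a ^ m) \<partial>\<mu>)"
    unfolding ennreal_smear[OF assms] by (intro nn_integral_mono ennreal_leI gauss_kernel_le a)
  also have "\<dots> = ennreal (measure \<mu> UNIV / a ^ m)"
    using a sp by (simp add: M.emeasure_eq_measure flip: ennreal_mult)
  finally show ?thesis using a by (subst (asm) ennreal_le_iff) auto
qed

lemma ennreal_smear_mult:
  assumes [measurable_cong]: "sets \<mu> = sets borel" "sets \<nu> = sets borel"
    and fin: "finite_measure \<mu>" "finite_measure \<nu>" and ab: "0 < a" "0 < b"
  shows "ennreal (smear \<mu> a x * smear \<nu> b x)
    = (\<integral>\<^sup>+p. ennreal (gauss_kernel m a (snd x) (fst x - fst p) * gauss_kernel m b (snd x) (fst x - snd p)) \<partial>(\<mu> \<Otimes>\<^sub>M \<nu>))"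
proof -
  interpret N: finite_measure \<nu> by fact
  note [measurable] = gauss_kernel_measurable_borel
  have [measurable]: "(\<lambda>p. gauss_kernel m a V (y - fst p)) \<in> borel_measurable (\<mu> \<Otimes>\<^sub>M \<nu>)" for a V y
    by (rule measurable_compose[OF _ gauss_kernel_measurable_borel]) measurable
  have [measurable]: "(\<lambda>p. gauss_kernel m a V (y - snd p)) \<in> borel_measurable (\<mu> \<Otimes>\<^sub>M \<nu>)" for a V y
    by (rule measurable_compose[OF _ gauss_kernel_measurable_borel]) measurable
  have "(\<integral>\<^sup>+p. ennreal (gauss_kernel m a (snd x) (fst x - fst p) * gauss_kernel m b (snd x) (fst x - snd p)) \<partial>(\<mu> \<Otimes>\<^sub>M \<nu>))
    = (\<integral>\<^sup>+z. (\<integral>\<^sup>+w. ennreal (gauss_kernel m a (snd x) (fst x - z)) * ennreal (gauss_kernel m b (snd x) (fst x - w)) \<partial>\<nu>) \<partial>\<mu>)"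
    using ab by (subst N.nn_integral_fst[symmetric]) (auto simp: ennreal_mult)
  also have "\<dots> = (\<integral>\<^sup>+z. ennreal (gauss_kernel m a (snd x) (fst x - z)) * ennreal (smear \<nu> b x) \<partial>\<mu>)"
    unfolding ennreal_smear[OF assms(2) fin(2) ab(2)]
    by (intro nn_integral_cong nn_integral_cmult) measurable
  also have "\<dots> = ennreal (smear \<mu> a x) * ennreal (smear \<nu> b x)"
    unfolding ennreal_smear[OF assms(1) fin(1) ab(1)] by (rule nn_integral_multc) measurable
  finally show ?thesis using ab by (simp add: ennreal_mult smear_nonneg)
qed

lemma smear_pairing:
  assumes s: "sets \<mu> = sets borel" "sets \<nu> = sets borel"
    and fin: "finite_measure \<mu>" "finite_measure \<nu>" and ab: "0 < a" "0 < b"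
  shows "(\<integral>\<^sup>+x. ennreal (smear \<mu> a x * smear \<nu> b x) \<partial>plane_bundle) = ennreal gauss_const * energy \<mu> \<nu> (sqrt (a\<^sup>2 + b\<^sup>2))"
  using nn_integral_bundle_weighted_pairs[OF s fin ab, of "\<lambda>_. 1"]
  by (simp add: ennreal_smear_mult[OF s fin ab] energy_def)

text \<open>Expansion of the square, with the cross term moved to the left since subtraction in
  \<open>ennreal\<close> is truncated.\<close>

lemma smear_diff_identity:
  assumes s: "sets \<mu> = sets borel" and fin: "finite_measure \<mu>" and ab: "0 < a" "0 < b"
  shows "(\<integral>\<^sup>+x. ennreal ((smear \<mu> a x - smear \<mu> b x)\<^sup>2) \<partial>plane_bundle) + 2 * (ennreal gauss_const * energy \<mu> \<mu> (sqrt (a\<^sup>2 + b\<^sup>2)))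
    = ennreal gauss_const * energy \<mu> \<mu> (sqrt (2 * a\<^sup>2)) + ennreal gauss_const * energy \<mu> \<mu> (sqrt (2 * b\<^sup>2))"
proof -
  note [measurable] = smear_measurable[OF s fin]
  have eq: "ennreal ((smear \<mu> a x - smear \<mu> b x)\<^sup>2) + 2 * ennreal (smear \<mu> a x * smear \<mu> b x)
    = ennreal (smear \<mu> a x * smear \<mu> a x) + ennreal (smear \<mu> b x * smear \<mu> b x)" for x
  proof -
    define p q where "p = smear \<mu> a x" and "q = smear \<mu> b x"
    have pq: "0 \<le> p" "0 \<le> q" using ab by (auto simp: p_def q_def smear_nonneg)
    have "ennreal ((p - q)\<^sup>2) + ennreal (2 * (p * q)) = ennreal ((p - q)\<^sup>2 + 2 * (p * q))"
      using pq by (intro ennreal_plus[symmetric]) auto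
    also have "(p - q)\<^sup>2 + 2 * (p * q) = p * p + q * q" by (simp add: power2_eq_square algebra_simps)
    also have "ennreal (p * p + q * q) = ennreal (p * p) + ennreal (q * q)"
      using pq by (intro ennreal_plus) auto
    also have "ennreal (2 * (p * q)) = 2 * ennreal (p * q)"
      using pq by (simp add: ennreal_mult)
    finally show ?thesis by (simp add: p_def q_def)
  qed
  have "(\<integral>\<^sup>+x. ennreal ((smear \<mu> a x - smear \<mu> b x)\<^sup>2) \<partial>plane_bundle) + 2 * (\<integral>\<^sup>+x. ennreal (smear \<mu> a x * smear \<mu> b x) \<partial>plane_bundle)
    = (\<integral>\<^sup>+x. ennreal ((smear \<mu> a x - smear \<mu> b x)\<^sup>2) + 2 * ennreal (smear \<mu> a x * smear \<mu> b x) \<partial>plane_bundle)"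
    by (subst nn_integral_add) (auto simp: nn_integral_cmult)
  also have "\<dots> = (\<integral>\<^sup>+x. ennreal (smear \<mu> a x * smear \<mu> a x) \<partial>plane_bundle) + (\<integral>\<^sup>+x. ennreal (smear \<mu> b x * smear \<mu> b x) \<partial>plane_bundle)"
    unfolding eq by (rule nn_integral_add) measurable
  finally show ?thesis
    by (simp add: smear_pairing[OF s s fin fin] ab)
qed

text \<open>Up to \<open>gauss_const\<close>, the squared distance of the densities is \<open>f (2 *
  a\<^sup>2) + f (2 * b\<^sup>2) - 2 * f (a\<^sup>2 + b\<^sup>2)\<close>. Being nonnegative, it
  makes \<open>f\<close> midpoint convex; boundedness then makes \<open>f\<close> nonincreasing, and
  close to 0, where \<open>f\<close> is near its supremum, the expression is small.\<close>

lemma smear_Cauchy: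
  assumes s: "sets \<mu> = sets borel" and fin: "finite_measure \<mu>"
    and bdd: "\<And>\<tau>. 0 < \<tau> \<Longrightarrow> energy \<mu> \<mu> \<tau> \<le> ennreal B" and e: "0 < e"
  obtains d where "0 < d" "\<And>a b. 0 < a \<Longrightarrow> a < d \<Longrightarrow> 0 < b \<Longrightarrow> b < d \<Longrightarrow>
    (\<integral>\<^sup>+x. ennreal ((smear \<mu> a x - smear \<mu> b x)\<^sup>2) \<partial>plane_bundle) \<le> ennreal e"
proof -
  define f where "f u = enn2real (energy \<mu> \<mu> (sqrt u))" for u
  have f: "energy \<mu> \<mu> (sqrt u) = ennreal (f u)" "0 \<le> f u" if "0 < u" for u
    using bdd[of "sqrt u"] that by (auto simp: f_def ennreal_enn2real_if top_unique)
  have fB: "f u \<le> max 0 B" if "0 < u" for u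
    using bdd[of "sqrt u"] f[OF that] that by (auto simp: ennreal_le_iff2)
  define D where "D a b = enn2real (\<integral>\<^sup>+x. ennreal ((smear \<mu> a x - smear \<mu> b x)\<^sup>2) \<partial>plane_bundle)" for a b
  have D: "(\<integral>\<^sup>+x. ennreal ((smear \<mu> a x - smear \<mu> b x)\<^sup>2) \<partial>plane_bundle) = ennreal (D a b)"
    "D a b + 2 * (gauss_const * f (a\<^sup>2 + b\<^sup>2)) = gauss_const * f (2 * a\<^sup>2) + gauss_const * f (2 * b\<^sup>2)" "0 \<le> D a b"
    if ab: "0 < a" "0 < b" for a b
  proof -
    have pos: "0 < a\<^sup>2 + b\<^sup>2" "0 < 2 * a\<^sup>2" "0 < 2 * b\<^sup>2" using ab by (auto simp: add_pos_pos)
    have id: "(\<integral>\<^sup>+x. ennreal ((smear \<mu> a x - smear \<mu> b x)\<^sup>2) \<partial>plane_bundle) + ennreal (2 * (gauss_const * f (a\<^sup>2 + b\<^sup>2)))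
      = ennreal (gauss_const * f (2 * a\<^sup>2) + gauss_const * f (2 * b\<^sup>2))"
      using smear_diff_identity[OF s fin ab] f[OF pos(1)] f[OF pos(2)] f[OF pos(3)] gauss_const_pos
      by (simp add: ennreal_mult)
    then have "(\<integral>\<^sup>+x. ennreal ((smear \<mu> a x - smear \<mu> b x)\<^sup>2) \<partial>plane_bundle) \<noteq> \<top>" by auto
    then show 1: "(\<integral>\<^sup>+x. ennreal ((smear \<mu> a x - smear \<mu> b x)\<^sup>2) \<partial>plane_bundle) = ennreal (D a b)"
      by (simp add: D_def ennreal_enn2real_if)
    show D0: "0 \<le> D a b" by (simp add: D_def)
    have "ennreal (D a b + 2 * (gauss_const * f (a\<^sup>2 + b\<^sup>2))) = ennreal (gauss_const * f (2 * a\<^sup>2) + gauss_const * f (2 * b\<^sup>2))"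
      using id D0 f(2)[OF pos(1)] gauss_const_pos unfolding 1 by (subst ennreal_plus) auto
    then show "D a b + 2 * (gauss_const * f (a\<^sup>2 + b\<^sup>2)) = gauss_const * f (2 * a\<^sup>2) + gauss_const * f (2 * b\<^sup>2)"
      using D0 f(2)[OF pos(1)] f(2)[OF pos(2)] f(2)[OF pos(3)] gauss_const_pos
      by (subst (asm) ennreal_inj) auto
  qed
  have mid: "2 * f (u + h) \<le> f u + f (u + 2 * h)" if "0 < u" "0 < h" for u h
  proof -
    \<comment> \<open>Widths that place the three energies of the identity at u, u + h and u + 2
      h.\<close>
    let ?a = "sqrt (u / 2)" and ?b = "sqrt ((u + 2 * h) / 2)"
    have ab: "0 < ?a" "0 < ?b" using that by auto
    have sq: "?a\<^sup>2 = u / 2" "?b\<^sup>2 = (u + 2 * h) / 2" using that by auto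
    have e: "?a\<^sup>2 + ?b\<^sup>2 = u + h" "2 * ?a\<^sup>2 = u" "2 * ?b\<^sup>2 = u + 2 * h"
      unfolding sq by (simp_all add: field_simps)
    have "gauss_const * (2 * f (u + h)) \<le> gauss_const * (f u + f (u + 2 * h))"
      using D(2)[OF ab, unfolded e] D(3)[OF ab] unfolding distrib_left by linarith
    then show ?thesis using gauss_const_pos by simp
  qed
  have anti: "f v \<le> f u" if "0 < u" "u \<le> v" for u v
    using midpoint_convex_bounded_antimono[of f, OF mid fB that] .
  define L where "L = (SUP u\<in>{0<..}. f u)"
  have bddf: "bdd_above (f ` {0<..})" using fB by (intro bdd_aboveI2) auto
  have fL: "f u \<le> L" if "0 < u" for u
    unfolding L_def using that by (intro cSUP_upper bddf) auto
  define e' where "e' = e / (2 * gauss_const)"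
  have e': "0 < e'" using e gauss_const_pos by (simp add: e'_def)
  have "\<exists>u\<in>{0<..}. L - e' < f u"
    using less_cSUP_iff[of "{0<..}" f "L - e'"] bddf e' by (auto simp: L_def)
  then obtain u0 where u0: "0 < u0" "L - e' < f u0" by auto
  show ?thesis
  proof (rule that[of "sqrt (u0 / 2)"])
    fix a b assume ab: "0 < a" "a < sqrt (u0 / 2)" "0 < b" "b < sqrt (u0 / 2)"
    have "a\<^sup>2 \<le> u0 / 2" "b\<^sup>2 \<le> u0 / 2" using ab u0
      by (smt (verit) power_mono real_sqrt_pow2 divide_nonneg_nonneg)+
    then have "f u0 \<le> f (a\<^sup>2 + b\<^sup>2)" using ab by (intro anti) (auto simp: add_pos_pos)
    moreover have "f (2 * a\<^sup>2) \<le> L" "f (2 * b\<^sup>2) \<le> L" using ab by (auto intro!: fL)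
    ultimately have "f (2 * a\<^sup>2) + f (2 * b\<^sup>2) - 2 * f (a\<^sup>2 + b\<^sup>2) \<le> 2 * e'" using u0 by linarith
    then have "gauss_const * (f (2 * a\<^sup>2) + f (2 * b\<^sup>2) - 2 * f (a\<^sup>2 + b\<^sup>2)) \<le> gauss_const * (2 * e')"
      using gauss_const_pos by (intro mult_left_mono) auto
    also have "\<dots> = e" using gauss_const_pos by (simp add: e'_def)
    finally have "D a b \<le> e" using D(2)[of a b] ab by (simp add: algebra_simps)
    then show "(\<integral>\<^sup>+x. ennreal ((smear \<mu> a x - smear \<mu> b x)\<^sup>2) \<partial>plane_bundle) \<le> ennreal e"
      using D(1)[of a b] ab by (simp add: ennreal_leI)
  qed (use u0 in auto)
qed

end

section \<open>Thin slices\<close>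

lemma infdist_subspace_triangle:
  fixes V :: "'a::euclidean_space set"
  assumes "subspace V"
  shows "infdist (x + y) V \<le> infdist x V + infdist y V"
proof -
  have cl: "closed V" "V \<noteq> {}" using assms closed_subspace subspace_0 by auto
  obtain v where v: "v \<in> V" "infdist x V = dist x v" using infdist_attains_inf[OF cl] by metis
  obtain w where w: "w \<in> V" "infdist y V = dist y w" using infdist_attains_inf[OF cl] by metis
  have "infdist (x + y) V \<le> dist (x + y) (v + w)"
    using v w assms by (intro infdist_le subspace_add)
  also have "\<dots> \<le> dist x v + dist y w" by (rule dist_triangle_add)
  finally show ?thesis using v w by simp
qed

lemma infdist_subspace_uminus:
  fixes V :: "'a::euclidean_space set"
  assumes "subspace V"
  shows "infdist (- x) V = infdist x V"
proof -
  have "infdist (- y) V \<le> infdist y V" for y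
  proof -
    have cl: "closed V" "V \<noteq> {}" using assms closed_subspace subspace_0 by auto
    obtain v where v: "v \<in> V" "infdist y V = dist y v" using infdist_attains_inf[OF cl] by metis
    have "infdist (- y) V \<le> dist (- y) (- v)" using v assms by (intro infdist_le subspace_neg)
    then show ?thesis using v by (simp add: dist_minus)
  qed
  from this[of x] this[of "- x"] show ?thesis by simp
qed

text \<open>The pairs (y, V) for which the part of C on the plane V + y is covered by finitely many balls
  from a countable family with total t-content below a. By compactness the remainder of C then
  stays a positive distance away from that plane.\<close>

definition ball_union :: "('a::metric_space \<times> real) set \<Rightarrow> 'a set" where
  "ball_union F = (\<Union>(c, r)\<in>F. ball c r)"

definition thin_slices :: "'a::euclidean_space set \<Rightarrow> 'a set \<Rightarrow> real \<Rightarrow> real \<Rightarrow> ('a \<times> 'a set) set" where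
  "thin_slices D C t a = {(y, V). \<exists>F. finite F \<and> F \<subseteq> D \<times> (\<rat> \<inter> {0<..}) \<and> (\<Sum>(c, r)\<in>F. (2 * r) powr t) < a \<and>
     (\<exists>\<eta>>0. \<forall>z\<in>C - ball_union F. \<eta> \<le> infdist (z - y) V)}"

text \<open>The same family F works for the nearby planes; half of the gap is spent on the
  translation.\<close>

lemma thin_slices_open:
  fixes V :: "'a::euclidean_space set"
  assumes V: "subspace V" and x: "(x, V) \<in> thin_slices D C t a"
  obtains \<eta> where "0 < \<eta>" "\<And>y. infdist (y - x) V < \<eta> \<Longrightarrow> (y, V) \<in> thin_slices D C t a"
proof -
  obtain F \<eta> where F: "finite F" "F \<subseteq> D \<times> (\<rat> \<inter> {0<..})" "(\<Sum>(c, r)\<in>F. (2 * r) powr t) < a"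
    and \<eta>: "0 < \<eta>" "\<And>z. z \<in> C - ball_union F \<Longrightarrow> \<eta> \<le> infdist (z - x) V"
    using x by (auto simp: thin_slices_def)
  show ?thesis
  proof (rule that[of "\<eta> / 2"])
    fix y assume y: "infdist (y - x) V < \<eta> / 2"
    have "\<eta> / 2 \<le> infdist (z - y) V" if "z \<in> C - ball_union F" for z
      using infdist_subspace_triangle[OF V, of "z - y" "y - x"] \<eta>(2)[OF that] y by simp
    then show "(y, V) \<in> thin_slices D C t a"
      unfolding thin_slices_def using F \<eta>(1) by (auto intro!: exI[of _ F] exI[of _ "\<eta> / 2"])
  qed (use \<eta> in auto)
qed

text \<open>The balls must come from a countable family, so each set of a cheap cover is enlarged to
  a ball with centre in D and rational radius; compactness of the slice leaves finitely many of
  them.\<close>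

lemma thin_slices_if_null:
  fixes C V :: "'a::euclidean_space set"
  assumes C: "compact C" and V: "subspace V" and t: "0 < t" and a: "0 < a"
    and D: "\<And>X. open X \<Longrightarrow> X \<noteq> {} \<Longrightarrow> \<exists>d\<in>D. d \<in> X"
    and null: "hausdorff_measure t (C \<inter> (\<lambda>v. v + x) ` V) = 0"
  shows "(x, V) \<in> thin_slices D C t a"
proof -
  define X where "X = C \<inter> (\<lambda>v. v + x) ` V"
  have clV: "closed V" "V \<noteq> {}" using V closed_subspace subspace_0 by auto
  have "closed ((\<lambda>v. v + x) ` V)"
    using closed_translation[OF clV(1), of x] by (simp add: add.commute)
  then have Xc: "compact X" unfolding X_def using C by (rule compact_Int_closed[rotated])
  \<comment> \<open>Enlarging a set to a ball costs a factor of at most \<open>4 powr t\<close>,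
    paid with one half of a. The other half is the sum of the \<open>\<epsilon> i\<close>, reserved
    for sets of diameter 0.\<close>
  define e where "e = a / (2 * 4 powr t)"
  have e: "0 < e" using a by (simp add: e_def)
  have "hausdorff_pre t 1 X \<le> hausdorff_measure t X"
    unfolding hausdorff_measure_def by (rule SUP_upper) simp
  then have "hausdorff_pre t 1 X < ennreal e" using null e by (simp add: X_def)
  then obtain K :: "nat \<Rightarrow> 'a set" where K: "X \<subseteq> (\<Union>i. K i)" "\<And>i. bounded (K i)"
    "(\<Sum>i. ennreal (hcontent t (K i))) < ennreal e"
    unfolding hausdorff_pre_def INF_less_iff by auto
  define \<epsilon> where "\<epsilon> i = (a / 4) * (1 / 2) ^ i" for i :: nat
  have \<epsilon>: "0 < \<epsilon> i" for i using a by (simp add: \<epsilon>_def)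
  have hc0: "0 \<le> hcontent t (K i)" for i by (simp add: hcontent_def)
  have "\<exists>q r. q \<in> D \<and> r \<in> \<rat> \<and> 0 < r \<and> K i \<subseteq> ball q r \<and> (2 * r) powr t \<le> 4 powr t * hcontent t (K i) + \<epsilon> i" for i
  proof -
    define d where "d = diameter (K i)"
    have d0: "0 \<le> d" unfolding d_def using K(2) by (rule diameter_ge_0)
    \<comment> \<open>For d = 0 this makes \<open>(2 * \<rho>) powr t\<close> equal to
      \<open>\<epsilon> i\<close>. In both cases \<rho> exceeds d, which leaves room to move the
      centre into D and to make the radius rational.\<close>
    define \<rho> where "\<rho> = (if d = 0 then \<epsilon> i powr (1 / t) / 2 else 2 * d)"
    have \<rho>: "d < \<rho>" using d0 \<epsilon>[of i] by (auto simp: \<rho>_def)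
    have \<rho>t: "(2 * \<rho>) powr t \<le> 4 powr t * hcontent t (K i) + \<epsilon> i"
    proof (cases "d = 0")
      case True
      then have "(2 * \<rho>) powr t = \<epsilon> i" using t \<epsilon>[of i] by (simp add: \<rho>_def powr_powr)
      then show ?thesis using hc0[of i] by simp
    next
      case False
      then have "K i \<noteq> {}" by (auto simp: d_def)
      then have "hcontent t (K i) = d powr t" using False by (simp add: hcontent_def d_def)
      moreover have "(2 * \<rho>) powr t = 4 powr t * d powr t"
        using False d0 by (simp add: \<rho>_def flip: powr_mult)
      ultimately show ?thesis using \<epsilon>[of i] by simp
    qed
    obtain c where c: "K i \<noteq> {} \<Longrightarrow> c \<in> K i" by blast
    obtain q where q: "q \<in> D" "dist c q < (\<rho> - d) / 2"
      using D[of "ball c ((\<rho> - d) / 2)"] \<rho> by auto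
    obtain r where r: "r \<in> \<rat>" "(\<rho> + d) / 2 < r" "r < \<rho>"
      using Rats_dense_in_real[of "(\<rho> + d) / 2" \<rho>] \<rho> by auto
    have "0 < (\<rho> + d) / 2" using \<rho> d0 by simp
    then have r0: "0 < r" using r(2) by (rule less_trans)
    have "K i \<subseteq> ball q r"
    proof
      fix y assume y: "y \<in> K i"
      then have "dist c y \<le> d" unfolding d_def using c K(2) by (intro diameter_bounded_bound) auto
      then have "dist q y < r" using dist_triangle[of q y c] q r by (simp add: dist_commute field_simps)
      then show "y \<in> ball q r" by simp
    qed
    moreover have "(2 * r) powr t \<le> (2 * \<rho>) powr t" using r r0 t by (intro powr_mono2) auto
    ultimately show ?thesis using q r r0 \<rho>t by (meson order_trans)
  qed
  then obtain q r where qr: "\<And>i. q i \<in> D" "\<And>i. r i \<in> \<rat>" "\<And>i. 0 < r i" "\<And>i. K i \<subseteq> ball (q i) (r i)"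
    "\<And>i. (2 * r i) powr t \<le> 4 powr t * hcontent t (K i) + \<epsilon> i"
    by metis
  have "X \<subseteq> (\<Union>i\<in>UNIV. ball (q i) (r i))" using K(1) qr(4) by blast
  then obtain J where J: "finite J" "X \<subseteq> (\<Union>i\<in>J. ball (q i) (r i))"
    using compactE_image[OF Xc, of UNIV "\<lambda>i. ball (q i) (r i)"] by auto
  define F where "F = (\<lambda>i. (q i, r i)) ` J"
  have F: "finite F" "F \<subseteq> D \<times> (\<rat> \<inter> {0<..})" using J(1) qr by (auto simp: F_def)
  have XF: "X \<subseteq> ball_union F" using J(2) by (auto simp: F_def ball_union_def)
  have "(\<Sum>(c, r)\<in>F. (2 * r) powr t) \<le> (\<Sum>i\<in>J. (2 * r i) powr t)"
    unfolding F_def using sum_image_le[OF J(1), of "\<lambda>(c, r). (2 * r) powr t" "\<lambda>i. (q i, r i)"] by (simp add: o_def)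
  also have "\<dots> \<le> (\<Sum>i\<in>J. 4 powr t * hcontent t (K i) + \<epsilon> i)" by (intro sum_mono qr)
  also have "\<dots> = 4 powr t * (\<Sum>i\<in>J. hcontent t (K i)) + (\<Sum>i\<in>J. \<epsilon> i)"
    by (simp add: sum.distrib sum_distrib_left)
  also have "\<dots> < 4 powr t * e + a / 2"
  proof -
    have "ennreal (\<Sum>i\<in>J. hcontent t (K i)) = (\<Sum>i\<in>J. ennreal (hcontent t (K i)))"
      by (simp add: sum_ennreal hc0)
    also have "\<dots> \<le> (\<Sum>i. ennreal (hcontent t (K i)))" using J(1) by (intro sum_le_suminf) auto
    also have "\<dots> < ennreal e" by fact
    finally have 1: "(\<Sum>i\<in>J. hcontent t (K i)) < e"
      by (simp add: ennreal_less_iff sum_nonneg hc0)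
    have "(\<Sum>i\<in>J. \<epsilon> i) \<le> (\<Sum>i. \<epsilon> i)"
      using J(1) \<epsilon> unfolding \<epsilon>_def by (intro sum_le_suminf summable_mult summable_geometric) (auto simp: less_imp_le)
    also have "\<dots> = a / 2" unfolding \<epsilon>_def by (subst suminf_mult) (auto simp: suminf_geometric summable_geometric)
    finally have 2: "(\<Sum>i\<in>J. \<epsilon> i) \<le> a / 2" .
    have "4 powr t * (\<Sum>i\<in>J. hcontent t (K i)) < 4 powr t * e" using 1 by simp
    with 2 show ?thesis by linarith
  qed
  also have "\<dots> = a" by (simp add: e_def)
  finally have Fa: "(\<Sum>(c, r)\<in>F. (2 * r) powr t) < a" .
  have opn: "open (ball_union F)" by (auto simp: ball_union_def)
  have Z: "compact (C - ball_union F)" using C opn by (rule compact_diff)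
  have pos: "0 < infdist (z - x) V" if "z \<in> C - ball_union F" for z
  proof (rule ccontr)
    assume "\<not> 0 < infdist (z - x) V"
    then have "infdist (z - x) V = 0" using infdist_nonneg[of "z - x" V] by linarith
    then have "z - x \<in> V" using in_closed_iff_infdist_zero[OF clV] by simp
    then have "z \<in> X" using that by (auto simp: X_def intro!: image_eqI[of _ _ "z - x"])
    then show False using XF that by auto
  qed
  have "\<exists>\<eta>>0. \<forall>z\<in>C - ball_union F. \<eta> \<le> infdist (z - x) V"
  proof (cases "C - ball_union F = {}")
    case False
    have "continuous_on (C - ball_union F) (\<lambda>z. infdist (z - x) V)" by (intro continuous_intros)
    then obtain z where "z \<in> C - ball_union F" "\<And>y. y \<in> C - ball_union F \<Longrightarrow> infdist (z - x) V \<le> infdist (y - x) V"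
      using continuous_attains_inf[OF Z False] by metis
    then show ?thesis using pos by blast
  qed (auto intro: exI[of _ 1])
  then show ?thesis using F Fa unfolding thin_slices_def by blast
qed

context invariant_grassmannian
begin

text \<open>All quantifiers become countable: the families F are finite subsets of a countable set,
  the gap runs through the numbers \<open>1 / real (Suc k)\<close>, and by continuity the remainder
  of C is represented by a countable dense subset.\<close>

lemma thin_slices_measurable:
  assumes D: "countable D"
  shows "thin_slices D C t a \<inter> space (borel \<Otimes>\<^sub>M \<gamma>) \<in> sets (borel \<Otimes>\<^sub>M \<gamma>)"
proof -
  define \<F> :: "((real^'n) \<times> real) set set" where "\<F> = {F. finite F \<and> F \<subseteq> D \<times> (\<rat> \<inter> {0<..})}"
  have "countable (D \<times> (\<rat> \<inter> {0<..} :: real set))"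
    using D countable_rat by (intro countable_SIGMA countable_Int1) auto
  then have cF: "countable \<F>" unfolding \<F>_def by (intro countable_Collect_finite_subset)
  define G where "G = {F \<in> \<F>. (\<Sum>(c, r)\<in>F. (2 * r) powr t) < a}"
  have cG: "countable G" using cF by (rule countable_subset[rotated]) (auto simp: G_def)
  define S where "S F k = {x \<in> space (borel \<Otimes>\<^sub>M \<gamma>). \<forall>z\<in>C - ball_union F. 1 / real (Suc k) \<le> infdist (z - fst x) (snd x)}" for F k
  have "thin_slices D C t a \<inter> space (borel \<Otimes>\<^sub>M \<gamma>) = (\<Union>F\<in>G. \<Union>k. S F k)"
  proof (intro equalityI subsetI)
    fix x assume "x \<in> thin_slices D C t a \<inter> space (borel \<Otimes>\<^sub>M \<gamma>)"
    then obtain F \<eta> where F: "F \<in> G" and \<eta>: "0 < \<eta>" "\<And>z. z \<in> C - ball_union F \<Longrightarrow> \<eta> \<le> infdist (z - fst x) (snd x)"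
      and x: "x \<in> space (borel \<Otimes>\<^sub>M \<gamma>)"
      by (auto simp: thin_slices_def G_def \<F>_def)
    obtain k where "1 / real (Suc k) < \<eta>" using \<eta>(1) nat_approx_posE by metis
    then have "x \<in> S F k" using \<eta>(2) x by (auto simp: S_def intro: order_trans[OF less_imp_le])
    then show "x \<in> (\<Union>F\<in>G. \<Union>k. S F k)" using F by blast
  next
    fix x assume "x \<in> (\<Union>F\<in>G. \<Union>k. S F k)"
    then obtain F k where "F \<in> G" "x \<in> S F k" by auto
    then show "x \<in> thin_slices D C t a \<inter> space (borel \<Otimes>\<^sub>M \<gamma>)"
      by (auto simp: thin_slices_def S_def G_def \<F>_def case_prod_beta' intro!: exI[of _ F] exI[of _ "1 / real (Suc k)"])
  qed
  moreover have "S F k \<in> sets (borel \<Otimes>\<^sub>M \<gamma>)" for F k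
  proof -
    obtain T where T: "countable T" "T \<subseteq> C - ball_union F" "C - ball_union F \<subseteq> closure T"
      using separable[of "C - ball_union F"] by metis
    have "S F k = {x \<in> space (borel \<Otimes>\<^sub>M \<gamma>). \<forall>z\<in>T. 1 / real (Suc k) \<le> infdist (z - fst x) (snd x)}"
    proof (intro equalityI subsetI)
      fix x assume x: "x \<in> {x \<in> space (borel \<Otimes>\<^sub>M \<gamma>). \<forall>z\<in>T. 1 / real (Suc k) \<le> infdist (z - fst x) (snd x)}"
      have "closed {z. 1 / real (Suc k) \<le> infdist (z - fst x) (snd x)}"
        by (intro closed_Collect_le continuous_intros)
      then have "closure T \<subseteq> {z. 1 / real (Suc k) \<le> infdist (z - fst x) (snd x)}"
        using x by (intro closure_minimal) auto
      then show "x \<in> S F k" using x T(3) by (auto simp: S_def)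
    qed (use T(2) in \<open>auto simp: S_def\<close>)
    moreover have "{x \<in> space (borel \<Otimes>\<^sub>M \<gamma>). \<forall>z\<in>T. 1 / real (Suc k) \<le> infdist (z - fst x) (snd x)} \<in> sets (borel \<Otimes>\<^sub>M \<gamma>)"
      by (rule sets.sets_Collect_countable_All'[OF _ T(1)]) measurable
    ultimately show ?thesis by simp
  qed
  ultimately show ?thesis using cG by auto
qed

text \<open>The t-energy of \<open>\<mu>\<close> smeared onto the plane x, with the Riesz kernel
  truncated at the smearing scale. Its integral over the bundle is controlled by the (t + m)-energy
  of \<open>\<mu>\<close>, the averaged kernel supplying the exponent m.\<close>

definition slice_energy :: "(real^'n) measure \<Rightarrow> real \<Rightarrow> real \<Rightarrow> (real^'n) \<times> (real^'n) set \<Rightarrow> ennreal" where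
  "slice_energy \<mu> \<delta> t x = (\<integral>\<^sup>+p. ennreal ((max \<delta> (dist (fst p) (snd p))) powr - t) *
     ennreal (gauss_kernel m \<delta> (snd x) (fst x - fst p) * gauss_kernel m \<delta> (snd x) (fst x - snd p)) \<partial>(\<mu> \<Otimes>\<^sub>M \<mu>))"

text \<open>Cauchy-Schwarz over a disjointed cover: thin slices force the smeared density to be small
  compared with the energy of the smeared slice.\<close>

lemma smear_le_slice_energy:
  assumes s: "sets \<mu> = sets borel" and fin: "finite_measure \<mu>" and C: "emeasure \<mu> (- C) = 0" "C \<in> sets borel"
    and t: "0 \<le> t" and x: "x \<in> thin_slices D C t a" and V: "subspace (snd x)"
  obtains \<eta> \<delta>0 where "0 < \<eta>" "0 < \<delta>0" "\<And>\<delta>. 0 < \<delta> \<Longrightarrow> \<delta> < \<delta>0 \<Longrightarrow>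
    ennreal ((smear \<mu> \<delta> x)\<^sup>2) \<le> ennreal (2 * (measure \<mu> UNIV * (exp (- \<eta>\<^sup>2 / (2 * \<delta>\<^sup>2)) / \<delta> ^ m))\<^sup>2) + ennreal (2 * a) * slice_energy \<mu> \<delta> t x"
proof -
  interpret M: finite_measure \<mu> by fact
  have sp: "space \<mu> = UNIV" using sets_eq_imp_space_eq[OF s] by simp
  note [measurable_cong] = s
  obtain y V where xyV: "x = (y, V)" by (cases x)
  have V: "subspace V" using V xyV by simp
  obtain F \<eta> where F: "finite F" "F \<subseteq> D \<times> (\<rat> \<inter> {0<..})" "(\<Sum>(c, r)\<in>F. (2 * r) powr t) < a"
    and \<eta>: "0 < \<eta>" "\<And>z. z \<in> C - ball_union F \<Longrightarrow> \<eta> \<le> infdist (z - y) V"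
    using x by (auto simp: thin_slices_def xyV)
  obtain h where h: "bij_betw h {0..<card F} F" using ex_bij_betw_nat_finite[OF F(1)] by blast
  define n where "n = card F"
  define b where "b i = (if i < n then ball (fst (h i)) (snd (h i)) else {})" for i
  define A where "A = disjointed b"
  have hF: "h i \<in> F" if "i < n" for i using h that by (auto simp: bij_betw_def n_def)
  have Ab: "A i \<subseteq> b i" for i unfolding A_def by (rule disjointed_subset)
  have UA: "(\<Union>i<n. A i) = ball_union F"
  proof -
    have "(\<Union>i\<in>{0..<n}. A i) = (\<Union>i\<in>{0..<n}. b i)" unfolding A_def by (rule finite_UN_disjointed_eq)
    also have "\<dots> = (\<Union>i\<in>{0..<n}. case h i of (c, r) \<Rightarrow> ball c r)" by (auto simp: b_def case_prod_beta')
    also have "\<dots> = ball_union F" using h unfolding ball_union_def bij_betw_def n_def by (metis image_image)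
    finally show ?thesis by (simp add: atLeast0LessThan)
  qed
  have disj: "disjoint_family A" unfolding A_def by (rule disjoint_family_disjointed)
  have "range b \<subseteq> sets borel" by (auto simp: b_def)
  then have "range A \<subseteq> sets borel" unfolding A_def by (rule sets.range_disjointed_sets)
  then have Am: "A i \<in> sets borel" for i by auto
  have [measurable]: "A i \<in> sets \<mu>" for i using Am s by simp
  have [measurable]: "C \<in> sets \<mu>" using C s by simp
  define p where "p i = (2 * snd (h i)) powr t" for i
  have r0: "0 < snd (h i)" if "i < n" for i using hF[OF that] F(2) by auto
  have p0: "0 < p i" if "i < n" for i using r0[OF that] by (simp add: p_def)
  have psum: "(\<Sum>i<n. p i) < a"
  proof -
    have "(\<Sum>i<n. p i) = (\<Sum>(c, r)\<in>F. (2 * r) powr t)"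
      using sum.reindex_bij_betw[OF h, of "\<lambda>(c, r). (2 * r) powr t"]
      by (simp add: p_def n_def atLeast0LessThan case_prod_beta')
    then show ?thesis using F(3) by simp
  qed
  \<comment> \<open>Below every radius r of the cover, truncation at \<delta> stays below the
    diameter 2 r, so the truncated kernel is at least \<open>1 / p i\<close> for two points of the
    same piece.\<close>
  define \<delta>0 where "\<delta>0 = Min (insert 1 ((\<lambda>i. snd (h i)) ` {..<n}))"
  have \<delta>0: "0 < \<delta>0" "\<And>i. i < n \<Longrightarrow> \<delta>0 \<le> snd (h i)" using r0 by (auto simp: \<delta>0_def)
  show ?thesis
  proof (rule that[OF \<eta>(1) \<delta>0(1)])
    fix \<delta> :: real assume \<delta>: "0 < \<delta>" "\<delta> < \<delta>0"
    define w where "w z = ennreal (gauss_kernel m \<delta> V (y - z))" for z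
    have [measurable]: "w \<in> borel_measurable \<mu>"
      unfolding w_def using measurable_cong_sets[OF s refl] gauss_kernel_measurable_borel by measurable
    \<comment> \<open>Bounds the kernel at the points of C outside the balls, all at distance at
      least \<eta> from the plane.\<close>
    define o' where "o' = exp (- \<eta>\<^sup>2 / (2 * \<delta>\<^sup>2)) / \<delta> ^ m"
    have o0: "0 \<le> o'" using \<delta> by (simp add: o'_def)
    define M where "M i = (\<integral>\<^sup>+z. w z * indicator (A i) z \<partial>\<mu>)" for i
    have sm: "ennreal (smear \<mu> \<delta> x) = (\<integral>\<^sup>+z. w z \<partial>\<mu>)"
      using ennreal_smear[OF s fin \<delta>(1), of x] by (simp add: w_def xyV)
    have "M i \<le> ennreal (smear \<mu> \<delta> x)" for i
      unfolding M_def sm by (intro nn_integral_mono) (auto simp: indicator_def)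
    then have Mfin: "M i = ennreal (enn2real (M i))" for i
      by (metis ennreal_enn2real_if ennreal_neq_top top_unique)
    define M' where "M' i = enn2real (M i)" for i
    have M': "M i = ennreal (M' i)" "0 \<le> M' i" for i using Mfin by (auto simp: M'_def)
    have "AE z in \<mu>. z \<in> C"
      using C s by (intro AE_I[where N="- C"]) auto
    then have "(\<integral>\<^sup>+z. w z \<partial>\<mu>) \<le> (\<integral>\<^sup>+z. ennreal o' + (\<Sum>i<n. w z * indicator (A i) z) \<partial>\<mu>)"
    proof (intro nn_integral_mono_AE, eventually_elim)
      case (elim z)
      show ?case
      proof (cases "z \<in> ball_union F")
        case True
        then obtain i where i: "i < n" "z \<in> A i" using UA by auto
        have "w z = w z * indicator (A i) z" using i by simp
        also have "\<dots> \<le> (\<Sum>i<n. w z * indicator (A i) z)" using i by (intro member_le_sum) auto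
        finally show ?thesis by (rule order_trans) simp
      next
        case False
        then have "\<eta> \<le> infdist (z - y) V" using elim \<eta>(2) by blast
        moreover have "infdist (y - z) V = infdist (z - y) V"
          using infdist_subspace_uminus[OF V, of "z - y"] by simp
        ultimately have "\<eta>\<^sup>2 \<le> (infdist (y - z) V)\<^sup>2" using \<eta>(1) by (intro power_mono) auto
        then have "gauss_kernel m \<delta> V (y - z) \<le> o'"
          using \<delta> by (simp add: gauss_kernel_def o'_def divide_right_mono)
        then have "w z \<le> ennreal o'" by (simp add: w_def ennreal_leI)
        then show ?thesis by (rule order_trans) simp
      qed
    qed
    also have "\<dots> = ennreal o' * emeasure \<mu> UNIV + (\<Sum>i<n. M i)"
    proof -
      have "(\<integral>\<^sup>+z. ennreal o' + (\<Sum>i<n. w z * indicator (A i) z) \<partial>\<mu>) = (\<integral>\<^sup>+z. ennreal o' \<partial>\<mu>) + (\<integral>\<^sup>+z. (\<Sum>i<n. w z * indicator (A i) z) \<partial>\<mu>)"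
        by (rule nn_integral_add) measurable
      also have "(\<integral>\<^sup>+z. (\<Sum>i<n. w z * indicator (A i) z) \<partial>\<mu>) = (\<Sum>i<n. M i)"
        unfolding M_def by (rule nn_integral_sum) measurable
      finally show ?thesis by (simp add: sp)
    qed
    also have "\<dots> = ennreal (measure \<mu> UNIV * o' + (\<Sum>i<n. M' i))"
      using o0 M' by (simp add: M.emeasure_eq_measure sum_nonneg ennreal_mult mult.commute)
    finally have "smear \<mu> \<delta> x \<le> measure \<mu> UNIV * o' + (\<Sum>i<n. M' i)"
      unfolding sm[symmetric] using o0 M' by (subst (asm) ennreal_le_iff) (auto intro!: add_nonneg_nonneg sum_nonneg)
    then have "(smear \<mu> \<delta> x)\<^sup>2 \<le> (measure \<mu> UNIV * o' + (\<Sum>i<n. M' i))\<^sup>2"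
      using \<delta> by (intro power_mono smear_nonneg)
    also have "\<dots> \<le> 2 * (measure \<mu> UNIV * o')\<^sup>2 + 2 * (\<Sum>i<n. M' i)\<^sup>2"
      using sum_squares_bound[of "measure \<mu> UNIV * o'" "\<Sum>i<n. M' i"] by (simp add: power2_sum)
    also have "(\<Sum>i<n. M' i)\<^sup>2 \<le> a * (\<Sum>i<n. (M' i)\<^sup>2 / p i)"
    proof -
      \<comment> \<open>With the weights \<open>sqrt (p i)\<close> the first factor of
        Cauchy-Schwarz is the content of the cover, which is below a.\<close>
      have "(\<Sum>i<n. M' i) = (\<Sum>i<n. sqrt (p i) * (M' i / sqrt (p i)))"
        using p0 by (intro sum.cong) (auto simp: less_imp_neq[symmetric])
      also have "\<dots>\<^sup>2 \<le> (\<Sum>i<n. (sqrt (p i))\<^sup>2) * (\<Sum>i<n. (M' i / sqrt (p i))\<^sup>2)"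
        by (rule Cauchy_Schwarz_ineq_sum)
      also have "\<dots> = (\<Sum>i<n. p i) * (\<Sum>i<n. (M' i)\<^sup>2 / p i)"
        using p0 by (intro arg_cong2[of _ _ _ _ "(*)"] sum.cong) (auto simp: power_divide less_imp_le)
      also have "\<dots> \<le> a * (\<Sum>i<n. (M' i)\<^sup>2 / p i)"
        using psum p0 by (intro mult_right_mono sum_nonneg) (auto simp: less_imp_le)
      finally show ?thesis .
    qed
    finally have 1: "(smear \<mu> \<delta> x)\<^sup>2 \<le> 2 * (measure \<mu> UNIV * o')\<^sup>2 + 2 * a * (\<Sum>i<n. (M' i)\<^sup>2 / p i)" by simp
    \<comment> \<open>Each summand is at most the part of the energy with both points in
      \<open>A i\<close>; the pieces being disjoint, these parts add up to at most the
      whole.\<close>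
    have 2: "ennreal (\<Sum>i<n. (M' i)\<^sup>2 / p i) \<le> slice_energy \<mu> \<delta> t x"
    proof -
      have pi: "ennreal ((M' i)\<^sup>2 / p i) = (\<integral>\<^sup>+q. ennreal (1 / p i) * (w (fst q) * indicator (A i) (fst q) * (w (snd q) * indicator (A i) (snd q))) \<partial>(\<mu> \<Otimes>\<^sub>M \<mu>))"
        if "i < n" for i
      proof -
        have "(\<integral>\<^sup>+q. ennreal (1 / p i) * (w (fst q) * indicator (A i) (fst q) * (w (snd q) * indicator (A i) (snd q))) \<partial>(\<mu> \<Otimes>\<^sub>M \<mu>))
          = ennreal (1 / p i) * (\<integral>\<^sup>+q. w (fst q) * indicator (A i) (fst q) * (w (snd q) * indicator (A i) (snd q)) \<partial>(\<mu> \<Otimes>\<^sub>M \<mu>))"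
          by (rule nn_integral_cmult) measurable
        also have "(\<integral>\<^sup>+q. w (fst q) * indicator (A i) (fst q) * (w (snd q) * indicator (A i) (snd q)) \<partial>(\<mu> \<Otimes>\<^sub>M \<mu>))
          = (\<integral>\<^sup>+z. (\<integral>\<^sup>+z'. w z * indicator (A i) z * (w z' * indicator (A i) z') \<partial>\<mu>) \<partial>\<mu>)"
        proof -
          have "(\<lambda>q. w (fst q) * indicator (A i) (fst q) * (w (snd q) * indicator (A i) (snd q))) \<in> borel_measurable (\<mu> \<Otimes>\<^sub>M \<mu>)"
            by measurable
          from M.nn_integral_fst[OF this] show ?thesis by simp
        qed
        also have "\<dots> = (\<integral>\<^sup>+z. w z * indicator (A i) z * M i \<partial>\<mu>)"
          unfolding M_def by (intro nn_integral_cong nn_integral_cmult) measurable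
        also have "\<dots> = M i * M i"
          unfolding M_def by (rule nn_integral_multc) measurable
        finally show ?thesis using p0[OF that] M'[of i] by (simp add: power2_eq_square flip: ennreal_mult)
      qed
      have "ennreal (\<Sum>i<n. (M' i)\<^sup>2 / p i) = (\<Sum>i<n. ennreal ((M' i)\<^sup>2 / p i))"
        using p0 by (intro sum_ennreal[symmetric]) (auto simp: less_imp_le)
      also have "\<dots> = (\<Sum>i<n. (\<integral>\<^sup>+q. ennreal (1 / p i) * (w (fst q) * indicator (A i) (fst q) * (w (snd q) * indicator (A i) (snd q))) \<partial>(\<mu> \<Otimes>\<^sub>M \<mu>)))"
        using pi by (intro sum.cong) auto
      also have "\<dots> = (\<integral>\<^sup>+q. (\<Sum>i<n. ennreal (1 / p i) * (w (fst q) * indicator (A i) (fst q) * (w (snd q) * indicator (A i) (snd q)))) \<partial>(\<mu> \<Otimes>\<^sub>M \<mu>))"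
        by (rule nn_integral_sum[symmetric]) measurable
      also have "\<dots> \<le> slice_energy \<mu> \<delta> t x"
        unfolding slice_energy_def
      proof (rule nn_integral_mono)
        fix q :: "(real^'n) \<times> (real^'n)"
        let ?K = "ennreal ((max \<delta> (dist (fst q) (snd q))) powr - t)"
        have R: "ennreal (gauss_kernel m \<delta> (snd x) (fst x - fst q) * gauss_kernel m \<delta> (snd x) (fst x - snd q)) = w (fst q) * w (snd q)"
          using \<delta> by (simp add: w_def xyV ennreal_mult)
        show "(\<Sum>i<n. ennreal (1 / p i) * (w (fst q) * indicator (A i) (fst q) * (w (snd q) * indicator (A i) (snd q))))
          \<le> ?K * ennreal (gauss_kernel m \<delta> (snd x) (fst x - fst q) * gauss_kernel m \<delta> (snd x) (fst x - snd q))"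
        proof (cases "\<exists>i<n. fst q \<in> A i")
          case True
          then obtain i where i: "i < n" "fst q \<in> A i" by auto
          have other: "fst q \<notin> A k" if "k \<noteq> i" for k
            using disj i(2) that by (auto simp: disjoint_family_on_def)
          have "(\<Sum>k<n. ennreal (1 / p k) * (w (fst q) * indicator (A k) (fst q) * (w (snd q) * indicator (A k) (snd q))))
            = ennreal (1 / p i) * (w (fst q) * indicator (A i) (fst q) * (w (snd q) * indicator (A i) (snd q)))"
            using i other by (subst sum.remove[of _ i]) (auto intro!: sum.neutral)
          also have "\<dots> \<le> ?K * (w (fst q) * w (snd q))"
          proof (cases "snd q \<in> A i")
            case True
            then have "dist (fst (h i)) (fst q) < snd (h i)" "dist (fst (h i)) (snd q) < snd (h i)"
              using i Ab[of i] by (auto simp: b_def)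
            then have "dist (fst q) (snd q) < 2 * snd (h i)"
              using dist_triangle[of "fst q" "snd q" "fst (h i)"] by (simp add: dist_commute)
            then have "max \<delta> (dist (fst q) (snd q)) \<le> 2 * snd (h i)"
              using \<delta> \<delta>0(2)[OF i(1)] by auto
            then have "(2 * snd (h i)) powr - t \<le> (max \<delta> (dist (fst q) (snd q))) powr - t"
              using t \<delta> by (intro powr_mono2') auto
            then have "1 / p i \<le> (max \<delta> (dist (fst q) (snd q))) powr - t"
              by (simp add: p_def powr_minus_divide)
            then show ?thesis using i True by (simp add: mult_right_mono ennreal_leI)
          qed simp
          finally show ?thesis by (simp only: R)
        next
          case False
          then have "(\<Sum>i<n. ennreal (1 / p i) * (w (fst q) * indicator (A i) (fst q) * (w (snd q) * indicator (A i) (snd q)))) = 0"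
            by (intro sum.neutral) auto
          then show ?thesis by (rule ord_eq_le_trans) (rule zero_le)
        qed
      qed
      finally show ?thesis .
    qed
    have a0: "0 \<le> a" using psum p0 sum_nonneg[of "{..<n}" p] by (force simp: less_imp_le)
    have "ennreal ((smear \<mu> \<delta> x)\<^sup>2) \<le> ennreal (2 * (measure \<mu> UNIV * o')\<^sup>2 + 2 * a * (\<Sum>i<n. (M' i)\<^sup>2 / p i))"
      using 1 by (rule ennreal_leI)
    also have "\<dots> = ennreal (2 * (measure \<mu> UNIV * o')\<^sup>2) + ennreal (2 * a) * ennreal (\<Sum>i<n. (M' i)\<^sup>2 / p i)"
    proof -
      have n0: "0 \<le> (\<Sum>i<n. (M' i)\<^sup>2 / p i)" using p0 by (intro sum_nonneg) (auto simp: less_imp_le)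
      show ?thesis using a0 n0 by (subst ennreal_plus) (auto simp: ennreal_mult)
    qed
    also have "\<dots> \<le> ennreal (2 * (measure \<mu> UNIV * o')\<^sup>2) + ennreal (2 * a) * slice_energy \<mu> \<delta> t x"
      using 2 by (intro add_left_mono mult_left_mono) auto
    finally show "ennreal ((smear \<mu> \<delta> x)\<^sup>2) \<le> ennreal (2 * (measure \<mu> UNIV * (exp (- \<eta>\<^sup>2 / (2 * \<delta>\<^sup>2)) / \<delta> ^ m))\<^sup>2) + ennreal (2 * a) * slice_energy \<mu> \<delta> t x"
      by (simp add: o'_def)
  qed
qed

end

section \<open>Dyadic content and discrete Frostman measures\<close>

text \<open>Dyadic cubes in the abstract: \<open>p k x\<close> is the index of the cell of
  generation k containing x, and \<open>g k\<close> is the cost of such a cell. Points that share a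
  cell share all coarser ones, so cells are nested or disjoint.\<close>

locale nested_partitions =
  fixes p :: "nat \<Rightarrow> 'a \<Rightarrow> 'b" and g :: "nat \<Rightarrow> real"
  assumes nested_Suc: "p (Suc k) x = p (Suc k) y \<Longrightarrow> p k x = p k y"
    and g_pos: "0 < g k"
begin

lemma nested: "k \<le> l \<Longrightarrow> p l x = p l y \<Longrightarrow> p k x = p k y"
  by (induction l rule: dec_induct) (auto dest: nested_Suc)

definition cell :: "nat \<times> 'b \<Rightarrow> 'a set" where "cell q = {x. p (fst q) x = snd q}"

definition cells :: "(nat \<times> 'b) set \<Rightarrow> 'a set" where "cells Q = (\<Union>q\<in>Q. cell q)"

text \<open>A measure on the set of cells, so that additivity and continuity from below of the cost
  are those of a measure.\<close>

definition cost_measure :: "(nat \<times> 'b) measure" where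
  "cost_measure = density (count_space UNIV) (\<lambda>q. ennreal (g (fst q)))"

abbreviation cost :: "(nat \<times> 'b) set \<Rightarrow> ennreal" where "cost \<equiv> emeasure cost_measure"

lemma sets_cost [simp]: "Q \<in> sets cost_measure" and space_cost [simp]: "space cost_measure = UNIV"
  by (simp_all add: cost_measure_def)

definition content :: "'a set \<Rightarrow> ennreal" where
  "content E = (INF Q \<in> {Q. E \<subseteq> cells Q}. cost Q)"

lemma mem_cells: "x \<in> cells Q \<longleftrightarrow> (\<exists>k. (k, p k x) \<in> Q)"
  by (force simp: cells_def cell_def)

lemma content_le_cost: "E \<subseteq> cells Q \<Longrightarrow> content E \<le> cost Q"
  unfolding content_def by (rule INF_lower) simp

lemma content_mono: "E \<subseteq> E' \<Longrightarrow> content E \<le> content E'"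
  unfolding content_def by (rule INF_superset_mono) auto

lemma cost_mono: "Q \<subseteq> R \<Longrightarrow> cost Q \<le> cost R"
  by (rule emeasure_mono) auto

text \<open>Increasing sets lemma: as cells are nested or disjoint, near-optimal covers of the sets E J
  can be merged by keeping maximal cells only.\<close>

lemma content_incseq_le:
  fixes E :: "nat \<Rightarrow> 'a set"
  assumes inc: "incseq E" and le: "\<And>J. content (E J) \<le> c"
  shows "content (\<Union>J. E J) \<le> c"
proof (cases "c = \<top>")
  case False
  show ?thesis
  proof (rule ennreal_le_epsilon)
    fix e :: real assume e: "0 < e"
    define \<epsilon> where "\<epsilon> J = ennreal ((e / 2) * (1 / 2) ^ J)" for J :: nat
    have "\<exists>Q. E J \<subseteq> cells Q \<and> cost Q < content (E J) + \<epsilon> J" for J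
    proof -
      have "content (E J) < \<top>" using le[of J] False by (simp add: less_top le_less_trans)
      then have "content (E J) < content (E J) + \<epsilon> J"
        using e ennreal_add_left_cancel_less[of "content (E J)" 0 "\<epsilon> J"] by (simp add: \<epsilon>_def less_top[symmetric])
      then show ?thesis unfolding content_def[of "E J"] INF_less_iff by auto
    qed
    then obtain Q where Q: "\<And>J. E J \<subseteq> cells (Q J)" "\<And>J. cost (Q J) < content (E J) + \<epsilon> J" by metis
    have Qfin: "cost (Q J) \<noteq> \<top>" for J using Q(2)[of J] by (auto simp: less_top[symmetric])
    \<comment> \<open>Exchange argument: a part T of a near-optimal cover is near-optimal for the
      points of \<open>E J\<close> that it covers, since a much cheaper replacement R would improve
      \<open>Q J\<close> beyond \<open>\<epsilon> J\<close>.\<close>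
    have star: "cost T \<le> content (E J \<inter> cells T) + \<epsilon> J" if T: "T \<subseteq> Q J" for T J
    proof -
      have "cost T \<le> cost R + \<epsilon> J" if R: "E J \<inter> cells T \<subseteq> cells R" for R
      proof -
        have "E J \<subseteq> cells (Q J - T \<union> R)" using Q(1)[of J] R by (fastforce simp: mem_cells)
        then have "content (E J) \<le> cost (Q J - T \<union> R)" by (rule content_le_cost)
        also have "\<dots> \<le> cost (Q J - T) + cost R" by (rule emeasure_subadditive) auto
        finally have 1: "content (E J) \<le> cost (Q J - T) + cost R" .
        have "cost (Q J - T) + cost T = cost (Q J)"
          using T by (subst plus_emeasure) (auto simp: Un_absorb2)
        also have "\<dots> \<le> content (E J) + \<epsilon> J" using Q(2) by (rule less_imp_le)
        also have "\<dots> \<le> cost (Q J - T) + (cost R + \<epsilon> J)"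
          using add_right_mono[OF 1, of "\<epsilon> J"] by (simp add: add.assoc)
        finally have "cost (Q J - T) + cost T \<le> cost (Q J - T) + (cost R + \<epsilon> J)" .
        moreover have "cost (Q J - T) \<noteq> \<top>" using cost_mono[of "Q J - T" "Q J"] Qfin[of J] by (auto simp: top_unique)
        ultimately show ?thesis by (simp add: ennreal_add_left_cancel_le)
      qed
      then have "cost T - \<epsilon> J \<le> cost R" if "E J \<inter> cells T \<subseteq> cells R" for R
        using that by (simp add: ennreal_minus_le_iff add.commute \<epsilon>_def)
      then have "cost T - \<epsilon> J \<le> content (E J \<inter> cells T)"
        unfolding content_def by (intro INF_greatest) auto
      then show ?thesis by (simp add: ennreal_minus_le_iff add.commute \<epsilon>_def)
    qed
    define A where "A = (\<Union>J. Q J)"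
    \<comment> \<open>The cells of \<open>A\<close> that lie in no strictly coarser cell of
      \<open>A\<close>. They still cover, as every covered point has a coarsest cell in
      \<open>A\<close>.\<close>
    define M where "M = {(k, r) \<in> A. \<forall>k'<k. \<forall>x. p k x = r \<longrightarrow> (k', p k' x) \<notin> A}"
    define S where "S J = M \<inter> (\<Union>i\<le>J. Q i)" for J
    have SA: "S J \<subseteq> A" for J by (auto simp: S_def A_def)
    have incS: "incseq S" unfolding incseq_def S_def by fastforce
    have US: "(\<Union>J. S J) = M" by (auto simp: S_def M_def A_def)
    have cover: "(\<Union>J. E J) \<subseteq> cells M"
    proof
      fix x assume "x \<in> (\<Union>J. E J)"
      then have ex: "\<exists>k. (k, p k x) \<in> A" using Q(1) by (fastforce simp: A_def mem_cells)
      define k where "k = (LEAST k. (k, p k x) \<in> A)"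
      have k: "(k, p k x) \<in> A" unfolding k_def using ex by (rule LeastI_ex)
      have "(k', p k' y) \<notin> A" if "k' < k" "p k y = p k x" for k' y
      proof -
        have "p k' y = p k' x" using nested that by (metis less_imp_le)
        then show ?thesis using not_less_Least that(1) unfolding k_def by metis
      qed
      then have "(k, p k x) \<in> M" using k by (auto simp: M_def)
      then show "x \<in> cells M" by (auto simp: mem_cells)
    qed
    have claim: "cost (S J) \<le> content (E J \<inter> cells (S J)) + (\<Sum>i\<le>J. \<epsilon> i)" for J
    proof (induction J)
      case 0
      show ?case using star[of "S 0" 0] by (simp add: S_def)
    next
      case (Suc J)
      \<comment> \<open>Cells of the new cover inside cells selected before. They cover
        \<open>E J \<inter> cells (S J)\<close>, so \<open>cost D\<close> dominates the content in
        the induction hypothesis and D can be traded for \<open>S J\<close>; \<open>star\<close>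
        then applies to D together with the new cells N, both parts of
        \<open>Q (Suc J)\<close>.\<close>
      define D where "D = {(k, r) \<in> Q (Suc J). \<exists>k'\<le>k. \<exists>x. p k x = r \<and> (k', p k' x) \<in> S J}"
      define N where "N = S (Suc J) - S J"
      have NQ: "N \<subseteq> Q (Suc J)" by (auto simp: N_def S_def le_Suc_eq)
      have disj: "D \<inter> N = {}"
      proof (rule ccontr)
        assume "D \<inter> N \<noteq> {}"
        then obtain k r k' x where kr: "(k, r) \<in> N" "k' \<le> k" "p k x = r" "(k', p k' x) \<in> S J"
          by (auto simp: D_def)
        then have "(k, r) \<in> M" "(k', p k' x) \<in> A" using SA by (auto simp: N_def S_def)
        then have "k' = k" using kr by (auto simp: M_def le_less)
        then show False using kr by (auto simp: N_def)
      qed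
      have 1: "E J \<inter> cells (S J) \<subseteq> cells D"
      proof
        fix x assume x: "x \<in> E J \<inter> cells (S J)"
        then obtain k' where k': "(k', p k' x) \<in> S J" by (auto simp: mem_cells)
        have "x \<in> E (Suc J)" using x inc by (auto simp: incseq_Suc_iff)
        then obtain k where k: "(k, p k x) \<in> Q (Suc J)" using Q(1) by (fastforce simp: mem_cells)
        have "k' \<le> k"
        proof (rule ccontr)
          assume "\<not> k' \<le> k"
          then have "(k, p k x) \<notin> A" using k' by (auto simp: S_def M_def)
          then show False using k by (auto simp: A_def)
        qed
        then have "(k, p k x) \<in> D" using k k' by (auto simp: D_def)
        then show "x \<in> cells D" by (auto simp: mem_cells)
      qed
      have 2: "cells (D \<union> N) \<subseteq> cells (S (Suc J))"
      proof
        fix y assume "y \<in> cells (D \<union> N)"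
        then obtain k where "(k, p k y) \<in> D \<union> N" by (auto simp: mem_cells)
        then show "y \<in> cells (S (Suc J))"
        proof
          assume "(k, p k y) \<in> D"
          then obtain k' x where kx: "k' \<le> k" "p k x = p k y" "(k', p k' x) \<in> S J" by (auto simp: D_def)
          then have "p k' x = p k' y" using nested by blast
          moreover have "S J \<subseteq> S (Suc J)" using incS by (auto simp: incseq_Suc_iff)
          ultimately show ?thesis using kx by (auto simp: mem_cells)
        qed (auto simp: N_def mem_cells)
      qed
      have "cost (S (Suc J)) = cost (S J) + cost N"
      proof -
        have "S J \<union> N = S (Suc J)" using incS by (auto simp: N_def incseq_Suc_iff)
        then show ?thesis by (subst plus_emeasure) (auto simp: N_def)
      qed
      also have "\<dots> \<le> (content (E J \<inter> cells (S J)) + (\<Sum>i\<le>J. \<epsilon> i)) + cost N"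
        by (rule add_right_mono[OF Suc])
      also have "\<dots> \<le> (cost D + (\<Sum>i\<le>J. \<epsilon> i)) + cost N"
        by (intro add_right_mono content_le_cost 1)
      also have "\<dots> = cost (D \<union> N) + (\<Sum>i\<le>J. \<epsilon> i)"
        using disj by (subst plus_emeasure[symmetric]) (auto simp: ac_simps)
      also have "\<dots> \<le> (content (E (Suc J) \<inter> cells (D \<union> N)) + \<epsilon> (Suc J)) + (\<Sum>i\<le>J. \<epsilon> i)"
        using NQ by (intro add_right_mono star) (auto simp: D_def)
      also have "\<dots> \<le> (content (E (Suc J) \<inter> cells (S (Suc J))) + \<epsilon> (Suc J)) + (\<Sum>i\<le>J. \<epsilon> i)"
        using 2 by (intro add_right_mono content_mono) auto
      finally show ?case by (simp add: ac_simps)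
    qed
    have eps: "(\<Sum>i\<le>J. \<epsilon> i) \<le> ennreal e" for J
    proof -
      have "(\<Sum>i\<le>J. (e / 2) * (1 / 2) ^ i) \<le> (\<Sum>i. (e / 2) * (1 / 2) ^ i)"
        using e by (intro sum_le_suminf summable_mult summable_geometric) auto
      also have "\<dots> = e" by (subst suminf_mult) (auto simp: suminf_geometric summable_geometric)
      finally show ?thesis using e unfolding \<epsilon>_def by (subst sum_ennreal) (auto intro: ennreal_leI)
    qed
    have "content (\<Union>J. E J) \<le> cost (\<Union>J. S J)" unfolding US by (rule content_le_cost[OF cover])
    also have "\<dots> = (SUP J. cost (S J))" by (rule SUP_emeasure_incseq[symmetric]) (auto intro: incS)
    also have "\<dots> \<le> c + ennreal e"
    proof (rule SUP_least)
      fix J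
      have "cost (S J) \<le> content (E J \<inter> cells (S J)) + (\<Sum>i\<le>J. \<epsilon> i)" by (rule claim)
      also have "\<dots> \<le> content (E J) + ennreal e" by (intro add_mono content_mono eps) auto
      also have "\<dots> \<le> c + ennreal e" by (intro add_right_mono le)
      finally show "cost (S J) \<le> c + ennreal e" .
    qed
    finally show "content (\<Union>J. E J) \<le> c + ennreal e" .
  qed
qed simp

text \<open>Greedy construction: give each new point as much mass as the constraints allow, so that it
  ends up in a saturated cell.\<close>

lemma saturated_weights:
  assumes "finite X"
  obtains w where "\<And>x. 0 \<le> w x" "\<And>k q. k \<le> j \<Longrightarrow> (\<Sum>x\<in>{x\<in>X. p k x = q}. w x) \<le> g k"
    "\<And>x. x \<in> X \<Longrightarrow> \<exists>k\<le>j. (\<Sum>x'\<in>{x'\<in>X. p k x' = p k x}. w x') = g k"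
proof -
  have "\<exists>w. (\<forall>x. 0 \<le> w x) \<and> (\<forall>k q. k \<le> j \<longrightarrow> (\<Sum>x\<in>{x\<in>X. p k x = q}. w x) \<le> g k) \<and>
    (\<forall>x\<in>X. \<exists>k\<le>j. (\<Sum>x'\<in>{x'\<in>X. p k x' = p k x}. w x') = g k)"
    using assms
  proof (induction X)
    case empty
    show ?case using g_pos by (auto intro!: exI[of _ "\<lambda>_. 0"] less_imp_le)
  next
    case (insert a X)
    then obtain w where w: "\<And>x. 0 \<le> w x" "\<And>k q. k \<le> j \<Longrightarrow> (\<Sum>x\<in>{x\<in>X. p k x = q}. w x) \<le> g k"
      "\<And>x. x \<in> X \<Longrightarrow> \<exists>k\<le>j. (\<Sum>x'\<in>{x'\<in>X. p k x' = p k x}. w x') = g k"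
      by blast
    \<comment> \<open>Slack at level k in the cell of the new point. Giving the point the least
      slack violates no constraint, saturates its cell at level \<open>k0\<close>, and cannot undo
      an earlier saturation.\<close>
    define f where "f k = g k - (\<Sum>x\<in>{x\<in>X. p k x = p k a}. w x)" for k
    define v where "v = Min (f ` {..j})"
    have fv: "v \<le> f k" if "k \<le> j" for k using that by (auto simp: v_def)
    have "v \<in> f ` {..j}" unfolding v_def by (rule Min_in) auto
    then obtain k0 where k0: "k0 \<le> j" "v = f k0" by auto
    have v0: "0 \<le> v" using k0 w(2)[OF k0(1)] by (simp add: f_def)
    define w' where "w' x = (if x = a then v else w x)" for x
    have sum': "(\<Sum>x\<in>{x\<in>insert a X. p k x = q}. w' x) = (\<Sum>x\<in>{x\<in>X. p k x = q}. w x) + (if p k a = q then v else 0)" for k q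
    proof -
      have eq: "(\<Sum>x\<in>{x\<in>X. p k x = q}. w' x) = (\<Sum>x\<in>{x\<in>X. p k x = q}. w x)"
        using insert by (intro sum.cong) (auto simp: w'_def)
      have "{x\<in>insert a X. p k x = q} = (if p k a = q then insert a {x\<in>X. p k x = q} else {x\<in>X. p k x = q})" by auto
      then show ?thesis using insert eq by (simp add: w'_def)
    qed
    have adm: "(\<Sum>x\<in>{x\<in>insert a X. p k x = q}. w' x) \<le> g k" if "k \<le> j" for k q
      unfolding sum' using w(2)[OF that, of q] fv[OF that] by (auto simp: f_def)
    have sat: "\<exists>k\<le>j. (\<Sum>x'\<in>{x'\<in>insert a X. p k x' = p k x}. w' x') = g k" if "x \<in> insert a X" for x
    proof (cases "x = a")
      case True
      then show ?thesis using k0 unfolding sum' by (auto simp: f_def intro!: exI[of _ k0])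
    next
      case False
      then have "x \<in> X" using that by simp
      then obtain k where k: "k \<le> j" "(\<Sum>x'\<in>{x'\<in>X. p k x' = p k x}. w x') = g k" using w(3) by blast
      have "g k \<le> (\<Sum>x'\<in>{x'\<in>insert a X. p k x' = p k x}. w' x')" unfolding sum' using k v0 by simp
      then show ?thesis using adm[OF k(1), of "p k x"] k(1) by (auto intro: antisym)
    qed
    have "0 \<le> w' x" for x using w(1) v0 by (simp add: w'_def)
    then show ?case using adm sat by blast
  qed
  then show ?thesis using that by blast
qed

text \<open>One representative is taken from each cell of generation j. The coarsest saturated cells
  of the representatives cover E, so they cost at least the content; they are disjoint and
  saturated, so the cost is at most the mass of \<open>w\<close>.\<close>

lemma finite_frostman:
  assumes fin: "finite (p j ` E)"
  obtains X w where "finite X" "X \<subseteq> E" "\<And>x. 0 \<le> w x"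
    "\<And>k q. k \<le> j \<Longrightarrow> (\<Sum>x\<in>{x\<in>X. p k x = q}. w x) \<le> g k" "content E \<le> ennreal (\<Sum>x\<in>X. w x)"
proof -
  define h where "h q = (SOME x. x \<in> E \<and> p j x = q)" for q
  have h: "h (p j x) \<in> E \<and> p j (h (p j x)) = p j x" if "x \<in> E" for x
    unfolding h_def by (rule someI[of _ x]) (use that in auto)
  define X where "X = h ` (p j ` E)"
  have X: "finite X" "X \<subseteq> E" using fin h by (auto simp: X_def)
  obtain w where w: "\<And>x. 0 \<le> w x" "\<And>k q. k \<le> j \<Longrightarrow> (\<Sum>x\<in>{x\<in>X. p k x = q}. w x) \<le> g k"
    "\<And>x. x \<in> X \<Longrightarrow> \<exists>k\<le>j. (\<Sum>x'\<in>{x'\<in>X. p k x' = p k x}. w x') = g k"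
    using saturated_weights[OF X(1), of j] by blast
  define full where "full k x \<longleftrightarrow> k \<le> j \<and> (\<Sum>x'\<in>{x'\<in>X. p k x' = p k x}. w x') = g k" for k x
  define l where "l x = (LEAST k. full k x)" for x
  have l: "full (l x) x" if "x \<in> X" for x
    unfolding l_def by (rule LeastI_ex) (use w(3)[OF that] in \<open>auto simp: full_def\<close>)
  have lmin: "l x \<le> k" if "full k x" for k x unfolding l_def using that by (rule Least_le)
  define Q where "Q = (\<lambda>x. (l x, p (l x) x)) ` X"
  have Qf: "finite Q" using X by (simp add: Q_def)
  have "E \<subseteq> cells Q"
  proof
    fix y assume y: "y \<in> E"
    define x where "x = h (p j y)"
    have x: "x \<in> X" "p j x = p j y" using y h[OF y] by (auto simp: X_def x_def)
    have "l x \<le> j" using l[OF x(1)] by (simp add: full_def)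
    then have "p (l x) x = p (l x) y" using x(2) nested by blast
    then show "y \<in> cells Q" using x(1) by (auto simp: mem_cells Q_def intro!: exI[of _ "l x"] image_eqI[of _ _ x])
  qed
  then have "content E \<le> cost Q" by (rule content_le_cost)
  also have "\<dots> = (\<Sum>q\<in>Q. ennreal (g (fst q)))"
    unfolding cost_measure_def using Qf
    by (simp add: emeasure_density nn_integral_count_space_indicator[symmetric] nn_integral_count_space_finite)
  also have "\<dots> = ennreal (\<Sum>q\<in>Q. g (fst q))" using g_pos by (intro sum_ennreal) (auto intro: less_imp_le)
  also have "\<dots> \<le> ennreal (\<Sum>x\<in>X. w x)"
  proof (rule ennreal_leI)
    \<comment> \<open>If two selected cells shared a point, the finer one would lie in a saturated
      coarser cell, against the minimality of \<open>l\<close>.\<close>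
    have uniq: "q = q'" if q: "q \<in> Q" "q' \<in> Q" "p (fst q) z = snd q" "p (fst q') z = snd q'" for q q' z
    proof -
      have le: "fst q' \<le> fst q" if q: "q \<in> Q" "q' \<in> Q" "p (fst q) z = snd q" "p (fst q') z = snd q'" for q q'
      proof (rule ccontr)
        assume less: "\<not> fst q' \<le> fst q"
        obtain x y where x: "x \<in> X" "q = (l x, p (l x) x)" and y: "y \<in> X" "q' = (l y, p (l y) y)"
          using q by (auto simp: Q_def)
        have "p (l x) y = p (l x) z" using q x y less by (intro nested[of "l x" "l y"]) auto
        then have "p (l x) y = p (l x) x" using q x by simp
        then have "full (l x) y" using l[OF x(1)] by (simp add: full_def)
        then show False using lmin[of "l x" y] less x y by simp
      qed
      have "fst q = fst q'" using le[OF q] le[OF q(2,1,4,3)] by simp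
      then show ?thesis using q by (auto simp: prod_eq_iff)
    qed
    have "(\<Sum>q\<in>Q. g (fst q)) = (\<Sum>q\<in>Q. \<Sum>x\<in>{x\<in>X. p (fst q) x = snd q}. w x)"
    proof (rule sum.cong)
      fix q assume "q \<in> Q"
      then obtain x where x: "x \<in> X" "q = (l x, p (l x) x)" by (auto simp: Q_def)
      then show "g (fst q) = (\<Sum>x\<in>{x\<in>X. p (fst q) x = snd q}. w x)" using l[OF x(1)] by (simp add: full_def)
    qed simp
    also have "\<dots> = (\<Sum>q\<in>Q. \<Sum>x\<in>X. if p (fst q) x = snd q then w x else 0)"
      by (simp only: sum.inter_filter[OF X(1)])
    also have "\<dots> = (\<Sum>x\<in>X. \<Sum>q\<in>Q. if p (fst q) x = snd q then w x else 0)" by (rule sum.swap)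
    also have "\<dots> \<le> (\<Sum>x\<in>X. w x)"
    proof (rule sum_mono)
      fix x
      have "(\<Sum>q\<in>Q. if p (fst q) x = snd q then w x else 0) = w x * real (card {q\<in>Q. p (fst q) x = snd q})"
        using Qf by (simp add: sum.inter_filter[symmetric])
      also have "card {q\<in>Q. p (fst q) x = snd q} \<le> 1"
        using Qf uniq by (intro card_le_Suc0_iff_eq[THEN iffD2, simplified One_nat_def[symmetric]]) auto
      then have "w x * real (card {q\<in>Q. p (fst q) x = snd q}) \<le> w x * 1"
        using w(1) by (intro mult_left_mono) auto
      finally show "(\<Sum>q\<in>Q. if p (fst q) x = snd q then w x else 0) \<le> w x" by simp
    qed
    finally show "(\<Sum>q\<in>Q. g (fst q)) \<le> (\<Sum>x\<in>X. w x)" .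
  qed
  finally show ?thesis using that X w(1,2) by blast
qed

end

section \<open>Dyadic cubes\<close>

definition dyadic_index :: "nat \<Rightarrow> real^'n \<Rightarrow> int^'n" where
  "dyadic_index k x = (\<chi> i. \<lfloor>2 ^ k * x $ i\<rfloor>)"

lemma floor_half_eq:
  fixes x :: real
  shows "\<lfloor>x\<rfloor> = \<lfloor>2 * x\<rfloor> div 2"
  by (rule floor_unique) linarith+

lemma dyadic_nested_partitions: "nested_partitions (dyadic_index :: nat \<Rightarrow> real^'n \<Rightarrow> int^'n) (\<lambda>k. (1 / 2 ^ k) powr t)"
proof
  fix k and x y :: "real^'n"
  assume eq: "dyadic_index (Suc k) x = dyadic_index (Suc k) y"
  have half: "dyadic_index k z $ i = dyadic_index (Suc k) z $ i div 2" for z :: "real^'n" and i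
    using floor_half_eq[of "2 ^ k * z $ i"] by (simp add: dyadic_index_def mult.assoc)
  show "dyadic_index k x = dyadic_index k y"
    by (simp add: vec_eq_iff half eq)
qed simp

lemma finite_vec_entries:
  assumes "finite F" shows "finite {v :: 'a^'n. \<forall>i. v $ i \<in> F}"
proof -
  have "vec_nth ` {v :: 'a^'n. \<forall>i. v $ i \<in> F} \<subseteq> PiE UNIV (\<lambda>_. F)" by auto
  moreover have "finite (PiE (UNIV :: 'n set) (\<lambda>_. F))" using assms by (intro finite_PiE) auto
  ultimately have "finite (vec_nth ` {v :: 'a^'n. \<forall>i. v $ i \<in> F})" by (rule finite_subset)
  then show ?thesis by (rule finite_imageD) (auto simp: inj_on_def vec_eq_iff fun_eq_iff)
qed

lemma finite_dyadic_index:
  fixes E :: "(real^'n) set"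
  assumes "bounded E" shows "finite (dyadic_index k ` E)"
proof -
  obtain R where R: "\<And>x. x \<in> E \<Longrightarrow> norm x \<le> R" using assms by (auto simp: bounded_iff)
  define F where "F = {\<lfloor>- (2 ^ k * R)\<rfloor> .. \<lfloor>2 ^ k * R\<rfloor>}"
  have "dyadic_index k ` E \<subseteq> {v. \<forall>i. v $ i \<in> F}"
  proof clarsimp
    fix x i assume x: "x \<in> E"
    have "\<bar>x $ i\<bar> \<le> R" using R[OF x] component_le_norm_cart[of x i] by linarith
    then have "2 ^ k * x $ i \<le> 2 ^ k * R" "2 ^ k * (- R) \<le> 2 ^ k * x $ i" by (intro mult_left_mono; simp)+
    then show "dyadic_index k x $ i \<in> F" unfolding F_def dyadic_index_def by (auto intro!: floor_mono)
  qed
  moreover have "finite {v :: int^'n. \<forall>i. v $ i \<in> F}" by (rule finite_vec_entries) (simp add: F_def)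
  ultimately show ?thesis by (rule finite_subset)
qed

lemma diameter_dyadic_cell:
  fixes q :: "int^'n"
  shows "bounded {x. dyadic_index k x = q}" "diameter {x. dyadic_index k x = q} \<le> real CARD('n) / 2 ^ k"
proof -
  let ?C = "{x :: real^'n. dyadic_index k x = q}"
  have b: "norm (x - y) \<le> real CARD('n) / 2 ^ k" if "x \<in> ?C" "y \<in> ?C" for x y :: "real^'n"
  proof -
    have "\<bar>x $ i - y $ i\<bar> \<le> 1 / 2 ^ k" for i
    proof -
      have "dyadic_index k x $ i = dyadic_index k y $ i" using that by simp
      then have "\<lfloor>2 ^ k * x $ i\<rfloor> = \<lfloor>2 ^ k * y $ i\<rfloor>" by (simp add: dyadic_index_def)
      then have "\<bar>2 ^ k * x $ i - 2 ^ k * y $ i\<bar> \<le> 1" by linarith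
      then have "2 ^ k * \<bar>x $ i - y $ i\<bar> \<le> 1" by (simp add: abs_mult flip: right_diff_distrib)
      then show ?thesis by (simp add: field_simps)
    qed
    then have "(\<Sum>i\<in>UNIV. \<bar>(x - y) $ i\<bar>) \<le> real CARD('n) * (1 / 2 ^ k)"
      by (intro sum_bounded_above) auto
    then show ?thesis using norm_le_l1_cart[of "x - y"] by simp
  qed
  show "diameter ?C \<le> real CARD('n) / 2 ^ k"
    by (rule diameter_le) (auto intro: b)
  show "bounded ?C"
  proof (cases "?C = {}")
    case False
    then obtain z :: "real^'n" where z: "z \<in> ?C" by auto
    have "dist z y \<le> real CARD('n) / 2 ^ k" if "y \<in> ?C" for y using b[OF z that] by (simp add: dist_norm)
    then show ?thesis unfolding bounded_def by blast
  qed simp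
qed

text \<open>A net content: covers by half-open dyadic cubes of side at most 1 and of mixed
  generations, each costing its side to the power t.\<close>

definition dyadic_content :: "real \<Rightarrow> (real^'n) set \<Rightarrow> ennreal" where
  "dyadic_content t = nested_partitions.content dyadic_index (\<lambda>k. (1 / 2 ^ k) powr t)"

lemma dyadic_content_incseq_le:
  "incseq E \<Longrightarrow> (\<And>J. dyadic_content t (E J) \<le> c) \<Longrightarrow> dyadic_content t (\<Union>J. E J) \<le> c"
  unfolding dyadic_content_def
  by (rule nested_partitions.content_incseq_le[OF dyadic_nested_partitions])

lemma hcontent_le:
  assumes "0 < t" "bounded C" "diameter C \<le> d"
  shows "hcontent t C \<le> d powr t"
  using assms diameter_ge_0[OF assms(2)] by (auto simp: hcontent_def intro!: powr_mono2)

text \<open>The content sets no limit to the size of the cells, but a small total cost makes every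
  single cell small. Cheap covers are therefore admissible for each \<delta>.\<close>

lemma hausdorff_measure_zero_if_dyadic_content_zero:
  fixes B :: "(real^'n) set"
  assumes t: "0 < t" and zero: "dyadic_content t B = 0"
  shows "hausdorff_measure t B = 0"
proof -
  let ?g = "\<lambda>k. (1 / 2 ^ k) powr t"
  interpret dy: nested_partitions "dyadic_index :: nat \<Rightarrow> real^'n \<Rightarrow> int^'n" ?g
    by (rule dyadic_nested_partitions)
  define N where "N = real CARD('n)"
  have N: "1 \<le> N" by (simp add: N_def Suc_leI)
  have "hausdorff_pre t \<delta> B = 0" if \<delta>: "0 < \<delta>" for \<delta>
  proof -
    have "hausdorff_pre t \<delta> B \<le> 0 + ennreal e" if e: "0 < e" for e
    proof -
      \<comment> \<open>The first term absorbs the factor \<open>N powr t\<close> between side and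
        diameter, N being a crude bound for the diameter of a unit cube; the second forces the sides
        below \<open>\<delta> / N\<close>.\<close>
      define e' where "e' = min (e / N powr t) ((\<delta> / N) powr t)"
      have e': "0 < e'" using e \<delta> N by (simp add: e'_def)
      have "dy.content B < ennreal e'" using zero e' by (simp add: dyadic_content_def)
      then obtain Q where Q: "B \<subseteq> dy.cells Q" "dy.cost Q < ennreal e'"
        unfolding dy.content_def INF_less_iff by auto
      have small: "N / 2 ^ fst q \<le> \<delta>" if "q \<in> Q" for q
      proof -
        have "ennreal (?g (fst q)) = dy.cost {q}"
          by (simp add: dy.cost_measure_def emeasure_density)
        also have "\<dots> \<le> dy.cost Q" using that by (intro dy.cost_mono) auto
        also have "\<dots> < ennreal e'" by (rule Q(2))
        finally have "?g (fst q) < e'" using e' by (simp add: ennreal_less_iff)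
        then have "?g (fst q) < (\<delta> / N) powr t" by (simp add: e'_def)
        then have "1 / 2 ^ fst q < \<delta> / N"
          using t \<delta> N by (meson not_le powr_mono2 less_imp_le divide_nonneg_nonneg le_less_trans less_irrefl
              order_trans zero_le_one)
        then show ?thesis using N by (simp add: field_simps)
      qed
      define K where "K i = (if i \<in> to_nat ` Q then dy.cell (from_nat i) else {})" for i
      have cov: "B \<subseteq> (\<Union>i. K i)"
      proof
        fix x assume "x \<in> B"
        then obtain q where "q \<in> Q" "x \<in> dy.cell q" using Q(1) by (auto simp: dy.cells_def)
        then have "x \<in> K (to_nat q)" by (simp add: K_def)
        then show "x \<in> (\<Union>i. K i)" by blast
      qed
      have cellq: "bounded (dy.cell q)" "diameter (dy.cell q) \<le> N / 2 ^ fst q" for q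
        using diameter_dyadic_cell[of "fst q" "snd q"] by (auto simp: dy.cell_def N_def)
      have Kd: "bounded (K i) \<and> diameter (K i) \<le> \<delta>" for i
      proof (cases "i \<in> to_nat ` Q")
        case True
        then obtain q where "q \<in> Q" "i = to_nat q" by auto
        then have "K i = dy.cell q" by (simp add: K_def)
        then show ?thesis using cellq[of q] small[OF \<open>q \<in> Q\<close>] by simp
      qed (use \<delta> in \<open>simp add: K_def\<close>)
      have "hausdorff_pre t \<delta> B \<le> (\<Sum>i. ennreal (hcontent t (K i)))"
        unfolding hausdorff_pre_def using cov Kd by (intro INF_lower) auto
      also have "\<dots> = (\<integral>\<^sup>+i. ennreal (hcontent t (K i)) \<partial>count_space UNIV)"
        by (rule nn_integral_count_space_nat[symmetric])
      also have "\<dots> = (\<integral>\<^sup>+i. ennreal (hcontent t (K i)) \<partial>count_space (to_nat ` Q))"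
        by (rule nn_integral_count_space_eq) (auto simp: K_def hcontent_def)
      also have "\<dots> = (\<integral>\<^sup>+q. ennreal (hcontent t (K (to_nat q))) \<partial>count_space Q)"
        by (rule nn_integral_bij_count_space[symmetric]) (auto simp: bij_betw_def inj_on_def)
      also have "\<dots> \<le> (\<integral>\<^sup>+q. ennreal (N powr t) * ennreal (?g (fst q)) \<partial>count_space Q)"
      proof (rule nn_integral_mono)
        fix q assume q: "q \<in> space (count_space Q)"
        then have "hcontent t (K (to_nat q)) \<le> (N / 2 ^ fst q) powr t"
          using hcontent_le[OF t cellq] by (simp add: K_def)
        also have "\<dots> = N powr t * ?g (fst q)" using N by (simp add: powr_divide)
        finally show "ennreal (hcontent t (K (to_nat q))) \<le> ennreal (N powr t) * ennreal (?g (fst q))"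
          by (simp add: ennreal_leI flip: ennreal_mult)
      qed
      also have "\<dots> = ennreal (N powr t) * dy.cost Q"
        by (simp add: nn_integral_cmult dy.cost_measure_def emeasure_density nn_integral_count_space_indicator)
      also have "\<dots> \<le> ennreal (N powr t) * ennreal e'"
        by (rule mult_left_mono[OF less_imp_le[OF Q(2)]]) simp
      also have "\<dots> \<le> ennreal e"
      proof -
        have "N powr t * e' \<le> N powr t * (e / N powr t)" by (intro mult_left_mono) (auto simp: e'_def)
        also have "\<dots> = e" using N by simp
        finally show ?thesis using e' by (simp add: ennreal_leI flip: ennreal_mult)
      qed
      finally show ?thesis by simp
    qed
    then have "hausdorff_pre t \<delta> B \<le> 0" by (rule ennreal_le_epsilon)
    then show ?thesis by simp
  qed
  then show ?thesis by (simp add: hausdorff_measure_def)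
qed

text \<open>Pushed forward to \<open>borel\<close>, since the energies and smeared densities are
  formed with measures on the Borel sets.\<close>

definition point_masses :: "'a::euclidean_space set \<Rightarrow> ('a \<Rightarrow> real) \<Rightarrow> 'a measure" where
  "point_masses X w = distr (point_measure X (\<lambda>x. ennreal (w x))) borel (\<lambda>x. x)"

lemma
  assumes X: "finite X" and w: "\<And>x. 0 \<le> w x"
  shows sets_point_masses: "sets (point_masses X w) = sets borel"
    and emeasure_point_masses: "S \<in> sets borel \<Longrightarrow> emeasure (point_masses X w) S = ennreal (\<Sum>x\<in>X \<inter> S. w x)"
proof -
  show "sets (point_masses X w) = sets borel" by (simp add: point_masses_def)
  assume "S \<in> sets borel"
  then have "emeasure (point_masses X w) S = emeasure (point_measure X (\<lambda>x. ennreal (w x))) (X \<inter> S)"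
    unfolding point_masses_def by (subst emeasure_distr) (auto simp: measurable_def space_point_measure sets_point_measure Int_commute)
  also have "\<dots> = (\<Sum>x\<in>X \<inter> S. ennreal (w x))"
    using X by (intro emeasure_point_measure_finite) auto
  finally show "emeasure (point_masses X w) S = ennreal (\<Sum>x\<in>X \<inter> S. w x)" using w by simp
qed

text \<open>The constant N depends on the dimension alone: a ball of radius \<open>1 / 2 ^ k\<close>
  meets only cells whose index differs from that of its centre by -1, 0 or 1 in each coordinate. The
  total mass is at most 1 per unit cube, a cell of generation 0 having cost 1.\<close>

lemma dyadic_frostman:
  obtains N :: real where "0 \<le> N" "\<And>t j (E :: (real^'n) set). bounded E \<Longrightarrow> \<exists>\<nu>. sets \<nu> = sets borel \<and> finite_measure \<nu> \<and>
      (AE x in \<nu>. x \<in> E) \<and> dyadic_content t E \<le> emeasure \<nu> UNIV \<and> emeasure \<nu> UNIV \<le> ennreal (real (card (dyadic_index 0 ` E))) \<and>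
      (\<forall>x. \<forall>k\<le>j. emeasure \<nu> (cball x (1 / 2 ^ k)) \<le> ennreal (N * (1 / 2 ^ k) powr t))"
proof -
  define U where "U = {v :: int^'n. \<forall>i. v $ i \<in> {-1, 0, 1}}"
  have U: "finite U" unfolding U_def by (rule finite_vec_entries) simp
  have "\<exists>\<nu>. sets \<nu> = sets borel \<and> finite_measure \<nu> \<and>
      (AE x in \<nu>. x \<in> E) \<and> dyadic_content t E \<le> emeasure \<nu> UNIV \<and> emeasure \<nu> UNIV \<le> ennreal (real (card (dyadic_index 0 ` E))) \<and>
      (\<forall>x. \<forall>k\<le>j. emeasure \<nu> (cball x (1 / 2 ^ k)) \<le> ennreal (real (card U) * (1 / 2 ^ k) powr t))"
    if E: "bounded E" for t j and E :: "(real^'n) set"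
  proof -
    let ?g = "\<lambda>k. (1 / 2 ^ k) powr t"
    interpret dy: nested_partitions "dyadic_index :: nat \<Rightarrow> real^'n \<Rightarrow> int^'n" ?g
      by (rule dyadic_nested_partitions)
    obtain X w where X: "finite X" "X \<subseteq> E" and w: "\<And>x. 0 \<le> w x"
      and adm: "\<And>k q. k \<le> j \<Longrightarrow> (\<Sum>x\<in>{x\<in>X. dyadic_index k x = q}. w x) \<le> ?g k"
      and tot: "dy.content E \<le> ennreal (\<Sum>x\<in>X. w x)"
      using dy.finite_frostman[OF finite_dyadic_index[OF E], of j] by blast
    define \<nu> where "\<nu> = point_masses X w"
    note em = emeasure_point_masses[where w = w, OF X(1) w, folded \<nu>_def]
    have s: "sets \<nu> = sets borel" unfolding \<nu>_def by (rule sets_point_masses[where w = w, OF X(1) w])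
    have sp: "space \<nu> = UNIV" using sets_eq_imp_space_eq[OF s] by simp
    have emU: "emeasure \<nu> UNIV = ennreal (\<Sum>x\<in>X. w x)" using em[of UNIV] by simp
    have "finite_measure \<nu>" by (rule finite_measureI) (simp add: sp emU)
    moreover have "AE x in \<nu>. x \<in> E"
    proof (rule AE_I[where N="- X"])
      have "- X \<in> sets borel" using finite_imp_closed[OF X(1)] by (simp add: borel_closed)
      then show "emeasure \<nu> (- X) = 0" "- X \<in> sets \<nu>" by (auto simp: em s)
    qed (use X in auto)
    moreover have "dyadic_content t E \<le> emeasure \<nu> UNIV" using tot by (simp add: dyadic_content_def emU)
    moreover have "emeasure \<nu> UNIV \<le> ennreal (real (card (dyadic_index 0 ` E)))"
    proof -
      have "(\<Sum>x\<in>X. w x) = (\<Sum>q\<in>dyadic_index 0 ` X. \<Sum>x\<in>{x\<in>X. dyadic_index 0 x = q}. w x)"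
        by (rule sum.group[OF X(1) finite_imageI[OF X(1)], symmetric]) simp
      also have "\<dots> \<le> (\<Sum>q\<in>dyadic_index 0 ` X. 1)" using adm[of 0] by (intro sum_mono) auto
      also have "\<dots> \<le> real (card (dyadic_index 0 ` E))"
        using X(2) finite_dyadic_index[OF E, of 0] by (simp add: card_mono image_mono)
      finally show ?thesis by (simp add: emU ennreal_leI)
    qed
    moreover have "emeasure \<nu> (cball x (1 / 2 ^ k)) \<le> ennreal (real (card U) * ?g k)" if k: "k \<le> j" for x k
    proof -
      have "X \<inter> cball x (1 / 2 ^ k) \<subseteq> (\<Union>v\<in>U. {y\<in>X. dyadic_index k y = dyadic_index k x + v})"
      proof
        fix y assume y: "y \<in> X \<inter> cball x (1 / 2 ^ k)"
        have "(dyadic_index k y - dyadic_index k x) $ i \<in> {-1, 0, 1}" for i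
        proof -
          have "\<bar>x $ i - y $ i\<bar> \<le> 1 / 2 ^ k"
            using y component_le_norm_cart[of "x - y" i] by (simp add: dist_norm)
          then have "2 ^ k * \<bar>x $ i - y $ i\<bar> \<le> 1" by (simp add: field_simps)
          then have "\<bar>2 ^ k * x $ i - 2 ^ k * y $ i\<bar> \<le> 1" by (simp add: abs_mult flip: right_diff_distrib)
          then have "\<lfloor>2 ^ k * y $ i\<rfloor> - \<lfloor>2 ^ k * x $ i\<rfloor> \<le> 1" "-1 \<le> \<lfloor>2 ^ k * y $ i\<rfloor> - \<lfloor>2 ^ k * x $ i\<rfloor>" by linarith+
          then show ?thesis by (auto simp: dyadic_index_def)
        qed
        then have "dyadic_index k y - dyadic_index k x \<in> U" by (simp add: U_def)
        then show "y \<in> (\<Union>v\<in>U. {y\<in>X. dyadic_index k y = dyadic_index k x + v})" using y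
          by (intro UN_I[of "dyadic_index k y - dyadic_index k x"]) auto
      qed
      then have "(\<Sum>y\<in>X \<inter> cball x (1 / 2 ^ k). w y) \<le> (\<Sum>y\<in>(\<Union>v\<in>U. {y\<in>X. dyadic_index k y = dyadic_index k x + v}). w y)"
        using X U w by (intro sum_mono2) auto
      also have "\<dots> \<le> (\<Sum>v\<in>U. \<Sum>y\<in>{y\<in>X. dyadic_index k y = dyadic_index k x + v}. w y)"
        using X U by (intro eq_refl sum.UNION_disjoint) auto
      also have "\<dots> \<le> (\<Sum>v\<in>U. ?g k)" by (intro sum_mono adm k)
      finally show ?thesis by (simp add: em ennreal_leI)
    qed
    ultimately show ?thesis using s by blast
  qed
  then show ?thesis using that[of "real (card U)"] by auto
qed

section \<open>Hausdorff measures and Frostman measures on compact subsets\<close>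

lemma hcontent_nonneg: "0 \<le> hcontent s C"
  by (simp add: hcontent_def)

lemma hausdorff_pre_le_suminf:
  "A \<subseteq> (\<Union>i. C i) \<Longrightarrow> (\<And>i. bounded (C i) \<and> diameter (C i) \<le> \<delta>) \<Longrightarrow>
    hausdorff_pre s \<delta> A \<le> (\<Sum>i. ennreal (hcontent s (C i)))"
  unfolding hausdorff_pre_def by (rule INF_lower) auto

lemma hausdorff_pre_lessD:
  "hausdorff_pre s \<delta> A < c \<Longrightarrow> \<exists>C :: nat \<Rightarrow> 'a::metric_space set. A \<subseteq> (\<Union>i. C i) \<and>
    (\<forall>i. bounded (C i) \<and> diameter (C i) \<le> \<delta>) \<and> (\<Sum>i. ennreal (hcontent s (C i))) < c"
  unfolding hausdorff_pre_def INF_less_iff by blast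

lemma hausdorff_pre_mono: "A \<subseteq> B \<Longrightarrow> hausdorff_pre s \<delta> A \<le> hausdorff_pre s \<delta> B"
  unfolding hausdorff_pre_def by (rule INF_superset_mono) auto

lemma hausdorff_pre_antimono: "\<delta> \<le> \<epsilon> \<Longrightarrow> hausdorff_pre s \<epsilon> A \<le> hausdorff_pre s \<delta> A"
  unfolding hausdorff_pre_def by (rule INF_superset_mono) (auto intro: order_trans)

lemma hausdorff_pre_le_measure: "0 < \<delta> \<Longrightarrow> hausdorff_pre s \<delta> A \<le> hausdorff_measure s A"
  unfolding hausdorff_measure_def by (rule SUP_upper) simp

lemma hausdorff_measure_mono: "A \<subseteq> B \<Longrightarrow> hausdorff_measure s A \<le> hausdorff_measure s B"
  unfolding hausdorff_measure_def by (intro SUP_mono) (auto intro: hausdorff_pre_mono)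

lemma hausdorff_measure_SUP_nat:
  "hausdorff_measure s A = (SUP n. hausdorff_pre s (1 / real (Suc n)) A)"
proof (rule antisym)
  show "hausdorff_measure s A \<le> (SUP n. hausdorff_pre s (1 / real (Suc n)) A)"
    unfolding hausdorff_measure_def
  proof (rule SUP_least)
    fix \<delta> :: real assume "\<delta> \<in> {0<..}"
    then obtain n where "1 / real (Suc n) < \<delta>" using nat_approx_posE by auto
    then have "hausdorff_pre s \<delta> A \<le> hausdorff_pre s (1 / real (Suc n)) A" by (intro hausdorff_pre_antimono) simp
    then show "hausdorff_pre s \<delta> A \<le> (SUP n. hausdorff_pre s (1 / real (Suc n)) A)" by (rule SUP_upper2[rotated]) simp
  qed
qed (auto intro!: SUP_least hausdorff_pre_le_measure)

lemma incseq_hausdorff_pre: "incseq (\<lambda>n. hausdorff_pre s (1 / real (Suc n)) A)"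
  by (auto simp: incseq_def intro!: hausdorff_pre_antimono divide_left_mono)

lemma hausdorff_measure_empty [simp]: "hausdorff_measure s {} = 0"
proof -
  have "hausdorff_pre s \<delta> ({} :: 'a set) \<le> 0" if "0 < \<delta>" for \<delta>
    using hausdorff_pre_le_suminf[of "{}" "\<lambda>_. {} :: 'a set" \<delta> s] that by (simp add: hcontent_def)
  then show ?thesis by (simp add: hausdorff_measure_def)
qed

lemma hausdorff_pre_countably_subadditive:
  fixes A :: "nat \<Rightarrow> 'a::metric_space set"
  shows "hausdorff_pre s \<delta> (\<Union>i. A i) \<le> (\<Sum>i. hausdorff_pre s \<delta> (A i))"
proof (cases "\<exists>i. hausdorff_pre s \<delta> (A i) = \<top>")
  case True
  then obtain i where i: "hausdorff_pre s \<delta> (A i) = \<top>" by auto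
  have "hausdorff_pre s \<delta> (A i) \<le> (\<Sum>i. hausdorff_pre s \<delta> (A i))"
    using sum_le_suminf[of "\<lambda>i. hausdorff_pre s \<delta> (A i)" "{i}"] by simp
  then show ?thesis using i by (simp add: top_unique)
next
  case False
  show ?thesis
  proof (rule ennreal_le_epsilon)
    fix e :: real assume e: "0 < e"
    define \<epsilon> where "\<epsilon> i = ennreal ((e / 2) * (1 / 2) ^ i)" for i :: nat
    have "\<exists>C :: nat \<Rightarrow> 'a set. A i \<subseteq> (\<Union>k. C k) \<and> (\<forall>k. bounded (C k) \<and> diameter (C k) \<le> \<delta>) \<and>
        (\<Sum>k. ennreal (hcontent s (C k))) \<le> hausdorff_pre s \<delta> (A i) + \<epsilon> i" for i
    proof -
      have "hausdorff_pre s \<delta> (A i) < hausdorff_pre s \<delta> (A i) + \<epsilon> i"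
        using False e ennreal_add_left_cancel_less[of "hausdorff_pre s \<delta> (A i)" 0 "\<epsilon> i"] by (simp add: \<epsilon>_def)
      from hausdorff_pre_lessD[OF this] show ?thesis by (blast intro: less_imp_le)
    qed
    then obtain C :: "nat \<Rightarrow> nat \<Rightarrow> 'a set" where C: "\<And>i. A i \<subseteq> (\<Union>k. C i k)"
      "\<And>i k. bounded (C i k) \<and> diameter (C i k) \<le> \<delta>"
      "\<And>i. (\<Sum>k. ennreal (hcontent s (C i k))) \<le> hausdorff_pre s \<delta> (A i) + \<epsilon> i"
      by metis
    define D where "D p = C (fst p) (snd p)" for p
    have "hausdorff_pre s \<delta> (\<Union>i. A i) \<le> (\<Sum>n. ennreal (hcontent s (D (prod_decode n))))"
    proof (rule hausdorff_pre_le_suminf)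
      show "(\<Union>i. A i) \<subseteq> (\<Union>n. D (prod_decode n))"
      proof
        fix x assume "x \<in> (\<Union>i. A i)"
        then obtain i k where "x \<in> C i k" using C(1) by blast
        then have "x \<in> D (prod_decode (prod_encode (i, k)))" by (simp add: D_def)
        then show "x \<in> (\<Union>n. D (prod_decode n))" by blast
      qed
    qed (simp add: D_def C)
    also have "\<dots> = (\<Sum>i. \<Sum>k. ennreal (hcontent s (C i k)))"
      by (rule suminf_ennreal_2dimen[where f = "\<lambda>p. ennreal (hcontent s (D p))"]) (simp add: D_def)
    also have "\<dots> \<le> (\<Sum>i. hausdorff_pre s \<delta> (A i) + \<epsilon> i)" by (intro suminf_le C(3)) auto
    also have "\<dots> = (\<Sum>i. hausdorff_pre s \<delta> (A i)) + (\<Sum>i. \<epsilon> i)" by (rule suminf_add[symmetric]) auto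
    also have "(\<Sum>i. \<epsilon> i) = ennreal e"
    proof -
      have "(\<Sum>i. (e / 2) * (1 / 2) ^ i) = e"
        by (subst suminf_mult) (auto simp: suminf_geometric summable_geometric)
      then show ?thesis
        unfolding \<epsilon>_def using e by (subst suminf_ennreal2) (auto intro!: summable_mult summable_geometric)
    qed
    finally show "hausdorff_pre s \<delta> (\<Union>i. A i) \<le> (\<Sum>i. hausdorff_pre s \<delta> (A i)) + ennreal e" .
  qed
qed

lemma hausdorff_measure_countably_subadditive:
  fixes A :: "nat \<Rightarrow> 'a::metric_space set"
  shows "hausdorff_measure s (\<Union>i. A i) \<le> (\<Sum>i. hausdorff_measure s (A i))"
  unfolding hausdorff_measure_def[of s "\<Union>i. A i"]
proof (rule SUP_least)
  fix \<delta> :: real assume "\<delta> \<in> {0<..}"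
  then have "hausdorff_pre s \<delta> (\<Union>i. A i) \<le> (\<Sum>i. hausdorff_pre s \<delta> (A i))" "(\<Sum>i. hausdorff_pre s \<delta> (A i)) \<le> (\<Sum>i. hausdorff_measure s (A i))"
    by (auto intro!: hausdorff_pre_countably_subadditive suminf_le hausdorff_pre_le_measure)
  then show "hausdorff_pre s \<delta> (\<Union>i. A i) \<le> (\<Sum>i. hausdorff_measure s (A i))" by (rule order_trans)
qed

lemma hausdorff_measure_outer: "outer_measure_space UNIV (hausdorff_measure s)"
  by (auto simp: outer_measure_space_def positive_def increasing_def countably_subadditive_def
      intro: hausdorff_measure_mono hausdorff_measure_countably_subadditive)

lemma hausdorff_measure_subadditive:
  "hausdorff_measure s (A \<union> B) \<le> hausdorff_measure s A + hausdorff_measure s B"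
proof -
  define C where "C i = (if i = 0 then A else if i = Suc 0 then B else {})" for i :: nat
  have "A \<union> B = (\<Union>i. C i)" by (auto simp: C_def split: if_splits)
  also have "hausdorff_measure s \<dots> \<le> (\<Sum>i. hausdorff_measure s (C i))" by (rule hausdorff_measure_countably_subadditive)
  also have "\<dots> = (\<Sum>i<2. hausdorff_measure s (C i))" by (rule suminf_finite) (auto simp: C_def)
  also have "\<dots> = hausdorff_measure s A + hausdorff_measure s B" by (simp add: C_def numeral_2_eq_2)
  finally show ?thesis .
qed

lemma hausdorff_measure_null_UN:
  fixes A :: "nat \<Rightarrow> 'a::metric_space set"
  assumes "\<And>i. hausdorff_measure s (A i) = 0" shows "hausdorff_measure s (\<Union>i. A i) = 0"
  using hausdorff_measure_countably_subadditive[of s A] assms by simp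

text \<open>A covering set of diameter at most \<delta> cannot meet both A and B, so every cover of
  the union splits into a cover of each.\<close>

lemma hausdorff_pre_separated:
  assumes sep: "\<And>x y. x \<in> A \<Longrightarrow> y \<in> B \<Longrightarrow> \<delta> < dist x y"
  shows "hausdorff_pre s \<delta> A + hausdorff_pre s \<delta> B \<le> hausdorff_pre s \<delta> (A \<union> B)"
  unfolding hausdorff_pre_def[of s \<delta> "A \<union> B"]
proof (rule INF_greatest)
  fix C assume C: "C \<in> {C :: nat \<Rightarrow> 'a set. A \<union> B \<subseteq> (\<Union>i. C i) \<and> (\<forall>i. bounded (C i) \<and> diameter (C i) \<le> \<delta>)}"
  define P where "P i \<longleftrightarrow> C i \<inter> A \<noteq> {}" for i
  have PB: "C i \<inter> B = {}" if Pi: "P i" for i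
  proof (rule ccontr)
    assume "C i \<inter> B \<noteq> {}"
    then obtain x y where "x \<in> C i" "x \<in> A" "y \<in> C i" "y \<in> B" using Pi unfolding P_def by blast
    moreover from this have "dist x y \<le> diameter (C i)" using C by (intro diameter_bounded_bound) auto
    ultimately show False using sep[of x y] C by (auto simp: not_less) (meson leD order_trans)
  qed
  define D where "D i = (if P i then C i else {})" for i
  define E where "E i = (if P i then {} else C i)" for i
  have \<delta>: "0 \<le> \<delta>" using C diameter_ge_0[of "C 0"] by (auto intro: order_trans)
  have "hausdorff_pre s \<delta> A + hausdorff_pre s \<delta> B \<le> (\<Sum>i. ennreal (hcontent s (D i))) + (\<Sum>i. ennreal (hcontent s (E i)))"
  proof (intro add_mono hausdorff_pre_le_suminf)
    show "A \<subseteq> (\<Union>i. D i)" using C by (fastforce simp: D_def P_def)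
    show "B \<subseteq> (\<Union>i. E i)"
    proof
      fix y assume y: "y \<in> B"
      then obtain i where "y \<in> C i" using C by auto
      then have "y \<in> E i" using PB[of i] y by (auto simp: E_def)
      then show "y \<in> (\<Union>i. E i)" by blast
    qed
  qed (use C \<delta> in \<open>auto simp: D_def E_def\<close>)
  also have "\<dots> = (\<Sum>i. ennreal (hcontent s (D i)) + ennreal (hcontent s (E i)))" by (rule suminf_add) auto
  also have "\<dots> = (\<Sum>i. ennreal (hcontent s (C i)))"
    by (intro arg_cong[where f = suminf] ext) (simp add: D_def E_def hcontent_def)
  finally show "hausdorff_pre s \<delta> A + hausdorff_pre s \<delta> B \<le> (\<Sum>i. ennreal (hcontent s (C i)))" .
qed

lemma hausdorff_measure_separated:
  assumes "0 < \<rho>" and sep: "\<And>x y. x \<in> A \<Longrightarrow> y \<in> B \<Longrightarrow> \<rho> \<le> dist x y"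
  shows "hausdorff_measure s A + hausdorff_measure s B \<le> hausdorff_measure s (A \<union> B)"
proof -
  have "hausdorff_measure s A + hausdorff_measure s B
    = (SUP n. hausdorff_pre s (1 / real (Suc n)) A + hausdorff_pre s (1 / real (Suc n)) B)"
    unfolding hausdorff_measure_SUP_nat by (rule ennreal_SUP_add[symmetric]) (rule incseq_hausdorff_pre)+
  also have "\<dots> \<le> hausdorff_measure s (A \<union> B)"
  proof (rule SUP_least)
    fix n
    define \<delta> where "\<delta> = min (1 / real (Suc n)) (\<rho> / 2)"
    have \<delta>: "0 < \<delta>" "\<delta> < \<rho>" "\<delta> \<le> 1 / real (Suc n)" using assms(1) by (auto simp: \<delta>_def)
    have "hausdorff_pre s (1 / real (Suc n)) A + hausdorff_pre s (1 / real (Suc n)) B \<le> hausdorff_pre s \<delta> A + hausdorff_pre s \<delta> B"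
      using \<delta> by (intro add_mono hausdorff_pre_antimono)
    also have "\<dots> \<le> hausdorff_pre s \<delta> (A \<union> B)"
      using sep \<delta> by (intro hausdorff_pre_separated) (auto intro: less_le_trans)
    also have "\<dots> \<le> hausdorff_measure s (A \<union> B)" using \<delta> by (intro hausdorff_pre_le_measure)
    finally show "hausdorff_pre s (1 / real (Suc n)) A + hausdorff_pre s (1 / real (Suc n)) B \<le> hausdorff_measure s (A \<union> B)" .
  qed
  finally show ?thesis .
qed

text \<open>Caratheodory's criterion: successive shells around the closed set F at distance between
  1/(k+2) and 1/(k+1) are separated from the region beyond them, so their measures are summable.\<close>

lemma closed_hausdorff_measurable:
  fixes F :: "'a::metric_space set"
  assumes F: "closed F"
  shows "hausdorff_measurable s F"
  unfolding hausdorff_measurable_def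
proof (intro allI antisym)
  fix E
  show "hausdorff_measure s E \<le> hausdorff_measure s (E \<inter> F) + hausdorff_measure s (E - F)"
    using hausdorff_measure_subadditive[of s "E \<inter> F" "E - F"] by (simp add: Int_Diff_Un)
  show "hausdorff_measure s (E \<inter> F) + hausdorff_measure s (E - F) \<le> hausdorff_measure s E"
  proof (cases "F = {} \<or> hausdorff_measure s E = \<top>")
    case True
    then show ?thesis by auto
  next
    case False
    then have ne: "F \<noteq> {}" and fin: "hausdorff_measure s E \<noteq> \<top>" by auto
    define R where "R k = {x \<in> E - F. 1 / real (Suc k) \<le> infdist x F}" for k
    define D where "D k = R (Suc k) - R k" for k
    have incR: "incseq R"
    proof (rule incseq_SucI)
      fix k
      have "1 / real (Suc (Suc k)) \<le> 1 / real (Suc k)" by (intro divide_left_mono) auto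
      then show "R k \<le> R (Suc k)" by (auto simp: R_def)
    qed
    have lip: "infdist y F \<le> infdist x F + dist x y" for x y
      using infdist_triangle[of y F x] by (simp add: dist_commute)
    define a where "a k = hausdorff_measure s (R k)" for k
    define d where "d k = hausdorff_measure s (D k)" for k
    have aE: "a k \<le> hausdorff_measure s E" for k unfolding a_def by (rule hausdorff_measure_mono) (auto simp: R_def)
    \<comment> \<open>Between the shell \<open>D (Suc k)\<close> and the region \<open>R k\<close>
      lies the shell \<open>D k\<close>, which leaves a gap of
      \<open>1 / real (Suc k) - 1 / real (Suc (Suc k))\<close>.\<close>
    have step: "d (Suc k) + a k \<le> a (Suc (Suc k))" for k
    proof -
      have "d (Suc k) + a k \<le> hausdorff_measure s (D (Suc k) \<union> R k)"
        unfolding d_def a_def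
      proof (rule hausdorff_measure_separated)
        have "1 / real (Suc (Suc k)) < 1 / real (Suc k)" by (intro divide_strict_left_mono) auto
        then show "0 < 1 / real (Suc k) - 1 / real (Suc (Suc k))" by simp
        fix x y assume x: "x \<in> D (Suc k)" and y: "y \<in> R k"
        then have "infdist x F < 1 / real (Suc (Suc k))" "1 / real (Suc k) \<le> infdist y F" by (auto simp: D_def R_def)
        then show "1 / real (Suc k) - 1 / real (Suc (Suc k)) \<le> dist x y" using lip[of y x] by linarith
      qed
      also have "\<dots> \<le> a (Suc (Suc k))"
        unfolding a_def using incR by (intro hausdorff_measure_mono) (auto simp: D_def incseq_def)
      finally show ?thesis .
    qed
    \<comment> \<open>As \<open>step\<close> advances by two indices, even and odd shells telescope
      separately; hence two terms on the right.\<close>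
    have sums: "(\<Sum>i<k. d (Suc i)) \<le> a k + a (Suc k)" for k
    proof (induction k)
      case (Suc k)
      have "(\<Sum>i<Suc k. d (Suc i)) \<le> (a k + a (Suc k)) + d (Suc k)" using Suc by (simp add: add_right_mono)
      also have "\<dots> = a (Suc k) + (d (Suc k) + a k)" by (simp add: ac_simps)
      also have "\<dots> \<le> a (Suc k) + a (Suc (Suc k))" by (intro add_left_mono step)
      finally show ?case .
    qed simp
    define H where "H = hausdorff_measure s E"
    have "(\<Sum>i. d (Suc i)) \<le> H + H"
    proof (rule suminf_le_const)
      fix k show "(\<Sum>i<k. d (Suc i)) \<le> H + H"
        using sums[of k] add_mono[OF aE[of k] aE[of "Suc k"]] by (auto simp: H_def intro: order_trans)
    qed simp
    then have dfin: "(\<Sum>i. d (Suc i)) \<noteq> \<top>" using fin by (auto simp: H_def top_unique)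
    define d' where "d' i = enn2real (d (Suc i))" for i
    have dk: "d (Suc i) = ennreal (d' i)" "0 \<le> d' i" for i
    proof -
      have "d (Suc i) \<le> (\<Sum>i. d (Suc i))" using sum_le_suminf[of "\<lambda>i. d (Suc i)" "{i}"] by simp
      then have "d (Suc i) \<noteq> \<top>" using dfin by (auto simp: top_unique)
      then show "d (Suc i) = ennreal (d' i)" "0 \<le> d' i" by (auto simp: d'_def less_top)
    qed
    have summ: "summable d'" using dfin dk by (intro summable_suminf_not_top) auto
    have bound: "hausdorff_measure s (E \<inter> F) + hausdorff_measure s (E - F) \<le> H + ennreal e" if e: "0 < e" for e
    proof -
      obtain N where N: "norm (\<Sum>i. d' (i + N)) < e" using suminf_exist_split[OF e summ] by blast
      have "E - F \<subseteq> R (Suc N) \<union> (\<Union>i. D (Suc (i + N)))"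
      proof
        fix x assume x: "x \<in> E - F"
        then have "infdist x F \<noteq> 0" using in_closed_iff_infdist_zero[OF F ne] by auto
        then have "0 < infdist x F" using infdist_nonneg[of x F] by linarith
        then obtain n where "1 / real (Suc n) < infdist x F" using nat_approx_posE by auto
        then have ex: "\<exists>n. x \<in> R n" using x by (auto simp: R_def intro: less_imp_le)
        define n where "n = (LEAST n. x \<in> R n)"
        have n: "x \<in> R n" unfolding n_def using ex by (rule LeastI_ex)
        show "x \<in> R (Suc N) \<union> (\<Union>i. D (Suc (i + N)))"
        proof (cases "n \<le> Suc N")
          case True
          then show ?thesis using n incR by (auto simp: incseq_def)
        next
          case False
          then obtain i where i: "n = Suc (Suc (i + N))" using less_imp_Suc_add[of "Suc N" n] by (auto simp: add.commute)
          have "x \<notin> R (Suc (i + N))" using not_less_Least[of "Suc (i + N)" "\<lambda>n. x \<in> R n"] i by (simp add: n_def)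
          then have "x \<in> D (Suc (i + N))" using n i by (simp add: D_def)
          then show ?thesis by blast
        qed
      qed
      then have "hausdorff_measure s (E - F) \<le> hausdorff_measure s (R (Suc N) \<union> (\<Union>i. D (Suc (i + N))))" by (rule hausdorff_measure_mono)
      also have "\<dots> \<le> a (Suc N) + (\<Sum>i. d (Suc (i + N)))"
        unfolding a_def d_def by (rule order_trans[OF hausdorff_measure_subadditive add_left_mono[OF hausdorff_measure_countably_subadditive]])
      also have "(\<Sum>i. d (Suc (i + N))) \<le> ennreal e"
      proof -
        have "(\<Sum>i. d (Suc (i + N))) = ennreal (\<Sum>i. d' (i + N))"
          unfolding dk using summ dk by (intro suminf_ennreal2) (auto simp: summable_iff_shift)
        then show ?thesis using N by (simp add: ennreal_leI)
      qed
      finally have 1: "hausdorff_measure s (E - F) \<le> a (Suc N) + ennreal e" by (simp add: add_left_mono)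
      have "hausdorff_measure s (E \<inter> F) + a (Suc N) \<le> hausdorff_measure s (E \<inter> F \<union> R (Suc N))"
        unfolding a_def
      proof (rule hausdorff_measure_separated)
        show "0 < 1 / real (Suc (Suc N))" by simp
        fix x y assume "x \<in> E \<inter> F" "y \<in> R (Suc N)"
        then show "1 / real (Suc (Suc N)) \<le> dist x y" using infdist_le[of x F y] by (auto simp: R_def dist_commute)
      qed
      also have "\<dots> \<le> H" unfolding H_def by (rule hausdorff_measure_mono) (auto simp: R_def)
      finally have 2: "hausdorff_measure s (E \<inter> F) + a (Suc N) \<le> H" .
      have "hausdorff_measure s (E \<inter> F) + hausdorff_measure s (E - F) \<le> hausdorff_measure s (E \<inter> F) + (a (Suc N) + ennreal e)"
        by (rule add_left_mono[OF 1])
      also have "\<dots> \<le> H + ennreal e" using add_right_mono[OF 2, of "ennreal e"] by (simp add: add.assoc)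
      finally show ?thesis .
    qed
    show ?thesis unfolding H_def[symmetric] by (rule ennreal_le_epsilon) (rule bound)
  qed
qed

section \<open>Hausdorff measure on Borel sets\<close>

definition hausdorff_borel :: "real \<Rightarrow> 'a::metric_space measure" where
  "hausdorff_borel s = measure_of UNIV (sets borel) (hausdorff_measure s)"

lemma sets_hausdorff_borel [simp, measurable_cong]: "sets (hausdorff_borel s) = sets borel"
  by (simp add: hausdorff_borel_def sets.sigma_sets_eq[of borel, simplified])

text \<open>The Caratheodory measurable sets form a sigma-algebra on which the outer measure is
  countably additive; it contains the closed sets and with them all Borel sets.\<close>

lemma emeasure_hausdorff_borel:
  assumes "S \<in> sets borel"
  shows "emeasure (hausdorff_borel s) S = hausdorff_measure s S"
proof -
  let ?L = "lambda_system UNIV UNIV (hausdorff_measure s :: 'a set \<Rightarrow> ennreal)"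
  have P: "sigma_algebra (UNIV :: 'a set) UNIV" using sigma_algebra_Pow[of "UNIV :: 'a set"] by simp
  have ms: "measure_space UNIV ?L (hausdorff_measure s)"
    by (rule sigma_algebra.caratheodory_lemma[OF P hausdorff_measure_outer])
  then have sa: "sigma_algebra UNIV ?L" and ca: "countably_additive ?L (hausdorff_measure s)"
    by (auto simp: measure_space_def)
  have Leq: "F \<in> ?L \<longleftrightarrow> hausdorff_measurable s F" for F :: "'a set"
  proof -
    have e: "(UNIV - F) \<inter> E = E - F" for E by auto
    have "F \<in> ?L \<longleftrightarrow> (\<forall>E. hausdorff_measure s (E \<inter> F) + hausdorff_measure s (E - F) = hausdorff_measure s E)"
      unfolding lambda_system_def by (simp only: e Int_commute[of F] mem_Collect_eq UNIV_I simp_thms ball_UNIV)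
    then show ?thesis unfolding hausdorff_measurable_def by metis
  qed
  have "sets (borel :: 'a measure) = sigma_sets UNIV {F. closed F}"
    by (simp add: borel_eq_closed)
  also have "\<dots> \<subseteq> ?L"
    by (rule sigma_algebra.sigma_sets_subset[OF sa]) (auto simp: Leq intro: closed_hausdorff_measurable)
  finally have sub: "sets (borel :: 'a measure) \<subseteq> ?L" .
  show ?thesis
    unfolding hausdorff_borel_def
  proof (rule emeasure_measure_of_sigma)
    show "sigma_algebra UNIV (sets (borel :: 'a measure))" using sets.sigma_algebra_axioms[of "borel :: 'a measure"] by simp
    show "positive (sets borel) (hausdorff_measure s :: 'a set \<Rightarrow> ennreal)" by (simp add: positive_def)
    show "countably_additive (sets borel) (hausdorff_measure s :: 'a set \<Rightarrow> ennreal)"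
      unfolding countably_additive_def
    proof (intro allI impI)
      fix A :: "nat \<Rightarrow> 'a set"
      assume A: "range A \<subseteq> sets borel" "disjoint_family A" "\<Union> (range A) \<in> sets borel"
      then have "range A \<subseteq> ?L" "\<Union> (range A) \<in> ?L" using sub by auto
      then show "(\<Sum>i. hausdorff_measure s (A i)) = hausdorff_measure s (\<Union> (range A))"
        using ca A(2) unfolding countably_additive_def by blast
    qed
  qed fact
qed

text \<open>Passing to closures preserves diameters. Intersecting the unions of closures over finer
  and finer near-optimal covers yields a Borel set of the same measure.\<close>

lemma borel_hull:
  fixes A :: "'a::metric_space set"
  assumes fin: "hausdorff_measure s A < \<infinity>"
  obtains G where "G \<in> sets borel" "A \<subseteq> G" "hausdorff_measure s G = hausdorff_measure s A"
proof -
  have "\<exists>C :: nat \<Rightarrow> 'a set. A \<subseteq> (\<Union>i. C i) \<and> (\<forall>i. bounded (C i) \<and> diameter (C i) \<le> 1 / real (Suc n)) \<and>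
      (\<Sum>i. ennreal (hcontent s (C i))) < hausdorff_measure s A + ennreal (1 / real (Suc n))" for n
  proof -
    have "hausdorff_pre s (1 / real (Suc n)) A \<le> hausdorff_measure s A" by (intro hausdorff_pre_le_measure) simp
    also have "\<dots> < hausdorff_measure s A + ennreal (1 / real (Suc n))"
      using fin ennreal_add_left_cancel_less[of "hausdorff_measure s A" 0 "ennreal (1 / real (Suc n))"] by simp
    finally have "hausdorff_pre s (1 / real (Suc n)) A < hausdorff_measure s A + ennreal (1 / real (Suc n))" .
    then show ?thesis by (rule hausdorff_pre_lessD)
  qed
  then have "\<exists>C :: nat \<Rightarrow> nat \<Rightarrow> 'a set. \<forall>n. A \<subseteq> (\<Union>i. C n i) \<and> (\<forall>i. bounded (C n i) \<and> diameter (C n i) \<le> 1 / real (Suc n)) \<and>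
      (\<Sum>i. ennreal (hcontent s (C n i))) < hausdorff_measure s A + ennreal (1 / real (Suc n))"
    by (intro choice allI)
  then obtain C :: "nat \<Rightarrow> nat \<Rightarrow> 'a set" where C: "\<And>n. A \<subseteq> (\<Union>i. C n i)"
    "\<And>n i. bounded (C n i)" "\<And>n i. diameter (C n i) \<le> 1 / real (Suc n)"
    "\<And>n. (\<Sum>i. ennreal (hcontent s (C n i))) < hausdorff_measure s A + ennreal (1 / real (Suc n))"
    by blast
  define G where "G = (\<Inter>n. \<Union>i. closure (C n i))"
  have G: "G \<in> sets borel" unfolding G_def by (intro sets.countable_INT sets.countable_UN) auto
  have AG: "A \<subseteq> G"
  proof
    fix x assume x: "x \<in> A"
    have "\<exists>i. x \<in> closure (C n i)" for n
    proof -
      obtain i where "x \<in> C n i" using C(1)[of n] x by auto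
      then show ?thesis using subsetD[OF closure_subset] by (intro exI[of _ i])
    qed
    then show "x \<in> G" by (simp add: G_def)
  qed
  have hc: "hcontent s (closure (C n i)) = hcontent s (C n i)" for n i
    using C(2) by (simp add: hcontent_def diameter_closure)
  have pre: "hausdorff_pre s (1 / real (Suc k)) G \<le> hausdorff_measure s A + ennreal (1 / real (Suc k))" for k
  proof -
    have "hausdorff_pre s (1 / real (Suc k)) G \<le> (\<Sum>i. ennreal (hcontent s (closure (C k i))))"
      using C(2,3) by (intro hausdorff_pre_le_suminf) (auto simp: G_def diameter_closure bounded_closure)
    then show ?thesis using C(4)[of k] by (simp add: hc)
  qed
  have "hausdorff_measure s G \<le> hausdorff_measure s A"
    unfolding hausdorff_measure_SUP_nat[of s G]
  proof (rule SUP_least)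
    fix n
    show "hausdorff_pre s (1 / real (Suc n)) G \<le> hausdorff_measure s A"
    proof (rule ennreal_le_epsilon)
      fix e :: real assume "0 < e"
      then obtain k where k: "1 / real (Suc k) < e" using nat_approx_posE by auto
      have "hausdorff_pre s (1 / real (Suc n)) G \<le> hausdorff_pre s (1 / real (Suc (max n k))) G"
        by (intro hausdorff_pre_antimono divide_left_mono) auto
      also have "\<dots> \<le> hausdorff_measure s A + ennreal (1 / real (Suc (max n k)))" by (rule pre)
      also have "\<dots> \<le> hausdorff_measure s A + ennreal e"
      proof (intro add_left_mono ennreal_leI)
        have "1 / real (Suc (max n k)) \<le> 1 / real (Suc k)" by (intro divide_left_mono) auto
        then show "1 / real (Suc (max n k)) \<le> e" using k by linarith
      qed
      finally show "hausdorff_pre s (1 / real (Suc n)) G \<le> hausdorff_measure s A + ennreal e" .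
    qed
  qed
  then show ?thesis using that[OF G AG] hausdorff_measure_mono[OF AG] by (simp add: antisym)
qed

text \<open>By measurability of A the excess G - A of a Borel hull is null. Removing from G a Borel
  hull N of this excess leaves a Borel subset of A of full measure.\<close>

lemma borel_kernel:
  fixes A :: "'a::metric_space set"
  assumes A: "hausdorff_measurable s A" and fin: "hausdorff_measure s A < \<infinity>"
  obtains B where "B \<in> sets borel" "B \<subseteq> A" "hausdorff_measure s B = hausdorff_measure s A"
proof -
  obtain G where G: "G \<in> sets borel" "A \<subseteq> G" "hausdorff_measure s G = hausdorff_measure s A"
    using borel_hull[OF fin] .
  have "hausdorff_measure s G = hausdorff_measure s (G \<inter> A) + hausdorff_measure s (G - A)"
    using A unfolding hausdorff_measurable_def by (rule spec)
  then have "hausdorff_measure s A + 0 = hausdorff_measure s A + hausdorff_measure s (G - A)"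
    using G(2,3) by (simp add: Int_absorb1)
  then have 0: "hausdorff_measure s (G - A) = 0" using fin unfolding ennreal_add_left_cancel by auto
  then have "hausdorff_measure s (G - A) < \<infinity>" by simp
  then obtain N where "N \<in> sets borel" "G - A \<subseteq> N" "hausdorff_measure s N = hausdorff_measure s (G - A)"
    by (rule borel_hull)
  then have N: "N \<in> sets borel" "G - A \<subseteq> N" "hausdorff_measure s N = 0" using 0 by simp_all
  have "hausdorff_measure s A \<le> hausdorff_measure s ((G - N) \<union> N)"
    using G by (intro hausdorff_measure_mono) auto
  also have "\<dots> \<le> hausdorff_measure s (G - N) + hausdorff_measure s N" by (rule hausdorff_measure_subadditive)
  finally have "hausdorff_measure s A \<le> hausdorff_measure s (G - N)" using N by simp
  moreover have "G - N \<subseteq> A" using N by auto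
  ultimately show ?thesis using that[of "G - N"] G N hausdorff_measure_mono[of "G - N" A s] by (auto intro: antisym)
qed

section \<open>Upper densities and a Frostman measure on a compact subset\<close>

lemma hausdorff_pre_le_count_space:
  assumes "countable I" "A \<subseteq> (\<Union>i\<in>I. C i)" "\<And>i. i \<in> I \<Longrightarrow> bounded (C i) \<and> diameter (C i) \<le> \<delta>" "0 \<le> \<delta>"
  shows "hausdorff_pre s \<delta> A \<le> (\<integral>\<^sup>+i. ennreal (hcontent s (C i)) \<partial>count_space I)"
proof -
  let ?f = "to_nat_on I"
  have inj: "inj_on ?f I" using assms(1) by (rule inj_on_to_nat_on)
  define K where "K n = (if n \<in> ?f ` I then C (inv_into I ?f n) else {})" for n
  have K: "K (?f i) = C i" if "i \<in> I" for i using that inj by (simp add: K_def)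
  have "hausdorff_pre s \<delta> A \<le> (\<Sum>n. ennreal (hcontent s (K n)))"
  proof (rule hausdorff_pre_le_suminf)
    show "A \<subseteq> (\<Union>n. K n)" using assms(2) K by blast
    fix n
    show "bounded (K n) \<and> diameter (K n) \<le> \<delta>"
    proof (cases "n \<in> ?f ` I")
      case True
      then show ?thesis using assms(3) K by auto
    qed (use assms(4) in \<open>simp add: K_def\<close>)
  qed
  also have "\<dots> = (\<integral>\<^sup>+n. ennreal (hcontent s (K n)) \<partial>count_space UNIV)"
    by (rule nn_integral_count_space_nat[symmetric])
  also have "\<dots> = (\<integral>\<^sup>+n. ennreal (hcontent s (K n)) \<partial>count_space (?f ` I))"
    by (rule nn_integral_count_space_eq) (auto simp: K_def hcontent_def)
  also have "\<dots> = (\<integral>\<^sup>+i. ennreal (hcontent s (K (?f i))) \<partial>count_space I)"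
    by (rule nn_integral_bij_count_space[symmetric]) (use inj in \<open>auto simp: bij_betw_def\<close>)
  also have "\<dots> = (\<integral>\<^sup>+i. ennreal (hcontent s (C i)) \<partial>count_space I)"
    by (rule nn_integral_cong) (simp add: K)
  finally show ?thesis .
qed

text \<open>Vitali covering: disjoint balls with mass above k times \<open>r powr s\<close> have
  total s-content of order 1 / k, and enlarging them five times to cover Z multiplies this by a
  constant.\<close>

lemma hausdorff_upper_density:
  fixes Z :: "'a::euclidean_space set"
  assumes s: "0 < s" and sets: "sets \<mu> = sets borel" and fin: "emeasure \<mu> UNIV < \<infinity>"
    and Z: "\<And>x k. x \<in> Z \<Longrightarrow> \<exists>r>0. r < 1 / real (Suc k) \<and> ennreal (real (Suc k) * r powr s) < emeasure \<mu> (ball x r)"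
  shows "hausdorff_measure s Z = 0"
proof -
  define M where "M = enn2real (emeasure \<mu> UNIV)"
  have M: "emeasure \<mu> UNIV = ennreal M" "0 \<le> M" using fin by (auto simp: M_def less_top)
  have "hausdorff_pre s \<delta> Z \<le> 0 + ennreal e" if \<delta>: "0 < \<delta>" and e: "0 < e" for \<delta> e
  proof -
    \<comment> \<open>The first bound makes the diameters 10 r at most \<delta>, the second makes
      the resulting content \<open>10 powr s * M / k\<close> at most e.\<close>
    obtain k where "max (10 / \<delta>) (10 powr s * M / e) < real k"
      using reals_Archimedean2 by blast
    then have k: "max (10 / \<delta>) (10 powr s * M / e) < real (Suc k)" by simp
    define k' where "k' = real (Suc k)"
    have k': "0 < k'" "10 / \<delta> < k'" "10 powr s * M / e < k'" using k by (auto simp: k'_def)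
    obtain r where r: "\<And>x. x \<in> Z \<Longrightarrow> 0 < r x" "\<And>x. x \<in> Z \<Longrightarrow> r x < 1 / k'"
      "\<And>x. x \<in> Z \<Longrightarrow> ennreal (k' * (r x) powr s) < emeasure \<mu> (ball x (r x))"
      using Z[of _ k] unfolding k'_def by metis
    obtain C where C: "countable C" "C \<subseteq> Z" "pairwise (\<lambda>i j. disjnt (ball i (r i)) (ball j (r j))) C"
      "Z \<subseteq> (\<Union>i\<in>C. ball i (5 * r i))"
    proof (rule Vitali_covering_lemma_balls[where S = Z and K = Z and a = "\<lambda>x. x" and r = r and B = "1 / k'"])
      show "Z \<subseteq> (\<Union>i\<in>Z. ball i (r i))" using r(1) by auto
      show "0 < r i \<and> r i \<le> 1 / k'" if "i \<in> Z" for i using r(1,2)[OF that] by simp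
    qed blast
    have rC: "0 < r x" "10 * r x \<le> \<delta>" if "x \<in> C" for x
    proof -
      have x: "x \<in> Z" using that C(2) by auto
      show "0 < r x" using r(1)[OF x] .
      have "1 / k' \<le> \<delta> / 10" using k' \<delta> by (simp add: field_simps)
      then show "10 * r x \<le> \<delta>" using r(2)[OF x] by simp
    qed
    have diam: "diameter (ball x (5 * r x)) \<le> 10 * r x" if "x \<in> C" for x
    proof (rule diameter_le)
      show "ball x (5 * r x) \<noteq> {} \<or> 0 \<le> 10 * r x" using rC(1)[OF that] by simp
      fix y z assume "y \<in> ball x (5 * r x)" "z \<in> ball x (5 * r x)"
      then show "norm (y - z) \<le> 10 * r x" using dist_triangle[of y z x] by (simp add: dist_commute dist_norm[symmetric])
    qed
    have "hausdorff_pre s \<delta> Z \<le> (\<integral>\<^sup>+x. ennreal (hcontent s (ball x (5 * r x))) \<partial>count_space C)"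
    proof (rule hausdorff_pre_le_count_space[OF C(1,4)])
      show "bounded (ball x (5 * r x)) \<and> diameter (ball x (5 * r x)) \<le> \<delta>" if "x \<in> C" for x
        using order_trans[OF diam[OF that] rC(2)[OF that]] by simp
    qed (use \<delta> in simp)
    also have "\<dots> \<le> (\<integral>\<^sup>+x. ennreal (10 powr s / k') * emeasure \<mu> (ball x (r x)) \<partial>count_space C)"
    proof (rule nn_integral_mono)
      fix x assume "x \<in> space (count_space C)"
      then have x: "x \<in> C" "x \<in> Z" using C(2) by auto
      have "hcontent s (ball x (5 * r x)) \<le> (10 * r x) powr s"
        using s diam[OF x(1)] by (intro hcontent_le) auto
      also have "\<dots> = 10 powr s / k' * (k' * (r x) powr s)" using k' rC(1)[OF x(1)] by (simp add: powr_mult)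
      finally have "ennreal (hcontent s (ball x (5 * r x))) \<le> ennreal (10 powr s / k' * (k' * (r x) powr s))" by (rule ennreal_leI)
      also have "\<dots> = ennreal (10 powr s / k') * ennreal (k' * (r x) powr s)" using k' by (intro ennreal_mult) auto
      also have "\<dots> \<le> ennreal (10 powr s / k') * emeasure \<mu> (ball x (r x))"
        by (rule mult_left_mono[OF less_imp_le[OF r(3)[OF x(2)]]]) simp
      finally show "ennreal (hcontent s (ball x (5 * r x))) \<le> ennreal (10 powr s / k') * emeasure \<mu> (ball x (r x))" .
    qed
    also have "\<dots> = ennreal (10 powr s / k') * (\<integral>\<^sup>+x. emeasure \<mu> (ball x (r x)) \<partial>count_space C)"
      by (rule nn_integral_cmult) simp
    also have "(\<integral>\<^sup>+x. emeasure \<mu> (ball x (r x)) \<partial>count_space C) = emeasure \<mu> (\<Union>x\<in>C. ball x (r x))"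
      using C(1,3) sets by (intro emeasure_UN_countable[symmetric]) (auto simp: pairwise_def disjoint_family_on_def disjnt_def)
    also have "\<dots> \<le> emeasure \<mu> UNIV" by (rule emeasure_mono) (auto simp: sets)
    also have "ennreal (10 powr s / k') * emeasure \<mu> UNIV = ennreal (10 powr s / k' * M)"
      unfolding M(1) using k' M(2) by (intro ennreal_mult[symmetric]) auto
    also have "\<dots> \<le> ennreal e" using k' e by (intro ennreal_leI) (simp add: field_simps)
    finally show ?thesis by (simp add: mult_left_mono)
  qed
  note le = this
  have "hausdorff_pre s \<delta> Z \<le> 0" if "0 < \<delta>" for \<delta>
    by (rule ennreal_le_epsilon) (rule le[OF that])
  then show ?thesis by (simp add: hausdorff_measure_def)
qed

text \<open>The mass of an open ball is lower semicontinuous in the centre: the mass is nearly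
  attained on a slightly smaller ball, which stays inside when the centre moves a little.\<close>

lemma closed_ball_measure_le:
  fixes \<mu> :: "'a::metric_space measure"
  assumes sets: "sets \<mu> = sets borel"
  shows "closed {x. emeasure \<mu> (ball x r) \<le> c}"
proof -
  have "open {x. c < emeasure \<mu> (ball x r)}"
  proof (rule openI)
    fix x assume "x \<in> {x. c < emeasure \<mu> (ball x r)}"
    then have x: "c < emeasure \<mu> (ball x r)" by simp
    have "ball x r = (\<Union>n. ball x (r - 1 / real (Suc n)))"
    proof (intro equalityI subsetI)
      fix y assume "y \<in> ball x r"
      then have "0 < r - dist x y" by simp
      then obtain n where "1 / real (Suc n) < r - dist x y" using nat_approx_posE by blast
      then have "y \<in> ball x (r - 1 / real (Suc n))" by simp
      then show "y \<in> (\<Union>n. ball x (r - 1 / real (Suc n)))" by blast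
    next
      fix y assume "y \<in> (\<Union>n. ball x (r - 1 / real (Suc n)))"
      then obtain n where "dist x y < r - 1 / real (Suc n)" by auto
      moreover have "0 < 1 / real (Suc n)" by simp
      ultimately show "y \<in> ball x r" unfolding mem_ball by linarith
    qed
    moreover have "(SUP n. emeasure \<mu> (ball x (r - 1 / real (Suc n)))) = emeasure \<mu> (\<Union>n. ball x (r - 1 / real (Suc n)))"
    proof (rule SUP_emeasure_incseq)
      show "incseq (\<lambda>n. ball x (r - 1 / real (Suc n)))"
      proof (rule incseq_SucI)
        fix n
        have "1 / real (Suc (Suc n)) \<le> 1 / real (Suc n)" by (intro divide_left_mono) auto
        then show "ball x (r - 1 / real (Suc n)) \<le> ball x (r - 1 / real (Suc (Suc n)))" by (intro subset_ball) simp
      qed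
    qed (auto simp: sets)
    ultimately have "c < (SUP n. emeasure \<mu> (ball x (r - 1 / real (Suc n))))" using x by simp
    then obtain n where n: "c < emeasure \<mu> (ball x (r - 1 / real (Suc n)))" unfolding less_SUP_iff by auto
    show "\<exists>e>0. ball x e \<subseteq> {x. c < emeasure \<mu> (ball x r)}"
    proof (intro exI[of _ "1 / real (Suc n)"] conjI subsetI)
      fix y assume y: "y \<in> ball x (1 / real (Suc n))"
      have "ball x (r - 1 / real (Suc n)) \<subseteq> ball y r"
      proof
        fix z assume "z \<in> ball x (r - 1 / real (Suc n))"
        then show "z \<in> ball y r" using y dist_triangle[of y z x] by (simp add: dist_commute del: of_nat_Suc)
      qed
      then have "emeasure \<mu> (ball x (r - 1 / real (Suc n))) \<le> emeasure \<mu> (ball y r)" by (rule emeasure_mono) (simp add: sets)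
      then show "y \<in> {x. c < emeasure \<mu> (ball x r)}" using n by simp
    qed auto
  qed
  moreover have "{x. emeasure \<mu> (ball x r) \<le> c} = - {x. c < emeasure \<mu> (ball x r)}" by auto
  ultimately show ?thesis by (simp add: closed_def)
qed

text \<open>The measure is the s-dimensional Hausdorff measure restricted to a compact piece of
  bounded upper density. Such a piece of positive measure exists because points of infinite density
  form a null set.\<close>

lemma frostman_subset:
  fixes A :: "'a::euclidean_space set"
  assumes s: "0 < s" and A: "hausdorff_measurable s A" "0 < hausdorff_measure s A" "hausdorff_measure s A < \<infinity>"
  obtains C \<mu> c where "compact C" "C \<subseteq> A" "sets \<mu> = sets borel" "finite_measure \<mu>" "emeasure \<mu> (- C) = 0"
    "0 < emeasure \<mu> UNIV" "0 \<le> c" "\<And>x k. x \<in> C \<Longrightarrow> emeasure \<mu> (cball x (1 / 2 ^ k)) \<le> ennreal (c * (1 / 2 ^ k) powr s)"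
    "emeasure \<mu> UNIV \<le> ennreal c"
proof -
  obtain B where B: "B \<in> sets borel" "B \<subseteq> A" "hausdorff_measure s B = hausdorff_measure s A"
    using borel_kernel[OF A(1,3)] .
  let ?N = "hausdorff_borel s :: 'a measure"
  define \<mu>B where "\<mu>B = density ?N (indicator B)"
  have \<mu>B: "emeasure \<mu>B S = hausdorff_measure s (B \<inter> S)" if "S \<in> sets borel" for S
    unfolding \<mu>B_def using that B(1) by (subst emeasure_restricted) (auto simp: emeasure_hausdorff_borel)
  have sB: "sets \<mu>B = sets borel" by (simp add: \<mu>B_def)
  have spB: "space \<mu>B = UNIV" using sets_eq_imp_space_eq[OF sB] by simp
  have "emeasure \<mu>B (space \<mu>B) \<noteq> \<infinity>" using A(3) B(3) by (simp add: spB \<mu>B)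
  from inner_regular[OF sB this B(1)] have "(SUP K\<in>{K. K \<subseteq> B \<and> compact K}. emeasure \<mu>B K) = hausdorff_measure s A"
    using B by (simp add: \<mu>B)
  then have "0 < (SUP K\<in>{K. K \<subseteq> B \<and> compact K}. emeasure \<mu>B K)" using A(2) by simp
  then obtain K where K: "K \<subseteq> B" "compact K" "0 < emeasure \<mu>B K" unfolding less_SUP_iff by auto
  have Kb: "K \<in> sets borel" using K(2) by (simp add: borel_compact)
  have HK: "0 < hausdorff_measure s K" using K Kb by (simp add: \<mu>B Int_absorb1)
  have HKfin: "hausdorff_measure s K < \<infinity>" using K(1) B(2) by (intro le_less_trans[OF hausdorff_measure_mono A(3)]) auto
  define \<mu> where "\<mu> = density ?N (indicator K)"
  have \<mu>: "emeasure \<mu> S = hausdorff_measure s (K \<inter> S)" if "S \<in> sets borel" for S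
    unfolding \<mu>_def using that Kb by (subst emeasure_restricted) (auto simp: emeasure_hausdorff_borel)
  have s\<mu>: "sets \<mu> = sets borel" by (simp add: \<mu>_def)
  have \<mu>fin: "emeasure \<mu> UNIV < \<infinity>" using HKfin by (simp add: \<mu>)
  \<comment> \<open>Density at most k + 1 at all radii below 1 / (k + 1); compact, as an
    intersection of closed sets over all these radii.\<close>
  define E where "E k = K \<inter> (\<Inter>r\<in>{0<..<1 / real (Suc k)}. {x. emeasure \<mu> (ball x r) \<le> ennreal (real (Suc k) * r powr s)})" for k
  have Ec: "compact (E k)" for k
    unfolding E_def using K(2) by (intro compact_Int_closed closed_INT ballI closed_ball_measure_le s\<mu>)
  have "hausdorff_measure s (K - (\<Union>k. E k)) = 0"
  proof (rule hausdorff_upper_density[OF s s\<mu> \<mu>fin])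
    fix x k assume x: "x \<in> K - (\<Union>k. E k)"
    then have "x \<notin> E k" "x \<in> K" by auto
    then show "\<exists>r>0. r < 1 / real (Suc k) \<and> ennreal (real (Suc k) * r powr s) < emeasure \<mu> (ball x r)"
      by (auto simp: E_def not_le)
  qed
  then have "hausdorff_measure s K \<le> hausdorff_measure s (\<Union>k. E k)"
    using hausdorff_measure_subadditive[of s "K - (\<Union>k. E k)" "\<Union>k. E k"] hausdorff_measure_mono[of K "K - (\<Union>k. E k) \<union> (\<Union>k. E k)" s]
    by auto
  then have "hausdorff_measure s (\<Union>k. E k) \<noteq> 0" using HK by auto
  then obtain k where k: "hausdorff_measure s (E k) \<noteq> 0" using hausdorff_measure_null_UN by metis
  define C where "C = E k"
  have C: "compact C" "C \<subseteq> K" "0 < hausdorff_measure s C"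
    using Ec k by (auto simp: C_def E_def zero_less_iff_neq_zero)
  have Cb: "C \<in> sets borel" using C(1) by (simp add: borel_compact)
  define \<nu> where "\<nu> = density ?N (indicator C)"
  have \<nu>: "emeasure \<nu> S = hausdorff_measure s (C \<inter> S)" if "S \<in> sets borel" for S
    unfolding \<nu>_def using that Cb by (subst emeasure_restricted) (auto simp: emeasure_hausdorff_borel)
  have s\<nu>: "sets \<nu> = sets borel" by (simp add: \<nu>_def)
  have le: "emeasure \<nu> S \<le> emeasure \<mu> S" if "S \<in> sets borel" for S
    using that C(2) unfolding \<nu>[OF that] \<mu>[OF that] by (intro hausdorff_measure_mono) auto
  define M where "M = enn2real (emeasure \<mu> UNIV)"
  have M: "emeasure \<mu> UNIV = ennreal M" "0 \<le> M" using \<mu>fin by (auto simp: M_def less_top)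
  \<comment> \<open>The second term serves small radii, where a closed ball is put into an open one
    of twice the radius; the third serves radii beyond the density bound, where the total mass M is
    compared with \<open>(1 / 2 ^ j) powr s\<close>.\<close>
  define c where "c = max M (max (real (Suc k) * 2 powr s) (M * (2 * real (Suc k)) powr s))"
  have c: "M \<le> c" "real (Suc k) * 2 powr s \<le> c" "M * (2 * real (Suc k)) powr s \<le> c" by (auto simp: c_def)
  have growth: "emeasure \<nu> (cball x (1 / 2 ^ j)) \<le> ennreal (c * (1 / 2 ^ j) powr s)" if x: "x \<in> C" for x j
  proof (cases "2 * (1 / 2 ^ j) < 1 / real (Suc k)")
    case True
    have "emeasure \<nu> (cball x (1 / 2 ^ j)) \<le> emeasure \<mu> (cball x (1 / 2 ^ j))" by (intro le) auto
    also have "\<dots> \<le> emeasure \<mu> (ball x (2 * (1 / 2 ^ j)))"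
      by (rule emeasure_mono) (auto simp: s\<mu> divide_simps)
    also have "\<dots> \<le> ennreal (real (Suc k) * (2 * (1 / 2 ^ j)) powr s)"
      using x True unfolding C_def E_def by auto
    also have "real (Suc k) * (2 * (1 / 2 ^ j)) powr s = (real (Suc k) * 2 powr s) * (1 / 2 ^ j) powr s"
      by (subst powr_mult) auto
    also have "ennreal \<dots> \<le> ennreal (c * (1 / 2 ^ j) powr s)"
      by (intro ennreal_leI mult_right_mono c) auto
    finally show ?thesis .
  next
    case False
    then have "1 \<le> 2 * real (Suc k) * (1 / 2 ^ j)" by (simp add: field_simps)
    then have "1 powr s \<le> (2 * real (Suc k) * (1 / 2 ^ j)) powr s" using s by (intro powr_mono2) auto
    then have "1 \<le> (2 * real (Suc k)) powr s * (1 / 2 ^ j) powr s" by (subst powr_mult[symmetric]) auto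
    then have "M * 1 \<le> M * ((2 * real (Suc k)) powr s * (1 / 2 ^ j) powr s)" using M(2) by (rule mult_left_mono)
    also have "\<dots> = M * (2 * real (Suc k)) powr s * (1 / 2 ^ j) powr s" by (simp only: mult.assoc)
    also have "\<dots> \<le> c * (1 / 2 ^ j) powr s" by (intro mult_right_mono c) auto
    finally have "ennreal M \<le> ennreal (c * (1 / 2 ^ j) powr s)" by (simp add: ennreal_leI)
    moreover have "emeasure \<nu> (cball x (1 / 2 ^ j)) \<le> emeasure \<mu> UNIV"
      using le[of "cball x (1 / 2 ^ j)"] emeasure_mono[of "cball x (1 / 2 ^ j)" UNIV \<mu>] by (auto simp: s\<mu> intro: order_trans)
    ultimately show ?thesis using M(1) by auto
  qed
  show ?thesis
  proof (rule that[of C \<nu> c])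
    show "C \<subseteq> A" using C(2) K(1) B(2) by auto
    have sp: "space \<nu> = UNIV" using sets_eq_imp_space_eq[OF s\<nu>] by simp
    show "finite_measure \<nu>"
      using le[of UNIV] \<mu>fin by (intro finite_measureI) (auto simp: sp top_unique)
    show "emeasure \<nu> (- C) = 0" using Cb by (simp add: \<nu> borel_comp)
    show "0 < emeasure \<nu> UNIV" using C(3) by (simp add: \<nu>)
    show "emeasure \<nu> UNIV \<le> ennreal c"
      using le[of UNIV] M(1) ennreal_leI[OF c(1)] by auto
    show "0 \<le> c" using M(2) c(1) by simp
  qed (use C(1) s\<nu> growth in auto)
qed

section \<open>Dependence of Hausdorff measure on the exponent\<close>

lemma hausdorff_measure_antimono_dim:
  assumes "0 \<le> u" "u \<le> t"
  shows "hausdorff_measure t X \<le> hausdorff_measure u X"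
proof -
  have hc: "hcontent t C \<le> hcontent u C" if "bounded C" "diameter C \<le> 1" for C :: "'a set"
  proof (cases "C = {} \<or> diameter C = 0")
    case False
    have "diameter C powr t \<le> diameter C powr u"
      using that assms diameter_ge_0[OF that(1)] by (intro powr_mono')
    then show ?thesis using False by (simp add: hcontent_def)
  qed (use assms in \<open>auto simp: hcontent_def\<close>)
  have "hausdorff_pre t (1 / real (Suc n)) X \<le> hausdorff_pre u (1 / real (Suc n)) X" for n
    unfolding hausdorff_pre_def
  proof (rule INF_mono)
    fix C assume C: "C \<in> {C :: nat \<Rightarrow> 'a set. X \<subseteq> (\<Union>i. C i) \<and> (\<forall>i. bounded (C i) \<and> diameter (C i) \<le> 1 / real (Suc n))}"
    have "1 / real (Suc n) \<le> 1" by simp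
    then have "diameter (C i) \<le> 1" for i using C by (blast intro: order_trans)
    then have "(\<Sum>i. ennreal (hcontent t (C i))) \<le> (\<Sum>i. ennreal (hcontent u (C i)))"
      using C by (intro suminf_le ennreal_leI hc) auto
    then show "\<exists>C'\<in>{C :: nat \<Rightarrow> 'a set. X \<subseteq> (\<Union>i. C i) \<and> (\<forall>i. bounded (C i) \<and> diameter (C i) \<le> 1 / real (Suc n))}.
        (\<Sum>i. ennreal (hcontent t (C' i))) \<le> (\<Sum>i. ennreal (hcontent u (C i)))"
      using C by blast
  qed
  then show ?thesis unfolding hausdorff_measure_SUP_nat by (intro SUP_mono) auto
qed

lemma hausdorff_measure_zero_above:
  assumes u: "0 < u" "u < t" and fin: "hausdorff_measure u X < \<infinity>"
  shows "hausdorff_measure t X = 0"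
proof -
  define H where "H = enn2real (hausdorff_measure u X)"
  have H: "hausdorff_measure u X = ennreal H" "0 \<le> H" using fin by (auto simp: H_def less_top)
  have "hausdorff_pre t \<delta> X \<le> 0 + ennreal e" if \<delta>: "0 < \<delta>" and e: "0 < e" for \<delta> e
  proof -
    \<comment> \<open>At this mesh the gain \<open>d powr (t - u)\<close> brings the bound H + 1 on
      the u-content down to e.\<close>
    define d where "d = min \<delta> ((e / (H + 1)) powr (1 / (t - u)))"
    have d: "0 < d" "d \<le> \<delta>" using \<delta> e H(2) by (auto simp: d_def)
    have "d powr (t - u) \<le> ((e / (H + 1)) powr (1 / (t - u))) powr (t - u)"
      using d u by (intro powr_mono2) (auto simp: d_def)
    also have "\<dots> = e / (H + 1)" using u e H(2) by (simp add: powr_powr)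
    finally have dt: "d powr (t - u) * (H + 1) \<le> e" using H(2) by (simp add: field_simps)
    have "hausdorff_pre u d X \<le> ennreal H" using hausdorff_pre_le_measure[OF d(1), of u X] H by simp
    also have "\<dots> < ennreal (H + 1)" using H by (simp add: ennreal_less_iff)
    finally have "\<exists>C :: nat \<Rightarrow> 'a set. X \<subseteq> (\<Union>i. C i) \<and> (\<forall>i. bounded (C i) \<and> diameter (C i) \<le> d) \<and>
      (\<Sum>i. ennreal (hcontent u (C i))) < ennreal (H + 1)" by (rule hausdorff_pre_lessD)
    then obtain C :: "nat \<Rightarrow> 'a set" where C: "X \<subseteq> (\<Union>i. C i)" "\<And>i. bounded (C i)" "\<And>i. diameter (C i) \<le> d"
      "(\<Sum>i. ennreal (hcontent u (C i))) < ennreal (H + 1)" by blast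
    have hc: "hcontent t (C i) \<le> d powr (t - u) * hcontent u (C i)" for i
    proof (cases "C i = {} \<or> diameter (C i) = 0")
      case False
      then have D: "0 < diameter (C i)" using diameter_ge_0[OF C(2)[of i]] by simp
      have "diameter (C i) powr t = diameter (C i) powr (t - u) * diameter (C i) powr u" by (simp flip: powr_add)
      also have "\<dots> \<le> d powr (t - u) * diameter (C i) powr u"
        using D C(3)[of i] u by (intro mult_right_mono powr_mono2) auto
      finally show ?thesis using False by (simp add: hcontent_def)
    qed (use u in \<open>auto simp: hcontent_def\<close>)
    have "hausdorff_pre t \<delta> X \<le> hausdorff_pre t d X" by (rule hausdorff_pre_antimono[OF d(2)])
    also have "\<dots> \<le> (\<Sum>i. ennreal (hcontent t (C i)))" using C by (intro hausdorff_pre_le_suminf) auto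
    also have "\<dots> \<le> (\<Sum>i. ennreal (d powr (t - u)) * ennreal (hcontent u (C i)))"
      by (intro suminf_le) (auto simp: hc hcontent_nonneg intro!: ennreal_leI simp flip: ennreal_mult)
    also have "\<dots> = ennreal (d powr (t - u)) * (\<Sum>i. ennreal (hcontent u (C i)))" by simp
    also have "\<dots> \<le> ennreal (d powr (t - u)) * ennreal (H + 1)"
      by (rule mult_left_mono[OF less_imp_le[OF C(4)]]) simp
    also have "\<dots> = ennreal (d powr (t - u) * (H + 1))" using H by (intro ennreal_mult[symmetric]) auto
    also have "\<dots> \<le> ennreal e" using dt by (rule ennreal_leI)
    finally show ?thesis by simp
  qed
  note le = this
  have "hausdorff_pre t \<delta> X \<le> 0" if "0 < \<delta>" for \<delta>
    by (rule ennreal_le_epsilon) (rule le[OF that])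
  then show ?thesis by (simp add: hausdorff_measure_def)
qed

lemma hausdorff_measure_singleton:
  assumes "0 < t" shows "hausdorff_measure t {x} = 0"
proof -
  have "hausdorff_pre t \<delta> {x} \<le> (\<Sum>i::nat. ennreal (hcontent t {x}))" if "0 < \<delta>" for \<delta>
    using that by (intro hausdorff_pre_le_suminf) auto
  then show ?thesis using assms by (simp add: hausdorff_measure_def hcontent_def)
qed

section \<open>Hausdorff measure of slices\<close>

context invariant_grassmannian
begin

text \<open>Chebyshev's inequality: on the strip, the Gaussian kernel of width d is at least
  \<open>exp (- 1 / 2) / d ^ m\<close>.\<close>

lemma strip_measure_le:
  obtains K where "0 \<le> K" "\<And>d z. 0 < d \<Longrightarrow> z \<noteq> 0 \<Longrightarrow>
    emeasure \<gamma> {V \<in> space \<gamma>. infdist z V \<le> d} \<le> ennreal (K * (d / norm z) ^ m)"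
proof -
  obtain C where C: "1 \<le> C" "\<And>a z. 0 < a \<Longrightarrow> kernel_avg a z \<le> ennreal (C / (max a (norm z)) ^ m)"
    using kernel_avg_upper by blast
  have "emeasure \<gamma> {V \<in> space \<gamma>. infdist z V \<le> d} \<le> ennreal (exp (1/2) * C * (d / norm z) ^ m)" if d: "0 < d" and z: "z \<noteq> 0" for d z
  proof -
    have "emeasure \<gamma> {V \<in> space \<gamma>. infdist z V \<le> d} = (\<integral>\<^sup>+V. indicator {V \<in> space \<gamma>. infdist z V \<le> d} V \<partial>\<gamma>)"
      by (rule nn_integral_indicator[symmetric]) measurable
    also have "\<dots> \<le> (\<integral>\<^sup>+V. ennreal (exp (1/2) * d ^ m) * ennreal (gauss_kernel m d V z) \<partial>\<gamma>)"
    proof (rule nn_integral_mono)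
      fix V
      show "indicator {V \<in> space \<gamma>. infdist z V \<le> d} V \<le> ennreal (exp (1/2) * d ^ m) * ennreal (gauss_kernel m d V z)"
      proof (cases "infdist z V \<le> d")
        case True
        then have "(infdist z V)\<^sup>2 \<le> d\<^sup>2" by (intro power_mono infdist_nonneg)
        then have "(infdist z V)\<^sup>2 / (2 * d\<^sup>2) \<le> 1 / 2" using d by (simp add: divide_le_eq)
        then have "exp 0 \<le> exp (1 / 2 - (infdist z V)\<^sup>2 / (2 * d\<^sup>2))" by (subst exp_le_cancel_iff) linarith
        also have "\<dots> = exp (1/2) * d ^ m * gauss_kernel m d V z"
        proof -
          have "exp (1 / 2 - (infdist z V)\<^sup>2 / (2 * d\<^sup>2)) = exp (1/2) * exp (- (infdist z V)\<^sup>2 / (2 * d\<^sup>2))"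
            by (subst exp_add[symmetric]) simp
          then show ?thesis using d by (simp add: gauss_kernel_def)
        qed
        finally have "ennreal 1 \<le> ennreal (exp (1/2) * d ^ m * gauss_kernel m d V z)" by (intro ennreal_leI) simp
        also have "\<dots> = ennreal (exp (1/2) * d ^ m) * ennreal (gauss_kernel m d V z)" using d by (intro ennreal_mult) auto
        finally show ?thesis by (simp add: indicator_def)
      qed simp
    qed
    also have "\<dots> = ennreal (exp (1/2) * d ^ m) * kernel_avg d z"
      unfolding kernel_avg_def by (rule nn_integral_cmult) measurable
    also have "\<dots> \<le> ennreal (exp (1/2) * d ^ m) * ennreal (C / (max d (norm z)) ^ m)"
      by (rule mult_left_mono[OF C(2)[OF d]]) simp
    also have "\<dots> = ennreal (exp (1/2) * d ^ m * (C / (max d (norm z)) ^ m))"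
      using d C(1) by (intro ennreal_mult[symmetric]) auto
    also have "\<dots> \<le> ennreal (exp (1/2) * d ^ m * (C / norm z ^ m))"
      using d C(1) z by (intro ennreal_leI mult_left_mono divide_left_mono power_mono) auto
    also have "exp (1/2) * d ^ m * (C / norm z ^ m) = exp (1/2) * C * (d / norm z) ^ m"
      by (simp add: power_divide)
    finally show ?thesis .
  qed
  then show ?thesis using that[of "exp (1/2) * C"] C(1) by simp
qed

text \<open>A set of diameter d meeting A at distance at least r from x is hit by V + x for a
  proportion of order (d / r) ^ m of the V, and the exponents s - m and m add up to s. Fatou over
  finer and finer covers bounds the average over V. Points near x are cut off because the strip
  bound degenerates there.\<close>

lemma slices_finite_measure:
  assumes fin: "hausdorff_measure s A < \<infinity>" and s: "real m < s" and r: "0 < r"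
  shows "AE V in \<gamma>. hausdorff_measure (s - real m) ({y\<in>A. r \<le> dist x y} \<inter> (\<lambda>v. v + x) ` V) < \<infinity>"
proof -
  define A' where "A' = {y\<in>A. r \<le> dist x y}"
  define u where "u = s - real m"
  have u: "0 < u" using s by (simp add: u_def)
  define H where "H = enn2real (hausdorff_measure s A)"
  have H: "hausdorff_measure s A = ennreal H" "0 \<le> H" using fin by (auto simp: H_def less_top)
  have "\<exists>C :: nat \<Rightarrow> (real^'n) set. A' \<subseteq> (\<Union>i. C i) \<and> (\<forall>i. bounded (C i) \<and> diameter (C i) \<le> 1 / real (Suc n)) \<and>
      (\<Sum>i. ennreal (hcontent s (C i))) < ennreal (H + 1)" for n
  proof (rule hausdorff_pre_lessD)
    have "hausdorff_pre s (1 / real (Suc n)) A' \<le> hausdorff_measure s A'" by (intro hausdorff_pre_le_measure) simp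
    also have "\<dots> \<le> ennreal H" unfolding H(1)[symmetric] by (intro hausdorff_measure_mono) (auto simp: A'_def)
    also have "\<dots> < ennreal (H + 1)" using H by (simp add: ennreal_less_iff)
    finally show "hausdorff_pre s (1 / real (Suc n)) A' < ennreal (H + 1)" .
  qed
  then have "\<exists>C :: nat \<Rightarrow> nat \<Rightarrow> (real^'n) set. \<forall>n. A' \<subseteq> (\<Union>i. C n i) \<and> (\<forall>i. bounded (C n i) \<and> diameter (C n i) \<le> 1 / real (Suc n)) \<and>
      (\<Sum>i. ennreal (hcontent s (C n i))) < ennreal (H + 1)"
    by (intro choice allI)
  then obtain C :: "nat \<Rightarrow> nat \<Rightarrow> (real^'n) set" where C: "\<And>n. A' \<subseteq> (\<Union>i. C n i)"
    "\<And>n i. bounded (C n i)" "\<And>n i. diameter (C n i) \<le> 1 / real (Suc n)"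
    "\<And>n. (\<Sum>i. ennreal (hcontent s (C n i))) < ennreal (H + 1)"
    by blast
  define d where "d n i = diameter (C n i)" for n i
  have d0: "0 \<le> d n i" for n i unfolding d_def by (rule diameter_ge_0[OF C(2)])
  define P where "P n i \<longleftrightarrow> C n i \<inter> A' \<noteq> {}" for n i
  \<comment> \<open>A reference point in A' is at distance at least r from x, which the rest of the
    covering set need not be.\<close>
  define c where "c n i = (SOME y. y \<in> C n i \<inter> A')" for n i
  have c: "c n i \<in> C n i \<inter> A'" if "P n i" for n i
    using that some_in_eq[of "C n i \<inter> A'"] by (simp add: P_def c_def)
  define f where "f n V = (\<Sum>i. ennreal (if P n i then d n i powr u else 0) * indicator {V \<in> space \<gamma>. infdist (c n i - x) V \<le> d n i} V)" for n V
  have [measurable]: "f n \<in> borel_measurable \<gamma>" for n unfolding f_def by measurable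
  have pre: "hausdorff_pre u (1 / real (Suc n)) (A' \<inter> (\<lambda>v. v + x) ` V) \<le> f n V" if V: "V \<in> space \<gamma>" for n V
  proof -
    define K where "K i = C n i \<inter> (A' \<inter> (\<lambda>v. v + x) ` V)" for i
    have Kb: "bounded (K i)" "diameter (K i) \<le> d n i" for i
      using C(2)[of n i] unfolding K_def d_def by (auto intro: bounded_subset diameter_subset)
    have "hausdorff_pre u (1 / real (Suc n)) (A' \<inter> (\<lambda>v. v + x) ` V) \<le> (\<Sum>i. ennreal (hcontent u (K i)))"
    proof (rule hausdorff_pre_le_suminf)
      show "A' \<inter> (\<lambda>v. v + x) ` V \<subseteq> (\<Union>i. K i)" using C(1)[of n] by (auto simp: K_def)
      show "bounded (K i) \<and> diameter (K i) \<le> 1 / real (Suc n)" for i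
        using Kb[of i] C(3)[of n i] by (simp add: d_def)
    qed
    also have "\<dots> \<le> f n V"
      unfolding f_def
    proof (intro suminf_le)
      fix i
      show "ennreal (hcontent u (K i)) \<le> ennreal (if P n i then d n i powr u else 0) * indicator {V \<in> space \<gamma>. infdist (c n i - x) V \<le> d n i} V"
      proof (cases "K i = {}")
        case False
        then obtain v where "v \<in> V" "v + x \<in> C n i" "v + x \<in> A'" by (auto simp: K_def)
        then obtain y where y: "y \<in> C n i" "y \<in> A'" "y - x \<in> V" by (metis add_diff_cancel_right')
        then have Pi: "P n i" by (auto simp: P_def)
        have "infdist (c n i - x) V \<le> dist (c n i - x) (y - x)" by (rule infdist_le[OF y(3)])
        also have "\<dots> = dist (c n i) y" by (simp add: dist_norm)
        also have "\<dots> \<le> d n i" unfolding d_def using c[OF Pi] y(1) C(2) by (intro diameter_bounded_bound) auto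
        finally have "infdist (c n i - x) V \<le> d n i" .
        then show ?thesis using Pi V hcontent_le[OF u Kb(1,2)] by (simp add: ennreal_leI)
      qed (simp add: hcontent_def)
    qed auto
    finally show ?thesis .
  qed
  obtain k where k: "0 \<le> k" "\<And>d z. 0 < d \<Longrightarrow> z \<noteq> 0 \<Longrightarrow>
    emeasure \<gamma> {V \<in> space \<gamma>. infdist z V \<le> d} \<le> ennreal (k * (d / norm z) ^ m)"
    using strip_measure_le by blast
  define k' where "k' = k / r ^ m"
  have k': "0 \<le> k'" using k(1) r by (simp add: k'_def)
  have int: "(\<integral>\<^sup>+V. f n V \<partial>\<gamma>) \<le> ennreal k' * ennreal (H + 1)" for n
  proof -
    have "(\<integral>\<^sup>+V. f n V \<partial>\<gamma>) = (\<Sum>i. (\<integral>\<^sup>+V. ennreal (if P n i then d n i powr u else 0) * indicator {V \<in> space \<gamma>. infdist (c n i - x) V \<le> d n i} V \<partial>\<gamma>))"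
      unfolding f_def by (rule nn_integral_suminf) measurable
    also have "\<dots> = (\<Sum>i. ennreal (if P n i then d n i powr u else 0) * emeasure \<gamma> {V \<in> space \<gamma>. infdist (c n i - x) V \<le> d n i})"
      by (intro arg_cong[where f = suminf] ext nn_integral_cmult_indicator) measurable
    also have "\<dots> \<le> (\<Sum>i. ennreal k' * ennreal (hcontent s (C n i)))"
    proof (intro suminf_le)
      fix i
      show "ennreal (if P n i then d n i powr u else 0) * emeasure \<gamma> {V \<in> space \<gamma>. infdist (c n i - x) V \<le> d n i} \<le> ennreal k' * ennreal (hcontent s (C n i))"
      proof (cases "P n i \<and> d n i \<noteq> 0")
        case True
        then have dp: "0 < d n i" using d0[of n i] by simp
        have ci: "c n i \<in> C n i" "r \<le> norm (c n i - x)"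
          using c[of n i] True by (auto simp: A'_def dist_norm norm_minus_commute)
        have "emeasure \<gamma> {V \<in> space \<gamma>. infdist (c n i - x) V \<le> d n i} \<le> ennreal (k * (d n i / norm (c n i - x)) ^ m)"
          using dp ci r by (intro k(2)) auto
        also have "\<dots> \<le> ennreal (k * (d n i / r) ^ m)"
          using dp ci r k(1) by (intro ennreal_leI mult_left_mono power_mono divide_left_mono mult_pos_pos) auto
        finally have "ennreal (d n i powr u) * emeasure \<gamma> {V \<in> space \<gamma>. infdist (c n i - x) V \<le> d n i}
          \<le> ennreal (d n i powr u) * ennreal (k * (d n i / r) ^ m)" by (rule mult_left_mono) simp
        also have "\<dots> = ennreal (d n i powr u * (k * (d n i / r) ^ m))"
          using dp k(1) r by (intro ennreal_mult[symmetric]) auto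
        also have "d n i powr u * (k * (d n i / r) ^ m) = k' * (d n i powr u * d n i powr real m)"
          using dp by (simp add: k'_def power_divide powr_realpow)
        also have "d n i powr u * d n i powr real m = d n i powr s"
          by (simp add: u_def flip: powr_add)
        also have "d n i powr s = hcontent s (C n i)"
          using dp ci(1) by (auto simp: hcontent_def d_def)
        finally have "ennreal (d n i powr u) * emeasure \<gamma> {V \<in> space \<gamma>. infdist (c n i - x) V \<le> d n i} \<le> ennreal (k' * hcontent s (C n i))" .
        also have "\<dots> = ennreal k' * ennreal (hcontent s (C n i))" using k' hcontent_nonneg by (rule ennreal_mult)
        finally show ?thesis using True by simp
      qed (use u in auto)
    qed auto
    also have "\<dots> = ennreal k' * (\<Sum>i. ennreal (hcontent s (C n i)))" by simp
    also have "\<dots> \<le> ennreal k' * ennreal (H + 1)"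
      by (rule mult_left_mono[OF less_imp_le[OF C(4)]]) simp
    finally show ?thesis .
  qed
  have "(\<integral>\<^sup>+V. liminf (\<lambda>n. f n V) \<partial>\<gamma>) \<le> liminf (\<lambda>n. \<integral>\<^sup>+V. f n V \<partial>\<gamma>)"
    by (rule nn_integral_liminf) measurable
  also have "\<dots> \<le> liminf (\<lambda>n::nat. ennreal k' * ennreal (H + 1))"
    by (rule Liminf_mono) (simp add: int)
  also have "\<dots> = ennreal k' * ennreal (H + 1)" by (simp add: Liminf_const)
  also have "\<dots> < \<infinity>" by (simp add: ennreal_mult_less_top)
  finally have fin_liminf: "AE V in \<gamma>. liminf (\<lambda>n. f n V) \<noteq> \<infinity>"
    by (intro nn_integral_noteq_infinite) (auto simp: less_top)
  have "hausdorff_measure u (A' \<inter> (\<lambda>v. v + x) ` V) \<le> liminf (\<lambda>n. f n V)" if "V \<in> space \<gamma>" for V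
    unfolding hausdorff_measure_SUP_nat
  proof (rule SUP_least)
    fix j
    show "hausdorff_pre u (1 / real (Suc j)) (A' \<inter> (\<lambda>v. v + x) ` V) \<le> liminf (\<lambda>n. f n V)"
    proof (rule Liminf_bounded, rule eventually_sequentiallyI[of j])
      fix n assume "j \<le> n"
      then have "hausdorff_pre u (1 / real (Suc j)) (A' \<inter> (\<lambda>v. v + x) ` V) \<le> hausdorff_pre u (1 / real (Suc n)) (A' \<inter> (\<lambda>v. v + x) ` V)"
        by (intro hausdorff_pre_antimono divide_left_mono) auto
      also have "\<dots> \<le> f n V" using that by (rule pre)
      finally show "hausdorff_pre u (1 / real (Suc j)) (A' \<inter> (\<lambda>v. v + x) ` V) \<le> f n V" .
    qed
  qed
  note bound = this
  have "AE V in \<gamma>. hausdorff_measure u (A' \<inter> (\<lambda>v. v + x) ` V) < \<infinity>"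
    using fin_liminf AE_space
  proof eventually_elim
    case (elim V)
    then have "liminf (\<lambda>n. f n V) < \<infinity>" by (simp add: less_top)
    with bound[OF elim(2)] show ?case by (rule le_less_trans)
  qed
  then show ?thesis by (simp only: u_def A'_def)
qed

text \<open>A is exhausted by its parts at distance at least \<open>1 / real (Suc k)\<close> from x,
  and the point x itself is null in positive dimension. Finiteness in dimension s - m serves all
  larger t at once, so one null set of V suffices for all t.\<close>

lemma slices_null_above:
  assumes fin: "hausdorff_measure s A < \<infinity>" and s: "real m < s"
  shows "AE V in \<gamma>. \<forall>t > s - real m. hausdorff_measure t (A \<inter> (\<lambda>v. v + x) ` V) = 0"
proof -
  define X where "X k V = {y\<in>A. 1 / real (Suc k) \<le> dist x y} \<inter> (\<lambda>v. v + x) ` V" for k V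
  have "AE V in \<gamma>. \<forall>k. hausdorff_measure (s - real m) (X k V) < \<infinity>"
    unfolding AE_all_countable X_def by (intro allI slices_finite_measure fin s) simp
  then show ?thesis
  proof eventually_elim
    case (elim V)
    show ?case
    proof (intro allI impI)
      fix t assume t: "s - real m < t"
      have "hausdorff_measure t (X k V) = 0" for k
        using elim s t by (intro hausdorff_measure_zero_above[of "s - real m"]) auto
      then have 1: "hausdorff_measure t (\<Union>k. X k V) = 0" by (rule hausdorff_measure_null_UN)
      have "A \<inter> (\<lambda>v. v + x) ` V \<subseteq> {x} \<union> (\<Union>k. X k V)"
      proof
        fix y assume y: "y \<in> A \<inter> (\<lambda>v. v + x) ` V"
        show "y \<in> {x} \<union> (\<Union>k. X k V)"
        proof (cases "y = x")
          case False
          then have "0 < dist x y" by simp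
          then obtain k where "1 / real (Suc k) < dist x y" using nat_approx_posE by blast
          then have "y \<in> X k V" using y by (auto simp: X_def)
          then show ?thesis by blast
        qed simp
      qed
      then have "hausdorff_measure t (A \<inter> (\<lambda>v. v + x) ` V) \<le> hausdorff_measure t ({x} \<union> (\<Union>k. X k V))"
        by (rule hausdorff_measure_mono)
      also have "\<dots> \<le> hausdorff_measure t {x} + hausdorff_measure t (\<Union>k. X k V)" by (rule hausdorff_measure_subadditive)
      also have "\<dots> = 0" using 1 hausdorff_measure_singleton[of t x] s t by simp
      finally show "hausdorff_measure t (A \<inter> (\<lambda>v. v + x) ` V) = 0" by simp
    qed
  qed
qed

end

section \<open>Planes through exceptional points\<close>

lemma exp_power4_tendsto_0:
  fixes c :: real
  assumes c: "0 < c"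
  shows "(\<lambda>j. exp (- c * 4 ^ j) * (4 ^ j) ^ m) \<longlonglongrightarrow> 0"
proof -
  have "filterlim (\<lambda>j::nat. c * 4 ^ j) at_top sequentially"
  proof (rule filterlim_tendsto_pos_mult_at_top[OF tendsto_const c])
    have "filterlim (\<lambda>j::nat. 4 ^ j :: real) at_infinity sequentially"
      by (rule filterlim_realpow_sequentially_gt1) simp
    then show "filterlim (\<lambda>j::nat. 4 ^ j :: real) at_top sequentially"
      by (rule filterlim_at_infinity_imp_filterlim_at_top) simp
  qed
  from filterlim_compose[OF tendsto_power_div_exp_0 this]
  have "(\<lambda>j. (c * 4 ^ j) ^ m / exp (c * 4 ^ j)) \<longlonglongrightarrow> 0" .
  then have "(\<lambda>j. (c * 4 ^ j) ^ m / exp (c * 4 ^ j) * (1 / c ^ m)) \<longlonglongrightarrow> 0 * (1 / c ^ m)"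
    by (intro tendsto_mult tendsto_const)
  moreover have "(c * 4 ^ j) ^ m / exp (c * 4 ^ j) * (1 / c ^ m) = exp (- c * 4 ^ j) * (4 ^ j) ^ m" for j
    using c by (simp add: power_mult_distrib exp_minus field_simps)
  ultimately show ?thesis by simp
qed

context invariant_grassmannian
begin

lemma slice_energy_measurable:
  assumes [measurable_cong]: "sets \<mu> = sets borel" and fin: "finite_measure \<mu>"
  shows "slice_energy \<mu> \<delta> t \<in> borel_measurable (borel \<Otimes>\<^sub>M \<gamma>)"
proof -
  interpret M: finite_measure \<mu> by fact
  interpret pair_sigma_finite \<mu> \<mu> ..
  show ?thesis unfolding slice_energy_def by measurable
qed

text \<open>On a thin plane the density at scale \<open>1 / 2 ^ j\<close> is small against the slice
  energy, but only from a j on that depends on the plane. Comparing the fixed scale i with j and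
  letting j tend to infinity under Fatou's lemma avoids any uniformity.\<close>

lemma smear_integral_thin_slices:
  fixes \<tau> a S :: "nat \<Rightarrow> real"
  assumes s: "sets \<mu> = sets borel" and fin: "finite_measure \<mu>" and C: "emeasure \<mu> (- C) = 0" "C \<in> sets borel"
    and D: "countable D" and \<tau>: "\<And>k. 0 \<le> \<tau> k" and a: "\<And>k. 0 \<le> a k"
    and diff: "\<And>j. i \<le> j \<Longrightarrow> (\<integral>\<^sup>+x. ennreal ((smear \<mu> (1 / 2 ^ i) x - smear \<mu> (1 / 2 ^ j) x)\<^sup>2) \<partial>plane_bundle) \<le> ennreal \<epsilon>"
    and energy: "\<And>k j. (\<integral>\<^sup>+x. slice_energy \<mu> (1 / 2 ^ j) (\<tau> k) x \<partial>plane_bundle) \<le> ennreal (S k)"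
    and sum: "(\<Sum>k. ennreal (4 * a k) * ennreal (S k)) \<le> ennreal \<epsilon>" and \<epsilon>: "0 \<le> \<epsilon>"
  shows "(\<integral>\<^sup>+x. ennreal ((smear \<mu> (1 / 2 ^ i) x)\<^sup>2) * indicator (\<Union>k. thin_slices D C (\<tau> k) (a k)) x \<partial>plane_bundle) \<le> ennreal (3 * \<epsilon>)"
proof -
  define F where "F j = smear \<mu> (1 / 2 ^ j)" for j
  \<comment> \<open>For large j this nearly dominates \<open>(F i x)\<^sup>2\<close> on the thin
    planes. The sum over all k makes it independent of the index k for which the plane is
    thin.\<close>
  define X where "X j x = 2 * ennreal ((F i x - F j x)\<^sup>2) + (\<Sum>k. ennreal (4 * a k) * slice_energy \<mu> (1 / 2 ^ j) (\<tau> k) x)" for j x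
  have [measurable]: "F j \<in> borel_measurable (borel \<Otimes>\<^sub>M \<gamma>)" for j unfolding F_def by (rule smear_measurable[OF s fin])
  note [measurable] = slice_energy_measurable[OF s fin]
  have Xm[measurable]: "X j \<in> borel_measurable plane_bundle" for j unfolding X_def by measurable
  have pt: "ennreal ((F i x)\<^sup>2) \<le> liminf (\<lambda>j. X j x)"
    if x: "x \<in> (\<Union>k. thin_slices D C (\<tau> k) (a k))" "x \<in> space plane_bundle" for x
  proof -
    obtain k where k: "x \<in> thin_slices D C (\<tau> k) (a k)" using x(1) by auto
    have V: "subspace (snd x)" using x(2) subspace_gamma by (auto simp: space_plane_bundle)
    obtain \<eta> \<delta>0 where \<eta>: "0 < \<eta>" "0 < \<delta>0" "\<And>\<delta>. 0 < \<delta> \<Longrightarrow> \<delta> < \<delta>0 \<Longrightarrow>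
      ennreal ((smear \<mu> \<delta> x)\<^sup>2) \<le> ennreal (2 * (measure \<mu> UNIV * (exp (- \<eta>\<^sup>2 / (2 * \<delta>\<^sup>2)) / \<delta> ^ m))\<^sup>2) + ennreal (2 * a k) * slice_energy \<mu> \<delta> (\<tau> k) x"
      using smear_le_slice_energy[OF s fin C \<tau> k V] by blast
    define r where "r j = 4 * (measure \<mu> UNIV * (exp (- \<eta>\<^sup>2 / (2 * (1 / 2 ^ j)\<^sup>2)) / (1 / 2 ^ j) ^ m))\<^sup>2" for j :: nat
    have r: "r \<longlonglongrightarrow> 0"
    proof -
      have "(\<lambda>j. exp (- (\<eta>\<^sup>2 / 2) * 4 ^ j) * (4 ^ j) ^ m) \<longlonglongrightarrow> 0" using \<eta>(1) by (intro exp_power4_tendsto_0) simp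
      then have "(\<lambda>j. exp (- \<eta>\<^sup>2 / (2 * (1 / 2 ^ j)\<^sup>2)) / (1 / 2 ^ j) ^ m) \<longlonglongrightarrow> 0"
      proof (rule tendsto_sandwich[OF _ _ tendsto_const, rotated 2])
        show "\<forall>\<^sub>F j in sequentially. exp (- \<eta>\<^sup>2 / (2 * (1 / 2 ^ j)\<^sup>2)) / (1 / 2 ^ j) ^ m \<le> exp (- (\<eta>\<^sup>2 / 2) * 4 ^ j) * (4 ^ j) ^ m"
        proof (intro always_eventually allI)
          fix j :: nat
          have 4: "((2::real) ^ j)\<^sup>2 = 4 ^ j" by (simp add: power_mult_distrib[symmetric] power2_eq_square)
          have "(2::real) ^ j \<le> 4 ^ j" by (intro power_mono) auto
          then have "((2::real) ^ j) ^ m \<le> (4 ^ j) ^ m" by (intro power_mono) auto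
          moreover have "exp (- \<eta>\<^sup>2 / (2 * (1 / 2 ^ j)\<^sup>2)) / (1 / 2 ^ j) ^ m = exp (- (\<eta>\<^sup>2 / 2) * 4 ^ j) * (2 ^ j) ^ m"
            by (simp add: power_divide 4 power_one_over)
          ultimately show "exp (- \<eta>\<^sup>2 / (2 * (1 / 2 ^ j)\<^sup>2)) / (1 / 2 ^ j) ^ m \<le> exp (- (\<eta>\<^sup>2 / 2) * 4 ^ j) * (4 ^ j) ^ m"
            by (simp only: mult_left_mono exp_ge_zero)
        qed
      qed auto
      then have "r \<longlonglongrightarrow> 4 * (measure \<mu> UNIV * 0)\<^sup>2" unfolding r_def by (intro tendsto_intros)
      then show ?thesis by simp
    qed
    show ?thesis
    proof (rule ennreal_le_epsilon)
      fix e :: real assume e: "0 < e"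
      have ev1: "\<forall>\<^sub>F j in sequentially. r j < e" using order_tendstoD(2)[OF r e] .
      have "(\<lambda>j. (1 / 2) ^ j :: real) \<longlonglongrightarrow> 0" by (rule LIMSEQ_power_zero) simp
      from order_tendstoD(2)[OF this \<eta>(2)]
      have ev2: "\<forall>\<^sub>F j in sequentially. 1 / 2 ^ j < \<delta>0" by (simp add: power_one_over)
      have "\<forall>\<^sub>F j in sequentially. ennreal ((F i x)\<^sup>2) - ennreal e \<le> X j x"
        using ev1 ev2
      proof eventually_elim
        case (elim j)
        have "ennreal ((F i x)\<^sup>2) \<le> ennreal (2 * (F i x - F j x)\<^sup>2 + 2 * (F j x)\<^sup>2)"
        proof (rule ennreal_leI)
          have "0 \<le> (F i x - 2 * F j x)\<^sup>2" by simp
          then show "(F i x)\<^sup>2 \<le> 2 * (F i x - F j x)\<^sup>2 + 2 * (F j x)\<^sup>2" by (simp add: power2_eq_square algebra_simps)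
        qed
        also have "\<dots> = 2 * ennreal ((F i x - F j x)\<^sup>2) + 2 * ennreal ((F j x)\<^sup>2)"
          by (subst ennreal_plus) (auto simp: ennreal_mult)
        also have "\<dots> \<le> 2 * ennreal ((F i x - F j x)\<^sup>2) + 2 * (ennreal (r j / 2) + ennreal (2 * a k) * slice_energy \<mu> (1 / 2 ^ j) (\<tau> k) x)"
          using \<eta>(3)[of "1 / 2 ^ j"] elim(2) by (intro add_left_mono mult_left_mono) (auto simp: F_def r_def)
        also have "2 * (ennreal (r j / 2) + ennreal (2 * a k) * slice_energy \<mu> (1 / 2 ^ j) (\<tau> k) x)
          = ennreal (r j) + ennreal (4 * a k) * slice_energy \<mu> (1 / 2 ^ j) (\<tau> k) x"
        proof -
          have "2 * ennreal (r j / 2) = ennreal (2 * (r j / 2))" by (subst ennreal_mult) (auto simp: r_def)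
          moreover have "2 * ennreal (2 * a k) = ennreal (2 * (2 * a k))" using a[of k] by (subst (2) ennreal_mult) auto
          ultimately show ?thesis by (simp add: distrib_left mult.assoc[symmetric])
        qed
        also have "2 * ennreal ((F i x - F j x)\<^sup>2) + (ennreal (r j) + ennreal (4 * a k) * slice_energy \<mu> (1 / 2 ^ j) (\<tau> k) x)
          \<le> 2 * ennreal ((F i x - F j x)\<^sup>2) + (ennreal e + (\<Sum>k. ennreal (4 * a k) * slice_energy \<mu> (1 / 2 ^ j) (\<tau> k) x))"
        proof (intro add_left_mono add_mono)
          show "ennreal (r j) \<le> ennreal e" using elim(1) by (simp add: ennreal_leI)
          show "ennreal (4 * a k) * slice_energy \<mu> (1 / 2 ^ j) (\<tau> k) x \<le> (\<Sum>k. ennreal (4 * a k) * slice_energy \<mu> (1 / 2 ^ j) (\<tau> k) x)"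
            using sum_le_suminf[of "\<lambda>k. ennreal (4 * a k) * slice_energy \<mu> (1 / 2 ^ j) (\<tau> k) x" "{k}"] by simp
        qed
        finally have "ennreal ((F i x)\<^sup>2) \<le> ennreal e + X j x" by (simp add: X_def ac_simps)
        then show ?case by (simp add: ennreal_minus_le_iff)
      qed
      then have "ennreal ((F i x)\<^sup>2) - ennreal e \<le> liminf (\<lambda>j. X j x)" by (rule Liminf_bounded)
      then show "ennreal ((F i x)\<^sup>2) \<le> liminf (\<lambda>j. X j x) + ennreal e"
        by (simp add: ennreal_minus_le_iff add.commute)
    qed
  qed
  have int: "(\<integral>\<^sup>+x. X j x \<partial>plane_bundle) \<le> ennreal (3 * \<epsilon>)" if j: "i \<le> j" for j
  proof -
    have "(\<integral>\<^sup>+x. X j x \<partial>plane_bundle) = 2 * (\<integral>\<^sup>+x. ennreal ((F i x - F j x)\<^sup>2) \<partial>plane_bundle)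
      + (\<Sum>k. ennreal (4 * a k) * (\<integral>\<^sup>+x. slice_energy \<mu> (1 / 2 ^ j) (\<tau> k) x \<partial>plane_bundle))"
      unfolding X_def by (subst nn_integral_add, measurable, subst nn_integral_suminf, measurable) (simp add: nn_integral_cmult)
    also have "\<dots> \<le> 2 * ennreal \<epsilon> + (\<Sum>k. ennreal (4 * a k) * ennreal (S k))"
      unfolding F_def by (intro add_mono mult_left_mono suminf_le diff j energy) auto
    also have "\<dots> \<le> 2 * ennreal \<epsilon> + ennreal \<epsilon>" by (rule add_left_mono[OF sum])
    also have "\<dots> = ennreal (2 * \<epsilon> + \<epsilon>)" using \<epsilon> by (subst ennreal_plus) (auto simp: ennreal_mult)
    also have "2 * \<epsilon> + \<epsilon> = 3 * \<epsilon>" by simp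
    finally show ?thesis .
  qed
  have "(\<integral>\<^sup>+x. ennreal ((F i x)\<^sup>2) * indicator (\<Union>k. thin_slices D C (\<tau> k) (a k)) x \<partial>plane_bundle)
    \<le> (\<integral>\<^sup>+x. liminf (\<lambda>j. X j x) \<partial>plane_bundle)"
    using pt by (intro nn_integral_mono) (auto simp: indicator_def)
  also have "\<dots> \<le> liminf (\<lambda>j. \<integral>\<^sup>+x. X j x \<partial>plane_bundle)"
    by (rule nn_integral_liminf) measurable
  also have "\<dots> \<le> liminf (\<lambda>j::nat. ennreal (3 * \<epsilon>))"
    by (rule Liminf_mono, rule eventually_sequentiallyI[of i]) (rule int)
  also have "\<dots> = ennreal (3 * \<epsilon>)" by (simp add: Liminf_const)
  finally show ?thesis by (simp add: F_def)
qed

lemma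
  fixes \<tau> a :: "nat \<Rightarrow> real"
  assumes D: "countable D"
  shows indicator_thin_slices_measurable:
      "(indicator (\<Union>k. thin_slices D C (\<tau> k) (a k)) :: _ \<Rightarrow> ennreal) \<in> borel_measurable (borel \<Otimes>\<^sub>M \<gamma>)"
      "(indicator (- (\<Union>k. thin_slices D C (\<tau> k) (a k))) :: _ \<Rightarrow> ennreal) \<in> borel_measurable (borel \<Otimes>\<^sub>M \<gamma>)"
proof -
  let ?U = "\<Union>k. thin_slices D C (\<tau> k) (a k)" and ?\<Omega> = "space (borel \<Otimes>\<^sub>M \<gamma>)"
  have "?U \<inter> ?\<Omega> = (\<Union>k. thin_slices D C (\<tau> k) (a k) \<inter> ?\<Omega>)" by auto
  also have "\<dots> \<in> sets (borel \<Otimes>\<^sub>M \<gamma>)"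
    by (rule sets.countable_UN') (auto intro: thin_slices_measurable[OF D])
  finally have U: "?U \<inter> ?\<Omega> \<in> sets (borel \<Otimes>\<^sub>M \<gamma>)" .
  moreover have "- ?U \<inter> ?\<Omega> = ?\<Omega> - ?U \<inter> ?\<Omega>" by auto
  ultimately have "- ?U \<inter> ?\<Omega> \<in> sets (borel \<Otimes>\<^sub>M \<gamma>)" by (simp only: sets.compl_sets)
  with U show "(indicator ?U :: _ \<Rightarrow> ennreal) \<in> borel_measurable (borel \<Otimes>\<^sub>M \<gamma>)"
    "(indicator (- ?U) :: _ \<Rightarrow> ennreal) \<in> borel_measurable (borel \<Otimes>\<^sub>M \<gamma>)"
    by (simp_all only: borel_measurable_indicator_iff)
qed

text \<open>If almost every plane through x has a thin slice, then the thin slices fill the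
  neighbourhood of x in the bundle, because thinness persists under small translations.\<close>

lemma thick_slices_vanish:
  fixes \<tau> a :: "nat \<Rightarrow> real"
  assumes D: "countable D" and AE: "AE V in \<gamma>. \<exists>k. (x, V) \<in> thin_slices D C (\<tau> k) (a k)"
  shows "(\<lambda>j. \<integral>\<^sup>+p. indicator (- (\<Union>k. thin_slices D C (\<tau> k) (a k))) p * ennreal (gauss_kernel m (1 / 2 ^ j) (snd p) (fst p - x)) \<partial>plane_bundle) \<longlonglongrightarrow> 0"
proof -
  define U where "U = (\<Union>k. thin_slices D C (\<tau> k) (a k))"
  note [measurable] = indicator_thin_slices_measurable(2)[OF D, of C \<tau> a, folded U_def]
  define f where "f j V = (\<integral>\<^sup>+y. indicator (- U) (y, V) * ennreal (gauss_kernel m (1 / 2 ^ j) V (y - x)) * ennreal (fiber_weight V y) \<partial>lborel)" for j V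
  interpret L: pair_sigma_finite "lborel :: (real^'n) measure" \<gamma> ..
  have fm[measurable]: "f j \<in> borel_measurable \<gamma>" for j unfolding f_def by measurable
  have eq: "(\<integral>\<^sup>+p. indicator (- U) p * ennreal (gauss_kernel m (1 / 2 ^ j) (snd p) (fst p - x)) \<partial>plane_bundle) = (\<integral>\<^sup>+V. f j V \<partial>\<gamma>)" for j
    unfolding f_def by (subst nn_integral_bundle) auto
  have G: "V \<in> grassmannian (CARD('n) - m)" if "V \<in> space \<gamma>" for V using that by (simp add: space_gamma)
  have fle: "f j V \<le> ennreal gauss_const" if V: "V \<in> space \<gamma>" for j V
  proof -
    have "f j V \<le> (\<integral>\<^sup>+y. ennreal (gauss_kernel m (1 / 2 ^ j) V (y - x) * fiber_weight V y) \<partial>lborel)"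
      unfolding f_def by (intro nn_integral_mono) (auto simp: indicator_def ennreal_mult)
    also have "\<dots> = ennreal gauss_const"
      unfolding gauss_const_def using m by (intro nn_integral_gauss_kernel_fiber_weight G V) auto
    finally show ?thesis .
  qed
  have lim: "(\<lambda>j. f j V) \<longlonglongrightarrow> 0" if V: "V \<in> space \<gamma>" "(x, V) \<in> U" for V
  proof -
    obtain k where "(x, V) \<in> thin_slices D C (\<tau> k) (a k)" using V(2) by (auto simp: U_def)
    then obtain \<eta> where \<eta>: "0 < \<eta>" "\<And>y. infdist (y - x) V < \<eta> \<Longrightarrow> (y, V) \<in> thin_slices D C (\<tau> k) (a k)"
      using thin_slices_open[OF subspace_gamma[OF V(1)]] by blast
    \<comment> \<open>Half of the Gaussian decay becomes a factor uniform at distance at least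
      \<eta> from the plane; the other half is kept as a kernel of width
      \<open>sqrt 2 * (1 / 2 ^ j)\<close>, whose mass is \<open>gauss_const\<close>.\<close>
    define q where "q j = sqrt 2 ^ m * exp (- (\<eta>\<^sup>2 / 4) * 4 ^ j)" for j :: nat
    have fq: "f j V \<le> ennreal (q j * gauss_const)" for j
    proof -
      have "f j V \<le> (\<integral>\<^sup>+y. ennreal (q j) * ennreal (gauss_kernel m (sqrt 2 * (1 / 2 ^ j)) V (y - x) * fiber_weight V y) \<partial>lborel)"
        unfolding f_def
      proof (rule nn_integral_mono)
        fix y
        show "indicator (- U) (y, V) * ennreal (gauss_kernel m (1 / 2 ^ j) V (y - x)) * ennreal (fiber_weight V y)
          \<le> ennreal (q j) * ennreal (gauss_kernel m (sqrt 2 * (1 / 2 ^ j)) V (y - x) * fiber_weight V y)"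
        proof (cases "(y, V) \<in> U")
          case False
          then have "\<eta> \<le> infdist (y - x) V" using \<eta>(2)[of y] by (force simp: U_def)
          then have sq: "\<eta>\<^sup>2 \<le> (infdist (y - x) V)\<^sup>2" using \<eta>(1) by (intro power_mono) auto
          define w where "w = (infdist (y - x) V)\<^sup>2"
          have 4: "((2::real) ^ j)\<^sup>2 = 4 ^ j" by (simp add: power_mult_distrib[symmetric] power2_eq_square)
          have e1: "gauss_kernel m (1 / 2 ^ j) V (y - x) = exp (- (w / 2) * 4 ^ j) * (2 ^ j) ^ m"
            by (simp add: gauss_kernel_def w_def power_divide 4 power_one_over)
          have e2: "sqrt 2 ^ m * gauss_kernel m (sqrt 2 * (1 / 2 ^ j)) V (y - x) = exp (- (w / 4) * 4 ^ j) * (2 ^ j) ^ m"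
            by (simp add: gauss_kernel_def w_def power_divide power_mult_distrib 4 power_one_over)
          have "exp (- (w / 2) * 4 ^ j) \<le> exp (- (\<eta>\<^sup>2 / 4) * 4 ^ j) * exp (- (w / 4) * 4 ^ j)"
          proof -
            have "\<eta>\<^sup>2 / 4 * 4 ^ j \<le> w / 4 * 4 ^ j" using sq by (simp add: w_def)
            then have "- (w / 2) * 4 ^ j \<le> - (\<eta>\<^sup>2 / 4) * 4 ^ j + - (w / 4) * 4 ^ j"
              by (simp add: field_simps)
            then show ?thesis by (subst exp_add[symmetric]) simp
          qed
          then have "exp (- (w / 2) * 4 ^ j) * (2 ^ j) ^ m \<le> exp (- (\<eta>\<^sup>2 / 4) * 4 ^ j) * exp (- (w / 4) * 4 ^ j) * (2 ^ j) ^ m"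
            by (intro mult_right_mono) auto
          then have "gauss_kernel m (1 / 2 ^ j) V (y - x) \<le> q j * gauss_kernel m (sqrt 2 * (1 / 2 ^ j)) V (y - x)"
            unfolding e1 q_def mult.assoc e2[symmetric] by (simp only: mult_ac)
          then have "gauss_kernel m (1 / 2 ^ j) V (y - x) * fiber_weight V y
            \<le> q j * gauss_kernel m (sqrt 2 * (1 / 2 ^ j)) V (y - x) * fiber_weight V y"
            by (intro mult_right_mono) auto
          then show ?thesis using False
            by (simp add: q_def ennreal_leI mult.assoc flip: ennreal_mult)
        qed simp
      qed
      also have "\<dots> = ennreal (q j) * (\<integral>\<^sup>+y. ennreal (gauss_kernel m (sqrt 2 * (1 / 2 ^ j)) V (y - x) * fiber_weight V y) \<partial>lborel)"
        using V(1) by (intro nn_integral_cmult) measurable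
      also have "(\<integral>\<^sup>+y. ennreal (gauss_kernel m (sqrt 2 * (1 / 2 ^ j)) V (y - x) * fiber_weight V y) \<partial>lborel) = ennreal gauss_const"
        unfolding gauss_const_def using m by (intro nn_integral_gauss_kernel_fiber_weight G V) auto
      also have "ennreal (q j) * ennreal gauss_const = ennreal (q j * gauss_const)"
        using gauss_const_pos by (intro ennreal_mult[symmetric]) (auto simp: q_def)
      finally show ?thesis .
    qed
    have "(\<lambda>j. exp (- (\<eta>\<^sup>2 / 4) * 4 ^ j) * (4 ^ j) ^ 0) \<longlonglongrightarrow> 0" using \<eta>(1) by (intro exp_power4_tendsto_0) simp
    then have "(\<lambda>j. sqrt 2 ^ m * (exp (- (\<eta>\<^sup>2 / 4) * 4 ^ j) * (4 ^ j) ^ 0) * gauss_const) \<longlonglongrightarrow> sqrt 2 ^ m * 0 * gauss_const"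
      by (intro tendsto_intros)
    then have "(\<lambda>j. q j * gauss_const) \<longlonglongrightarrow> 0" by (simp add: q_def)
    then have "(\<lambda>j. ennreal (q j * gauss_const)) \<longlonglongrightarrow> ennreal 0" by (rule tendsto_ennrealI)
    then have lim0: "(\<lambda>j. ennreal (q j * gauss_const)) \<longlonglongrightarrow> 0" by simp
    show ?thesis
      by (rule tendsto_sandwich[OF _ _ tendsto_const lim0]) (auto intro: always_eventually fq)
  qed
  have "(\<lambda>j. \<integral>\<^sup>+V. f j V \<partial>\<gamma>) \<longlonglongrightarrow> (\<integral>\<^sup>+V. 0 \<partial>\<gamma>)"
  proof (rule nn_integral_dominated_convergence[where w = "\<lambda>_. ennreal gauss_const"])
    show "AE V in \<gamma>. (\<lambda>j. f j V) \<longlonglongrightarrow> 0"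
      using AE AE_space by eventually_elim (rule lim, auto simp: U_def)
    show "AE V in \<gamma>. f j V \<le> ennreal gauss_const" for j using AE_space by eventually_elim (rule fle)
    have "(\<integral>\<^sup>+V. ennreal gauss_const \<partial>\<gamma>) = ennreal gauss_const" by (simp only: nn_integral_const emeasure_space_1 mult_1_right)
    then show "(\<integral>\<^sup>+V. ennreal gauss_const \<partial>\<gamma>) < \<infinity>" by (simp only:) (rule ennreal_less_top[folded infinity_ennreal_def])
    show "f j \<in> borel_measurable \<gamma>" for j by (rule fm)
  qed (rule fm borel_measurable_const)+
  then show ?thesis by (simp only: U_def[symmetric] eq nn_integral_const mult_zero_left)
qed

text \<open>The averaged kernel is at most K times the distance to the power -m, so weight and
  kernel combine into a Riesz kernel of order t + m, which is below the growth exponent s. The case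
  t = 0 gives the plain energy.\<close>

lemma weighted_energy_le:
  fixes \<mu> \<nu> :: "(real^'n) measure"
  assumes s: "sets \<mu> = sets borel" "sets \<nu> = sets borel" and fin: "finite_measure \<mu>" "finite_measure \<nu>"
    and K: "0 \<le> K" "\<And>a z. 0 < a \<Longrightarrow> kernel_avg a z \<le> ennreal (K / (max a (norm z)) ^ m)"
    and t: "0 \<le> t" "t + real m < s" and c: "0 \<le> c"
    and growth: "AE x in \<nu>. \<forall>k\<le>j. emeasure \<mu> (cball x (1 / 2 ^ k)) \<le> ennreal (c * (1 / 2 ^ k) powr s)"
    and total: "emeasure \<mu> UNIV \<le> ennreal c" and \<tau>: "1 / 2 ^ j \<le> \<tau>"
  shows "(\<integral>\<^sup>+p. ennreal ((max (1 / 2 ^ j) (dist (fst p) (snd p))) powr - t) * kernel_avg \<tau> (fst p - snd p) \<partial>(\<nu> \<Otimes>\<^sub>M \<mu>))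
    \<le> ennreal (K * c * riesz_const (t + real m) s) * emeasure \<nu> UNIV"
proof -
  interpret M: finite_measure \<mu> by fact
  interpret N: finite_measure \<nu> by fact
  note [measurable_cong] = s
  let ?r = "\<lambda>p :: (real^'n) \<times> (real^'n). max (1 / 2 ^ j) (dist (fst p) (snd p))"
  have "(\<integral>\<^sup>+p. ennreal (?r p powr - t) * kernel_avg \<tau> (fst p - snd p) \<partial>(\<nu> \<Otimes>\<^sub>M \<mu>))
    \<le> (\<integral>\<^sup>+p. ennreal K * ennreal (?r p powr - (t + real m)) \<partial>(\<nu> \<Otimes>\<^sub>M \<mu>))"
  proof (rule nn_integral_mono)
    fix p :: "(real^'n) \<times> (real^'n)"
    have "0 < (1::real) / 2 ^ j" by simp
    then have r: "0 < ?r p" by (rule less_le_trans) (rule max.cobounded1)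
    have "0 < (1::real) / 2 ^ j" by simp
    then have \<tau>0: "0 < \<tau>" using \<tau> by (rule less_le_trans)
    have "kernel_avg \<tau> (fst p - snd p) \<le> ennreal (K / (max \<tau> (norm (fst p - snd p))) ^ m)" by (rule K(2)[OF \<tau>0])
    also have "\<dots> \<le> ennreal (K / ?r p ^ m)"
      using r \<tau> \<tau>0 K(1) by (intro ennreal_leI divide_left_mono power_mono mult_pos_pos zero_less_power) (auto simp: dist_norm)
    also have "K / ?r p ^ m = K * ?r p powr - real m"
      using r by (simp add: powr_minus powr_realpow divide_inverse)
    finally have "ennreal (?r p powr - t) * kernel_avg \<tau> (fst p - snd p) \<le> ennreal (?r p powr - t) * ennreal (K * ?r p powr - real m)"
      by (rule mult_left_mono) simp
    also have "\<dots> = ennreal (?r p powr - t * (K * ?r p powr - real m))"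
      using K(1) by (intro ennreal_mult[symmetric]) auto
    also have "?r p powr - t * (K * ?r p powr - real m) = K * ?r p powr - (t + real m)"
      using r by (simp add: powr_add powr_minus algebra_simps powr_diff divide_inverse)
    also have "ennreal \<dots> = ennreal K * ennreal (?r p powr - (t + real m))"
      using K(1) by (intro ennreal_mult) auto
    finally show "ennreal (?r p powr - t) * kernel_avg \<tau> (fst p - snd p) \<le> ennreal K * ennreal (?r p powr - (t + real m))" .
  qed
  also have "\<dots> = ennreal K * (\<integral>\<^sup>+p. ennreal (?r p powr - (t + real m)) \<partial>(\<nu> \<Otimes>\<^sub>M \<mu>))"
    by (rule nn_integral_cmult) measurable
  also have "\<dots> \<le> ennreal K * (ennreal (c * riesz_const (t + real m) s) * emeasure \<nu> UNIV)"
    using t by (intro mult_left_mono riesz_energy_bound s fin c growth total) auto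
  also have "\<dots> = ennreal (K * c * riesz_const (t + real m) s) * emeasure \<nu> UNIV"
    using K(1) c riesz_const_nonneg[OF t(2)] by (simp add: ennreal_mult mult.assoc)
  finally show ?thesis .
qed

lemma energy_le:
  fixes \<mu> \<nu> :: "(real^'n) measure"
  assumes s: "sets \<mu> = sets borel" "sets \<nu> = sets borel" and fin: "finite_measure \<mu>" "finite_measure \<nu>"
    and K: "0 \<le> K" "\<And>a z. 0 < a \<Longrightarrow> kernel_avg a z \<le> ennreal (K / (max a (norm z)) ^ m)"
    and sm: "real m < s" and c: "0 \<le> c"
    and growth: "AE x in \<nu>. \<forall>k\<le>j. emeasure \<mu> (cball x (1 / 2 ^ k)) \<le> ennreal (c * (1 / 2 ^ k) powr s)"
    and total: "emeasure \<mu> UNIV \<le> ennreal c" and \<tau>: "1 / 2 ^ j \<le> \<tau>"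
  shows "energy \<nu> \<mu> \<tau> \<le> ennreal (K * c * riesz_const (real m) s) * emeasure \<nu> UNIV"
proof -
  have "(max (1 / 2 ^ j) r) powr - 0 = 1" for r :: real
  proof -
    have "0 < (1::real) / 2 ^ j" by simp
    then have "max (1 / 2 ^ j) r \<noteq> 0" by linarith
    then show ?thesis by simp
  qed
  then show ?thesis
    using weighted_energy_le[OF s fin K, of 0 s c j \<tau>] sm c growth total \<tau> by (simp add: energy_def)
qed

text \<open>The contradiction: Frostman measures on the finite stages of B see smeared densities of mu
  only through thick slices, whereas the pairing of the two smeared densities is bounded below.\<close>

lemma exceptional_set_null:
  fixes B C :: "(real^'n) set" and \<tau> :: "nat \<Rightarrow> real"
  assumes s: "sets \<mu> = sets borel" and fin: "finite_measure \<mu>" and C: "compact C" "emeasure \<mu> (- C) = 0"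
    and pos: "0 < emeasure \<mu> UNIV" and c: "0 \<le> c"
    and growth: "\<And>x k. x \<in> C \<Longrightarrow> emeasure \<mu> (cball x (1 / 2 ^ k)) \<le> ennreal (c * (1 / 2 ^ k) powr s)"
    and total: "emeasure \<mu> UNIV \<le> ennreal c" and sm: "real m < s"
    and D: "countable D" and \<tau>: "\<And>k. 0 \<le> \<tau> k" "\<And>k. \<tau> k < s - real m"
    and B: "bounded B" and t: "real m < t"
    and bad: "\<And>x. x \<in> B \<Longrightarrow> AE V in \<gamma>. \<exists>k. \<forall>a>0. (x, V) \<in> thin_slices D C (\<tau> k) a"
  shows "dyadic_content t B = 0"
proof (rule ccontr)
  assume "dyadic_content t B \<noteq> 0"
  then have "0 < dyadic_content t B" by (simp add: zero_less_iff_neq_zero)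
  \<comment> \<open>A positive real strictly below the content, so that one of the stages
    \<open>E J\<close> must exceed it.\<close>
  then obtain b' where b': "0 < b'" "b' < dyadic_content t B" using dense by blast
  moreover from b'(2) have "b' < top" by (rule less_le_trans) simp
  ultimately obtain b where b: "0 < b" "ennreal b < dyadic_content t B"
    by (cases b') auto
  interpret M: finite_measure \<mu> by fact
  have Cb: "C \<in> sets borel" using C(1) by (simp add: borel_compact)
  have sp: "space \<mu> = UNIV" using sets_eq_imp_space_eq[OF s] by simp
  have AEC: "AE x in \<mu>. x \<in> C" using C(2) Cb s by (intro AE_I[where N = "- C"]) auto
  define M where "M = measure \<mu> UNIV"
  have M: "emeasure \<mu> UNIV = ennreal M" "0 < M"
    using pos by (auto simp: M_def M.emeasure_eq_measure)
  obtain N where N: "0 \<le> N" "\<And>t j (E :: (real^'n) set). bounded E \<Longrightarrow> \<exists>\<nu>. sets \<nu> = sets borel \<and> finite_measure \<nu> \<and>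
      (AE x in \<nu>. x \<in> E) \<and> dyadic_content t E \<le> emeasure \<nu> UNIV \<and> emeasure \<nu> UNIV \<le> ennreal (real (card (dyadic_index 0 ` E))) \<and>
      (\<forall>x. \<forall>k\<le>j. emeasure \<nu> (cball x (1 / 2 ^ k)) \<le> ennreal (N * (1 / 2 ^ k) powr t))"
    using dyadic_frostman by blast
  obtain K where K1: "1 \<le> K" and K2: "\<And>a z. 0 < a \<Longrightarrow> kernel_avg a z \<le> ennreal (K / (max a (norm z)) ^ m)"
    using kernel_avg_upper by blast
  have K0: "0 \<le> K" using K1 by simp
  have "bounded (B \<union> C)" using B C(1) compact_imp_bounded by auto
  then obtain R where R: "0 < R" "\<And>x. x \<in> B \<union> C \<Longrightarrow> norm x \<le> R" by (auto simp: bounded_pos)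
  obtain l where l: "0 < l" "\<And>a z. 0 < a \<Longrightarrow> a \<le> 1 \<Longrightarrow> norm z \<le> 2 * R \<Longrightarrow> ennreal l \<le> kernel_avg a z"
    using kernel_avg_lower[of "2 * R"] R(1) by auto
  define cB where "cB = real (card (dyadic_index 0 ` B))"
  have energy_mu: "energy \<mu> \<mu> u \<le> ennreal (K * c * riesz_const (real m) s * M)" if u: "0 < u" for u
  proof -
    obtain j where j: "(1 / 2) ^ j < u" using real_arch_pow_inv[OF u, of "1/2"] by auto
    have "energy \<mu> \<mu> u \<le> ennreal (K * c * riesz_const (real m) s) * emeasure \<mu> UNIV"
    proof (rule energy_le[OF s s fin fin K0 K2 sm c _ total])
      show "AE x in \<mu>. \<forall>k\<le>j. emeasure \<mu> (cball x (1 / 2 ^ k)) \<le> ennreal (c * (1 / 2 ^ k) powr s)"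
        using AEC by eventually_elim (auto intro: growth)
      show "1 / 2 ^ j \<le> u" using j by (simp add: power_one_over)
    qed
    then show ?thesis using K0 c riesz_const_nonneg[OF sm] M by (simp add: ennreal_mult)
  qed
  \<comment> \<open>Bound for the integrated slice energies at exponent \<open>\<tau> k\<close>, the
    same at every scale.\<close>
  define S where "S k = gauss_const * (K * c * riesz_const (\<tau> k + real m) s * M)" for k
  have S0: "0 \<le> S k" for k
    unfolding S_def using gauss_const_pos K0 c riesz_const_nonneg[of "\<tau> k + real m" s] \<tau>(2)[of k] M(2) by simp
  have energy_slice: "(\<integral>\<^sup>+x. slice_energy \<mu> (1 / 2 ^ j) (\<tau> k) x \<partial>plane_bundle) \<le> ennreal (S k)" for k j
  proof -
    define \<delta> :: real where "\<delta> = 1 / 2 ^ j"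
    have \<delta>: "0 < \<delta>" by (simp add: \<delta>_def)
    have "(\<integral>\<^sup>+x. slice_energy \<mu> \<delta> (\<tau> k) x \<partial>plane_bundle)
      = ennreal gauss_const * (\<integral>\<^sup>+p. ennreal ((max \<delta> (dist (fst p) (snd p))) powr - \<tau> k) * kernel_avg (sqrt (\<delta>\<^sup>2 + \<delta>\<^sup>2)) (fst p - snd p) \<partial>(\<mu> \<Otimes>\<^sub>M \<mu>))"
      unfolding slice_energy_def by (rule nn_integral_bundle_weighted_pairs[OF s s fin fin \<delta> \<delta>]) measurable
    also have "\<dots> \<le> ennreal gauss_const * (ennreal (K * c * riesz_const (\<tau> k + real m) s) * emeasure \<mu> UNIV)"
      unfolding \<delta>_def
    proof (intro mult_left_mono weighted_energy_le[OF s s fin fin K0 K2 \<tau>(1) _ c _ total])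
      show "AE x in \<mu>. \<forall>i\<le>j. emeasure \<mu> (cball x (1 / 2 ^ i)) \<le> ennreal (c * (1 / 2 ^ i) powr s)"
        using AEC by eventually_elim (auto intro: growth)
      show "\<tau> k + real m < s" using \<tau>(2)[of k] by simp
      show "(1::real) / 2 ^ j \<le> sqrt ((1 / 2 ^ j)\<^sup>2 + (1 / 2 ^ j)\<^sup>2)" by (rule real_le_rsqrt) simp
    qed auto
    also have "\<dots> = ennreal (S k)"
      using gauss_const_pos K0 c riesz_const_nonneg[of "\<tau> k + real m" s] \<tau>(2)[of k] M
      by (simp add: S_def ennreal_mult)
    finally show ?thesis by (simp add: \<delta>_def)
  qed
  define c' where "c' = max N cB"
  have c': "0 \<le> c'" "N \<le> c'" "cB \<le> c'" using N(1) by (auto simp: c'_def)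
  \<comment> \<open>Bound for the square mean of the smeared \<open>\<nu>\<close>, uniform over the
    scale j and the stage J, neither of which is chosen yet.\<close>
  define W where "W = gauss_const * (K * c' * riesz_const (real m) t * cB)"
  have W0: "0 \<le> W" unfolding W_def using gauss_const_pos K0 c' riesz_const_nonneg[OF t] by (simp add: cB_def)
  \<comment> \<open>Lower bound for the pairing: \<open>\<mu>\<close> has mass M,
    \<open>\<nu>\<close> has mass above b, and the averaged kernel is at least l on their
    supports.\<close>
  define T where "T = gauss_const * (l * M * b)"
  have T: "0 < T" using gauss_const_pos l M(2) b by (simp add: T_def)
  \<comment> \<open>The constants depend on each other in the order \<rho>, \<epsilon>, i, a and
    \<kappa>, J, j, \<open>\<nu>\<close>. This one is the weight in the inequality
    \<open>amgm\<close>, so large that the square mean of the smeared \<open>\<nu>\<close>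
    contributes at most T / 4.\<close>
  define \<rho> where "\<rho> = 4 * W / T + 1"
  have \<rho>: "0 < \<rho>" "W / \<rho> \<le> T / 4"
  proof -
    have "0 \<le> 4 * W / T" using W0 T by simp
    then show "0 < \<rho>" by (simp add: \<rho>_def)
    moreover have "4 * W \<le> T * \<rho>" using T by (simp add: \<rho>_def field_simps)
    ultimately show "W / \<rho> \<le> T / 4" by (simp add: field_simps)
  qed
  \<comment> \<open>The two terms with weight \<open>\<rho> / 2\<close>, of sizes \<epsilon> and
    \<open>3 * \<epsilon>\<close>, then add up to T / 4.\<close>
  define \<epsilon> where "\<epsilon> = T / (8 * \<rho>)"
  have \<epsilon>: "0 < \<epsilon>" "2 * \<rho> * \<epsilon> = T / 4" using T \<rho> by (auto simp: \<epsilon>_def field_simps)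
  obtain d where d: "0 < d" "\<And>a b. 0 < a \<Longrightarrow> a < d \<Longrightarrow> 0 < b \<Longrightarrow> b < d \<Longrightarrow>
    (\<integral>\<^sup>+x. ennreal ((smear \<mu> a x - smear \<mu> b x)\<^sup>2) \<partial>plane_bundle) \<le> ennreal \<epsilon>"
    using smear_Cauchy[OF s fin energy_mu \<epsilon>(1)] by blast
  obtain i where "(1 / 2) ^ i < d" using real_arch_pow_inv[OF d(1), of "1/2"] by auto
  then have i: "1 / 2 ^ i < d" by (simp add: power_one_over)
  have diff: "(\<integral>\<^sup>+x. ennreal ((smear \<mu> (1 / 2 ^ i) x - smear \<mu> (1 / 2 ^ j) x)\<^sup>2) \<partial>plane_bundle) \<le> ennreal \<epsilon>" if "i \<le> j" for j
  proof (rule d(2))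
    have "(1::real) / 2 ^ j \<le> 1 / 2 ^ i" using that by (intro divide_left_mono power_increasing) auto
    then show "1 / 2 ^ j < d" using i by simp
  qed (use i in auto)
  \<comment> \<open>Thresholds small against the energies \<open>S k\<close>, with a geometric
    factor for the sum over k. They may be this small because an exceptional plane is thin, for some
    k, at every threshold.\<close>
  define a where "a k = \<epsilon> * (1 / 2) ^ Suc k / (4 * (S k + 1))" for k
  have a: "0 < a k" for k using \<epsilon>(1) S0[of k] by (simp add: a_def)
  have asum: "(\<Sum>k. ennreal (4 * a k) * ennreal (S k)) \<le> ennreal \<epsilon>"
  proof -
    have "(\<Sum>k. ennreal (4 * a k) * ennreal (S k)) \<le> (\<Sum>k. ennreal (\<epsilon> * (1 / 2) ^ Suc k))"
    proof (intro suminf_le)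
      fix k
      have "4 * a k * S k = \<epsilon> * (1 / 2) ^ Suc k * (S k / (S k + 1))"
        unfolding a_def by (simp only: times_divide_eq_left times_divide_eq_right mult_divide_mult_cancel_left_if) (simp add: mult_ac)
      also have "\<dots> \<le> \<epsilon> * (1 / 2) ^ Suc k * 1" using S0[of k] \<epsilon>(1) by (intro mult_left_mono) auto
      finally show "ennreal (4 * a k) * ennreal (S k) \<le> ennreal (\<epsilon> * (1 / 2) ^ Suc k)"
        using a[of k] S0[of k] by (subst ennreal_mult[symmetric]) (auto intro: ennreal_leI)
    qed auto
    also have "\<dots> = ennreal (\<Sum>k. \<epsilon> * (1 / 2) ^ Suc k)"
      using \<epsilon>(1) by (intro suminf_ennreal2 summable_mult) (auto simp: summable_Suc_iff summable_geometric)
    also have "(\<Sum>k. \<epsilon> * (1 / 2) ^ Suc k) = \<epsilon>"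
      using power_half_series sums_unique suminf_mult[of "\<lambda>k. (1 / 2 :: real) ^ Suc k" \<epsilon>] by (simp add: sums_iff)
    finally show ?thesis .
  qed
  define U where "U = (\<Union>k. thin_slices D C (\<tau> k) (a k))"
  have thinF: "(\<integral>\<^sup>+x. ennreal ((smear \<mu> (1 / 2 ^ i) x)\<^sup>2) * indicator U x \<partial>plane_bundle) \<le> ennreal (3 * \<epsilon>)"
    unfolding U_def using \<epsilon>(1) a less_imp_le
    by (intro smear_integral_thin_slices[OF s fin C(2) Cb D \<tau>(1) _ diff energy_slice asum]) auto
  define L where "L = M * (2 ^ i) ^ m"
  have L: "0 < L" "smear \<mu> (1 / 2 ^ i) x \<le> L" for x
    using smear_le[OF s fin, of "1 / 2 ^ i" x] M(2) by (auto simp: L_def M_def power_one_over)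
  define \<psi> where "\<psi> j x = (\<integral>\<^sup>+p. indicator (- U) p * ennreal (gauss_kernel m (1 / 2 ^ j) (snd p) (fst p - x)) \<partial>plane_bundle)" for j x
  define \<kappa> where "\<kappa> = T / (4 * L * (cB + 1))"
  have cB0: "0 \<le> cB" by (simp add: cB_def)
  have \<kappa>: "0 < \<kappa>" using T L(1) cB0 by (simp add: \<kappa>_def)
  have \<psi>lim: "(\<lambda>j. \<psi> j x) \<longlonglongrightarrow> 0" if "x \<in> B" for x
    unfolding \<psi>_def U_def
  proof (rule thick_slices_vanish[OF D])
    show "AE V in \<gamma>. \<exists>k. (x, V) \<in> thin_slices D C (\<tau> k) (a k)"
      using bad[OF that] by eventually_elim (use a in blast)
  qed
  \<comment> \<open>Points whose thick pencils are uniformly small from J on. These sets increase to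
    B, so by the increasing sets lemma one of them keeps content above b, measurable or not.\<close>
  define E where "E J = {x \<in> B. \<forall>j\<ge>J. \<psi> j x \<le> ennreal \<kappa>}" for J
  have "incseq E" by (rule incseq_SucI) (auto simp: E_def)
  moreover have "(\<Union>J. E J) = B"
  proof (intro equalityI subsetI)
    fix x assume x: "x \<in> B"
    have "0 < ennreal \<kappa>" using \<kappa> by simp
    from order_tendstoD(2)[OF \<psi>lim[OF x] this] obtain J where "\<And>j. J \<le> j \<Longrightarrow> \<psi> j x < ennreal \<kappa>"
      by (auto simp: eventually_sequentially)
    then have "x \<in> E J" using x by (auto simp: E_def intro: less_imp_le)
    then show "x \<in> (\<Union>J. E J)" by blast
  qed (auto simp: E_def)
  ultimately have "\<exists>J. \<not> dyadic_content t (E J) \<le> ennreal b"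
    using dyadic_content_incseq_le[of E t "ennreal b"] b(2) by (metis not_le)
  then obtain J where J: "ennreal b < dyadic_content t (E J)" by (auto simp: not_le)
  \<comment> \<open>Beyond i for the Cauchy estimate and beyond J for \<open>E J\<close>; the
    successor gives \<open>\<delta> \<le> 1 / 2\<close>, so that the combined scale
    \<open>?\<tau>\<close> is at most 1, as the lower kernel bound requires.\<close>
  define j where "j = Suc (max i J)"
  have EB: "E J \<subseteq> B" by (auto simp: E_def)
  have "bounded (E J)" using B EB by (rule bounded_subset)
  from N(2)[OF this, of t j] obtain \<nu> where \<nu>: "sets \<nu> = sets borel" "finite_measure \<nu>" "AE x in \<nu>. x \<in> E J"
    "dyadic_content t (E J) \<le> emeasure \<nu> UNIV" "emeasure \<nu> UNIV \<le> ennreal (real (card (dyadic_index 0 ` E J)))"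
    "\<And>x k. k \<le> j \<Longrightarrow> emeasure \<nu> (cball x (1 / 2 ^ k)) \<le> ennreal (N * (1 / 2 ^ k) powr t)"
    by blast
  interpret V: finite_measure \<nu> by (rule \<nu>(2))
  interpret MV: pair_sigma_finite \<mu> \<nu> ..
  note [measurable_cong] = s \<nu>(1)
  have sp\<nu>: "space \<nu> = UNIV" using sets_eq_imp_space_eq[OF \<nu>(1)] by simp
  have "card (dyadic_index 0 ` E J) \<le> card (dyadic_index 0 ` B)"
    using EB finite_dyadic_index[OF B] by (intro card_mono image_mono) auto
  then have \<nu>cB: "emeasure \<nu> UNIV \<le> ennreal cB"
    using \<nu>(5) by (intro order_trans[OF \<nu>(5)] ennreal_leI) (simp add: cB_def)
  define \<delta> :: real where "\<delta> = 1 / 2 ^ j"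
  have \<delta>: "0 < \<delta>" "\<delta> \<le> 1 / 2"
    by (auto simp: \<delta>_def j_def divide_simps one_le_power)
  define F where "F = smear \<mu> \<delta>"
  define Fi where "Fi = smear \<mu> (1 / 2 ^ i)"
  define G where "G = smear \<nu> \<delta>"
  have nn: "0 \<le> F x" "0 \<le> Fi x" "0 \<le> G x" for x
    using \<delta> by (auto simp: F_def Fi_def G_def intro!: smear_nonneg)
  have [measurable]: "F \<in> borel_measurable (borel \<Otimes>\<^sub>M \<gamma>)" "Fi \<in> borel_measurable (borel \<Otimes>\<^sub>M \<gamma>)" "G \<in> borel_measurable (borel \<Otimes>\<^sub>M \<gamma>)"
    unfolding F_def Fi_def G_def by (intro smear_measurable s fin \<nu>(1,2))+
  note [measurable] = indicator_thin_slices_measurable[OF D, of C \<tau> a, folded U_def]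
  let ?\<tau> = "sqrt (\<delta>\<^sup>2 + \<delta>\<^sup>2)"
  have \<tau>1: "0 < ?\<tau>" "?\<tau> \<le> 1" "\<delta> \<le> ?\<tau>"
  proof -
    show "0 < ?\<tau>" using \<delta> by (simp add: add_pos_pos)
    have "\<delta>\<^sup>2 \<le> (1 / 2)\<^sup>2" using \<delta> by (intro power_mono) auto
    then show "?\<tau> \<le> 1" by (intro real_le_lsqrt) (auto simp: power2_eq_square)
    show "\<delta> \<le> ?\<tau>" by (rule real_le_rsqrt) simp
  qed
  have lower: "ennreal T \<le> (\<integral>\<^sup>+x. ennreal (F x * G x) \<partial>plane_bundle)"
  proof -
    have "energy \<mu> \<nu> ?\<tau> = (\<integral>\<^sup>+z. (\<integral>\<^sup>+w. kernel_avg ?\<tau> (z - w) \<partial>\<nu>) \<partial>\<mu>)"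
      unfolding energy_def by (subst V.nn_integral_fst[symmetric]) auto
    moreover have "(\<integral>\<^sup>+z. (\<integral>\<^sup>+w. ennreal l \<partial>\<nu>) \<partial>\<mu>) \<le> (\<integral>\<^sup>+z. (\<integral>\<^sup>+w. kernel_avg ?\<tau> (z - w) \<partial>\<nu>) \<partial>\<mu>)"
    proof (rule nn_integral_mono_AE, use AEC in eventually_elim)
      fix z assume z: "z \<in> C"
      show "(\<integral>\<^sup>+w. ennreal l \<partial>\<nu>) \<le> (\<integral>\<^sup>+w. kernel_avg ?\<tau> (z - w) \<partial>\<nu>)"
      proof (rule nn_integral_mono_AE, use \<nu>(3) in eventually_elim)
        fix w assume "w \<in> E J"
        then have "norm (z - w) \<le> norm z + norm w" "norm z \<le> R" "norm w \<le> R"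
          using z EB R(2) by (auto intro: norm_triangle_ineq4)
        then show "ennreal l \<le> kernel_avg ?\<tau> (z - w)" using \<tau>1 by (intro l(2)) auto
      qed
    qed
    ultimately have "ennreal l * emeasure \<nu> UNIV * emeasure \<mu> UNIV \<le> energy \<mu> \<nu> ?\<tau>" by (simp add: sp sp\<nu>)
    moreover have "ennreal l * ennreal b * ennreal M \<le> ennreal l * emeasure \<nu> UNIV * emeasure \<mu> UNIV"
      using J \<nu>(4) M(1) by (intro mult_mono) auto
    ultimately have "ennreal gauss_const * (ennreal l * ennreal b * ennreal M) \<le> ennreal gauss_const * energy \<mu> \<nu> ?\<tau>"
      by (intro mult_left_mono) auto
    also have "\<dots> = (\<integral>\<^sup>+x. ennreal (F x * G x) \<partial>plane_bundle)"
      unfolding F_def G_def by (rule smear_pairing[OF s \<nu>(1) fin \<nu>(2) \<delta>(1) \<delta>(1), symmetric])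
    also have "ennreal gauss_const * (ennreal l * ennreal b * ennreal M) = ennreal T"
      unfolding T_def using gauss_const_pos l(1) b(1) M(2) by (simp add: mult_ac flip: ennreal_mult)
    finally show ?thesis .
  qed
  have GG: "(\<integral>\<^sup>+x. ennreal (G x * G x) \<partial>plane_bundle) \<le> ennreal W"
  proof -
    have "energy \<nu> \<nu> ?\<tau> \<le> ennreal (K * c' * riesz_const (real m) t) * emeasure \<nu> UNIV"
    proof (rule energy_le[OF \<nu>(1) \<nu>(1) \<nu>(2) \<nu>(2) K0 K2 t c'(1)])
      show "AE x in \<nu>. \<forall>k\<le>j. emeasure \<nu> (cball x (1 / 2 ^ k)) \<le> ennreal (c' * (1 / 2 ^ k) powr t)"
      proof (intro AE_I2 allI impI)
        fix x k assume "k \<le> j"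
        then have "emeasure \<nu> (cball x (1 / 2 ^ k)) \<le> ennreal (N * (1 / 2 ^ k) powr t)" by (rule \<nu>(6))
        also have "\<dots> \<le> ennreal (c' * (1 / 2 ^ k) powr t)" using c'(2) by (intro ennreal_leI mult_right_mono) auto
        finally show "emeasure \<nu> (cball x (1 / 2 ^ k)) \<le> ennreal (c' * (1 / 2 ^ k) powr t)" .
      qed
      show "emeasure \<nu> UNIV \<le> ennreal c'" using \<nu>cB ennreal_leI[OF c'(3)] by (rule order_trans)
      show "1 / 2 ^ j \<le> ?\<tau>" using \<tau>1(3) by (simp add: \<delta>_def)
    qed
    also have "\<dots> \<le> ennreal (K * c' * riesz_const (real m) t) * ennreal cB" by (rule mult_left_mono[OF \<nu>cB]) simp
    finally have "ennreal gauss_const * energy \<nu> \<nu> ?\<tau> \<le> ennreal gauss_const * (ennreal (K * c' * riesz_const (real m) t) * ennreal cB)"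
      by (rule mult_left_mono) simp
    also have "\<dots> = ennreal W"
      unfolding W_def using gauss_const_pos K0 c' riesz_const_nonneg[OF t] cB0 by (simp flip: ennreal_mult)
    finally show ?thesis
      unfolding G_def by (subst smear_pairing[OF \<nu>(1) \<nu>(1) \<nu>(2) \<nu>(2) \<delta>(1) \<delta>(1)])
  qed
  \<comment> \<open>By Tonelli, the mass of G on thick planes is the \<open>\<nu>\<close>-integral
    of the thick pencils \<open>\<psi> j\<close>, and \<open>\<nu>\<close> lives on
    \<open>E J\<close>.\<close>
  have thick: "(\<integral>\<^sup>+x. indicator (- U) x * ennreal (G x) \<partial>plane_bundle) \<le> ennreal (\<kappa> * cB)"
  proof -
    interpret Lb: pair_sigma_finite "lborel :: (real^'n) measure" \<gamma> ..
    interpret LV: pair_sigma_finite "(lborel :: (real^'n) measure) \<Otimes>\<^sub>M \<gamma>" \<nu> ..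
    let ?w = "\<lambda>x :: (real^'n) \<times> (real^'n) set. ennreal (fiber_weight (snd x) (fst x))"
    let ?g = "\<lambda>x z. indicator (- U) x * ennreal (gauss_kernel m \<delta> (snd x) (fst x - z))"
    have "(\<integral>\<^sup>+x. indicator (- U) x * ennreal (G x) \<partial>plane_bundle)
      = (\<integral>\<^sup>+x. ?w x * (indicator (- U) x * ennreal (G x)) \<partial>(lborel \<Otimes>\<^sub>M \<gamma>))"
      unfolding plane_bundle_def by (subst nn_integral_density) (auto simp: case_prod_beta')
    also have "\<dots> = (\<integral>\<^sup>+x. (\<integral>\<^sup>+z. ?w x * ?g x z \<partial>\<nu>) \<partial>(lborel \<Otimes>\<^sub>M \<gamma>))"
    proof (rule nn_integral_cong)
      fix x :: "(real^'n) \<times> (real^'n) set"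
      have [measurable]: "(\<lambda>z. gauss_kernel m \<delta> (snd x) (fst x - z)) \<in> borel_measurable \<nu>"
        using gauss_kernel_measurable_borel measurable_cong_sets[OF \<nu>(1) refl] by blast
      show "?w x * (indicator (- U) x * ennreal (G x)) = (\<integral>\<^sup>+z. ?w x * ?g x z \<partial>\<nu>)"
        unfolding G_def ennreal_smear[OF \<nu>(1,2) \<delta>(1)] by (simp add: nn_integral_cmult)
    qed
    also have "\<dots> = (\<integral>\<^sup>+z. (\<integral>\<^sup>+x. ?w x * ?g x z \<partial>(lborel \<Otimes>\<^sub>M \<gamma>)) \<partial>\<nu>)"
      by (rule LV.Fubini'[symmetric]) measurable
    also have "\<dots> = (\<integral>\<^sup>+z. \<psi> j z \<partial>\<nu>)"
      unfolding \<psi>_def plane_bundle_def \<delta>_def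
      by (rule nn_integral_cong, subst nn_integral_density) (auto simp: case_prod_beta')
    also have "\<dots> \<le> (\<integral>\<^sup>+z. ennreal \<kappa> \<partial>\<nu>)"
      using \<nu>(3) by (intro nn_integral_mono_AE, eventually_elim) (auto simp: E_def j_def)
    also have "\<dots> = ennreal \<kappa> * emeasure \<nu> UNIV" by (simp add: sp\<nu>)
    also have "\<dots> \<le> ennreal \<kappa> * ennreal cB" by (rule mult_left_mono[OF \<nu>cB]) simp
    also have "\<dots> = ennreal (\<kappa> * cB)" using \<kappa> cB0 by (intro ennreal_mult[symmetric]) auto
    finally show ?thesis .
  qed
  have amgm: "p * q \<le> \<rho> / 2 * p\<^sup>2 + 1 / (2 * \<rho>) * (q * q)" for p q :: real
  proof -
    have "0 \<le> (\<rho> * p - q)\<^sup>2 / (2 * \<rho>)" using \<rho>(1) by simp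
    also have "\<dots> = \<rho> / 2 * p\<^sup>2 + 1 / (2 * \<rho>) * (q * q) - p * q"
      using \<rho>(1) by (simp add: power2_eq_square field_simps)
    finally show ?thesis by simp
  qed
  \<comment> \<open>F is split as (F - Fi) + Fi. Closeness in the square mean handles the first
    part; for the second, Fi has small square mean on U and is at most L off U. F itself has no
    bound independent of j.\<close>
  have pt: "ennreal (F x * G x) \<le> ennreal (\<rho> / 2) * ennreal ((Fi x - F x)\<^sup>2) + ennreal (1 / \<rho>) * ennreal (G x * G x)
    + ennreal (\<rho> / 2) * (ennreal ((Fi x)\<^sup>2) * indicator U x) + ennreal L * (indicator (- U) x * ennreal (G x))" for x
  proof -
    have lam: "1 / \<rho> * (G x * G x) = 1 / (2 * \<rho>) * (G x * G x) + 1 / (2 * \<rho>) * (G x * G x)" by (simp add: field_simps)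
    have 1: "(F x - Fi x) * G x \<le> \<rho> / 2 * (Fi x - F x)\<^sup>2 + 1 / (2 * \<rho>) * (G x * G x)"
      using amgm[of "F x - Fi x" "G x"] by (simp add: power2_commute)
    have 0: "0 \<le> 1 / (2 * \<rho>) * (G x * G x)" using \<rho>(1) by simp
    have split: "F x * G x = (F x - Fi x) * G x + Fi x * G x" by (simp add: algebra_simps)
    have "F x * G x \<le> \<rho> / 2 * (Fi x - F x)\<^sup>2 + 1 / \<rho> * (G x * G x) + \<rho> / 2 * ((Fi x)\<^sup>2 * indicator U x) + L * (indicator (- U) x * G x)"
    proof (cases "x \<in> U")
      case True
      then show ?thesis using 1 amgm[of "Fi x" "G x"] unfolding split lam by simp
    next
      case False
      have "Fi x * G x \<le> L * G x" using L(2)[of x] nn by (intro mult_right_mono) (auto simp: Fi_def)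
      then show ?thesis using False 0 1 unfolding split lam by simp
    qed
    then have "ennreal (F x * G x) \<le> ennreal (\<rho> / 2 * (Fi x - F x)\<^sup>2 + 1 / \<rho> * (G x * G x) + \<rho> / 2 * ((Fi x)\<^sup>2 * indicator U x) + L * (indicator (- U) x * G x))"
      by (rule ennreal_leI)
    also have "\<dots> = ennreal (\<rho> / 2 * (Fi x - F x)\<^sup>2) + ennreal (1 / \<rho> * (G x * G x)) + ennreal (\<rho> / 2 * ((Fi x)\<^sup>2 * indicator U x)) + ennreal (L * (indicator (- U) x * G x))"
      using \<rho>(1) L(1) nn[of x] by (simp add: ennreal_plus)
    also have "ennreal (\<rho> / 2 * (Fi x - F x)\<^sup>2) = ennreal (\<rho> / 2) * ennreal ((Fi x - F x)\<^sup>2)"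
      using \<rho>(1) by (intro ennreal_mult) auto
    also have "ennreal (1 / \<rho> * (G x * G x)) = ennreal (1 / \<rho>) * ennreal (G x * G x)"
      using \<rho>(1) by (intro ennreal_mult) auto
    also have "ennreal (\<rho> / 2 * ((Fi x)\<^sup>2 * indicator U x)) = ennreal (\<rho> / 2) * (ennreal ((Fi x)\<^sup>2) * indicator U x)"
      using \<rho>(1) by (subst ennreal_mult) (auto simp: indicator_def)
    also have "ennreal (L * (indicator (- U) x * G x)) = ennreal L * (indicator (- U) x * ennreal (G x))"
      using L(1) nn[of x] by (subst ennreal_mult) (auto simp: indicator_def)
    finally show ?thesis .
  qed
  have "ennreal T \<le> (\<integral>\<^sup>+x. ennreal (F x * G x) \<partial>plane_bundle)" by (rule lower)
  also have "\<dots> \<le> (\<integral>\<^sup>+x. ennreal (\<rho> / 2) * ennreal ((Fi x - F x)\<^sup>2) + ennreal (1 / \<rho>) * ennreal (G x * G x)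
    + ennreal (\<rho> / 2) * (ennreal ((Fi x)\<^sup>2) * indicator U x) + ennreal L * (indicator (- U) x * ennreal (G x)) \<partial>plane_bundle)"
    by (intro nn_integral_mono pt)
  also have "\<dots> = ennreal (\<rho> / 2) * (\<integral>\<^sup>+x. ennreal ((Fi x - F x)\<^sup>2) \<partial>plane_bundle) + ennreal (1 / \<rho>) * (\<integral>\<^sup>+x. ennreal (G x * G x) \<partial>plane_bundle)
    + ennreal (\<rho> / 2) * (\<integral>\<^sup>+x. ennreal ((Fi x)\<^sup>2) * indicator U x \<partial>plane_bundle) + ennreal L * (\<integral>\<^sup>+x. indicator (- U) x * ennreal (G x) \<partial>plane_bundle)"
    by (simp add: nn_integral_add nn_integral_cmult)
  also have "\<dots> \<le> ennreal (\<rho> / 2) * ennreal \<epsilon> + ennreal (1 / \<rho>) * ennreal W + ennreal (\<rho> / 2) * ennreal (3 * \<epsilon>) + ennreal L * ennreal (\<kappa> * cB)"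
    using GG thinF thick diff[of j] unfolding F_def Fi_def \<delta>_def
    by (intro add_mono mult_left_mono) (auto simp: j_def)
  also have "\<dots> = ennreal (\<rho> / 2 * \<epsilon>) + ennreal (1 / \<rho> * W) + ennreal (\<rho> / 2 * (3 * \<epsilon>)) + ennreal (L * (\<kappa> * cB))"
    using \<rho>(1) \<epsilon>(1) W0 L(1) \<kappa> cB0 by (intro arg_cong2[where f = "(+)"] ennreal_mult[symmetric]) auto
  also have "\<dots> = ennreal (\<rho> / 2 * \<epsilon> + 1 / \<rho> * W + \<rho> / 2 * (3 * \<epsilon>) + L * (\<kappa> * cB))"
  proof -
    have "0 \<le> \<rho> / 2 * \<epsilon>" "0 \<le> 1 / \<rho> * W" "0 \<le> \<rho> / 2 * (3 * \<epsilon>)" "0 \<le> L * (\<kappa> * cB)"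
      using \<rho>(1) \<epsilon>(1) W0 L(1) \<kappa> cB0 by auto
    then show ?thesis by (simp only: ennreal_plus add_nonneg_nonneg)
  qed
  finally have "T \<le> \<rho> / 2 * \<epsilon> + 1 / \<rho> * W + \<rho> / 2 * (3 * \<epsilon>) + L * (\<kappa> * cB)"
    using \<rho>(1) \<epsilon>(1) W0 L(1) \<kappa> cB0 by (subst (asm) ennreal_le_iff) (auto intro!: add_nonneg_nonneg)
  moreover have "\<rho> / 2 * \<epsilon> + \<rho> / 2 * (3 * \<epsilon>) = T / 4" using \<epsilon>(2) by (simp add: mult_ac)
  moreover have "1 / \<rho> * W \<le> T / 4" using \<rho>(2) by simp
  moreover have "L * (\<kappa> * cB) \<le> T / 4"
  proof -
    have "L * (\<kappa> * cB) = T / 4 * (cB / (cB + 1))" using L(1) cB0 by (simp add: \<kappa>_def)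
    also have "\<dots> \<le> T / 4 * 1" using T cB0 by (intro mult_left_mono) auto
    finally show ?thesis by simp
  qed
  ultimately show False using T by linarith
qed

end

section \<open>Hausdorff dimension and the conclusion\<close>

lemma hausdorff_dim_le:
  assumes u: "0 \<le> u" and zero: "\<And>t. u < t \<Longrightarrow> hausdorff_measure t X = 0"
  shows "hausdorff_dim X \<le> u"
proof (rule dense_ge)
  fix t assume "u < t"
  then show "hausdorff_dim X \<le> t"
    unfolding hausdorff_dim_def using u zero[of t] by (intro cInf_lower) (auto intro: bdd_belowI[of _ 0])
qed

text \<open>The exponent u, possibly far above the dimension, guarantees that the infimum defining
  the dimension is taken over a nonempty set.\<close>

lemma hausdorff_measure_zero_above_dim:
  assumes zero: "0 \<le> u" "hausdorff_measure u X = 0" and t: "hausdorff_dim X < t"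
  shows "hausdorff_measure t X = 0"
proof -
  have "bdd_below {t. 0 \<le> t \<and> hausdorff_measure t X = 0}" by (rule bdd_belowI[of _ 0]) simp
  moreover have "{t. 0 \<le> t \<and> hausdorff_measure t X = 0} \<noteq> {}" using zero by blast
  ultimately obtain r where r: "0 \<le> r" "hausdorff_measure r X = 0" "r < t"
    using t unfolding hausdorff_dim_def by (auto simp: cInf_less_iff)
  then show ?thesis using hausdorff_measure_antimono_dim[of r t X] by simp
qed

theorem theorem1p3:
  fixes A :: "(real ^ 'n) set" and m :: nat and s :: real
    and \<gamma> :: "(real ^ 'n) set measure"
  assumes "0 < m" and "m < CARD('n)"
    and "real m < s" and "s \<le> real CARD('n)"
    and "hausdorff_measurable s A"
    and "0 < hausdorff_measure s A" and "hausdorff_measure s A < \<infinity>"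
    and "grass_invariant_prob (CARD('n) - m) \<gamma>"
  shows "hausdorff_dim
           {x. AE V in \<gamma>. hausdorff_dim (A \<inter> (\<lambda>v. v + x) ` V) \<noteq> s - real m}
         \<le> real m"
proof -
  interpret prob_space \<gamma> using assms(8) by (simp add: grass_invariant_prob_def)
  interpret invariant_grassmannian \<gamma> m using assms by unfold_locales
  let ?B = "{x. AE V in \<gamma>. hausdorff_dim (A \<inter> (\<lambda>v. v + x) ` V) \<noteq> s - real m}"
  have s0: "0 < s" using assms(3) by linarith
  obtain C \<mu> c where C: "compact C" "C \<subseteq> A" and \<mu>: "sets \<mu> = sets borel" "finite_measure \<mu>" "emeasure \<mu> (- C) = 0"
    "0 < emeasure \<mu> UNIV" and c: "0 \<le> c" "\<And>x k. x \<in> C \<Longrightarrow> emeasure \<mu> (cball x (1 / 2 ^ k)) \<le> ennreal (c * (1 / 2 ^ k) powr s)"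
    "emeasure \<mu> UNIV \<le> ennreal c"
    using frostman_subset[OF s0 assms(5-7)] by metis
  obtain D :: "(real^'n) set" where D: "countable D" "\<And>X. open X \<Longrightarrow> X \<noteq> {} \<Longrightarrow> \<exists>d\<in>D. d \<in> X"
    by (rule countable_dense_setE) blast
  \<comment> \<open>Exponents increasing to s - m: a dimension below s - m is below some
    \<open>\<tau> k\<close>, and a countable family keeps the union of thin slices
    measurable.\<close>
  define \<tau> where "\<tau> k = (s - real m) * (1 - 1 / real (k + 2))" for k
  have \<tau>: "0 < \<tau> k" "\<tau> k < s - real m" for k
  proof -
    have "0 < 1 - 1 / real (k + 2)" "1 - 1 / real (k + 2) < 1" by simp_all
    from mult_pos_pos[OF _ this(1), of "s - real m"] mult_strict_left_mono[OF this(2), of "s - real m"]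
    show "0 < \<tau> k" "\<tau> k < s - real m" using assms(3) by (simp_all add: \<tau>_def)
  qed
  have bad: "AE V in \<gamma>. \<exists>k. \<forall>a>0. (x, V) \<in> thin_slices D C (\<tau> k) a" if "x \<in> ?B" for x
  proof -
    from that have "AE V in \<gamma>. hausdorff_dim (A \<inter> (\<lambda>v. v + x) ` V) \<noteq> s - real m" by simp
    with slices_null_above[OF assms(7,3), of x] AE_space show ?thesis
    proof eventually_elim
      fix V
      let ?X = "A \<inter> (\<lambda>v. v + x) ` V"
      assume V: "\<forall>t>s - real m. hausdorff_measure t ?X = 0" "V \<in> space \<gamma>" "hausdorff_dim ?X \<noteq> s - real m"
      have "hausdorff_dim ?X \<le> s - real m" using V(1) assms(3) by (intro hausdorff_dim_le) auto
      with V(3) have dim: "hausdorff_dim ?X < s - real m" by simp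
      have "(\<lambda>k. 1 / real (k + 2)) \<longlonglongrightarrow> 0"
        using LIMSEQ_ignore_initial_segment[OF lim_inverse_n, of 2] by (simp add: inverse_eq_divide)
      then have "(\<lambda>k. (s - real m) * (1 - 1 / real (k + 2))) \<longlonglongrightarrow> (s - real m) * (1 - 0)" by (intro tendsto_intros)
      then have "\<tau> \<longlonglongrightarrow> s - real m" by (simp add: \<tau>_def[abs_def])
      from order_tendstoD(1)[OF this dim] obtain k where k: "hausdorff_dim ?X < \<tau> k"
        by (auto dest: eventually_happens)
      have "hausdorff_measure (\<tau> k) ?X = 0"
        using V(1) assms(3) by (intro hausdorff_measure_zero_above_dim[OF _ _ k, of "s - real m + 1"]) auto
      moreover have "hausdorff_measure (\<tau> k) (C \<inter> (\<lambda>v. v + x) ` V) \<le> hausdorff_measure (\<tau> k) ?X"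
        using C(2) by (intro hausdorff_measure_mono) auto
      ultimately have "hausdorff_measure (\<tau> k) (C \<inter> (\<lambda>v. v + x) ` V) = 0" by simp
      then show "\<exists>k. \<forall>a>0. (x, V) \<in> thin_slices D C (\<tau> k) a"
        using thin_slices_if_null[OF C(1) subspace_gamma[OF V(2)] \<tau>(1) _ D(2)] by blast
    qed
  qed
  show ?thesis
  proof (rule hausdorff_dim_le)
    fix t assume t: "real m < t"
    \<comment> \<open>Bounded pieces, since a discrete Frostman measure is built from the finitely
      many dyadic cells that the set meets.\<close>
    have "hausdorff_measure t (?B \<inter> cball 0 (real i)) = 0" for i
    proof (rule hausdorff_measure_zero_if_dyadic_content_zero)
      show "0 < t" using t by linarith
      show "dyadic_content t (?B \<inter> cball 0 (real i)) = 0"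
      proof (rule exceptional_set_null[where \<tau> = \<tau>, OF \<mu>(1,2) C(1) \<mu>(3,4) c assms(3) D(1) less_imp_le[OF \<tau>(1)] \<tau>(2) _ t])
        show "bounded (?B \<inter> cball 0 (real i))" by (intro bounded_Int) auto
      qed (assumption | rule bad, simp)+
    qed
    then have "hausdorff_measure t (\<Union>i. ?B \<inter> cball 0 (real i)) = 0" by (rule hausdorff_measure_null_UN)
    moreover have "(\<Union>i. ?B \<inter> cball 0 (real i)) = ?B" by (auto intro: real_arch_simple)
    ultimately show "hausdorff_measure t ?B = 0" by simp
  qed simp
qed

end
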